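(* Let $K$ be a finite set with $|K|\ge 2$, $\tau\in L[K]$, $1_\tau=\min_\tau K$, $m_\tau=\max_\tau K$. Then in $\mathbf{scf}(U)$ $$S\big(\chi^{(\tau,1_\tau\frown m_\tau)}\big)=\sum_{\phi\in L[K]}\ \sum_{\mu}(-1)^s(q-1)^{s-1}z^\mu_{\phi,\tau}(q-1)\,\chi^{(\phi,\mu)},$$ where the inner sum is over all $\mu\in\mathcal S^\phi\cap\mathcal S^\tau$ for which $\phi$ admits a factorization of the form described below, and $s$, $z^\mu_{\phi,\tau}$ are computed from that factorization.
   Context: Fix a prime power $q$. For a finite set $K$, $L[K]$ is the set of linear orders on $K$; an order $\phi$ is identified with the word listing $K$ in increasing order ($i\prec_\phi j$: $i$ before $j$). $\phi|_J$ is restriction, $\phi\tau$ concatenation of orders on disjoint sets. For $\phi\in L[K]$, a set partition w.r.t. $\phi$ is a set $\lambda$ of arcs $i\frown j$ with $i\frown j\in\lambda\Rightarrow i\prec_\phi j$ and, for $i\frown l,j\frown k\in\lambda$, $i=j$ iff $k=l$; $\mathcal S^\phi$ is the set of these. $\lambda_J=\{i\frown j\in\lambda: i,j\in J\}$. $U^\phi$ is the group of invertible $\mathbb F_q$-matrices indexed by $K$ with $u_{ii}=1$, $u_{ij}=0$ unless $i=j$ or $i\prec_\phi j$; $u,v$ lie in the same superclass if $v-1=ta(u-1)b^{-1}t^{-1}$ ($a,b\in U^\phi$, $t$ invertible diagonal); superclasses are indexed by $\mu\in\mathcal S^\phi$ (containing $1+\sum_{i\frown j\in\mu}e_{ij}$);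 $\mathrm{scf}^\phi$ is the space of functions on $U^\phi$ constant on superclasses. The Hopf monoid $\mathbf{scf}(U)$ has $\mathbf{scf}(U)[K]=\bigoplus_{\phi\in L[K]}\mathrm{scf}^\phi$, product by inflation along $U^{\phi\tau}\to U^\phi\times U^\tau$ (diagonal blocks), coproduct $\Delta_{I,J}$ by restriction to the block-diagonal subgroup $U^{\phi|_I}\times U^{\phi|_J}$; $S$ is its antipode. Put $\dim(\phi,\lambda)=\sum_{i\frown k\in\lambda}\#\{j: i\prec_\phi j\preceq_\phi k\}$ and $\mathrm{nst}^\lambda_\mu=\#\{(i\frown l,j\frown k)\in\lambda\times\mu: i\prec_\phi j\prec_\phi k\prec_\phi l\}$. The supercharacter $\chi^{(\phi,\lambda)}\in\mathrm{scf}^\phi$ ($\lambda\in\mathcal S^\phi$) takes on superclass $\mu$ the value $(-1)^{|\lambda\cap\mu|}q^{\dim(\phi,\lambda)-|\lambda|}(q-1)^{|\lambda\setminus\mu|}q^{-\mathrm{nst}^\lambda_\mu}$ if there are no $i\prec_\phi j\prec_\phi k$ with $i\frown k\in\lambda$ and $i\frown j\in\mu$ or $j\frown k\in\mu$, and $0$ otherwise; these form a basis of $\mathrm{scf}^\phi$. Factorization: $\phi$ is written as a concatenation of words $\phi=\phi_0(a_1\psi_1b_1)\phi_1(a_2\psi_2b_2)\phi_2\cdots\phi_{s-1}(a_s\psi_sb_s)\phi_s$ ($s\ge1$; the $\phi_i,\psi_i$ possibly empty), where for each $i$ either $a_i\neq b_i$, or $a_i=b_i\in\{1_\tau,m_\tau\}$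 and then $a_i\psi_ib_i$ stands for the single letter $a_i$; and (1) $\mu=\{a_i\frown b_i:1\le i\le s,\ a_i\neq b_i\}$; (2) each $a_i\psi_ib_i$ is increasing with respect to $\tau$; (3) $1_\tau\in\{a_1,\dots,a_s\}$ and $m_\tau\in\{b_1,\dots,b_s\}$. Statistics: adjoin two new letters $b_0$ and $a_{s+1}$ and extend $\tau$ so that $a_{s+1}$ is smallest and $b_0$ largest. For $0\le i\le s$ factor the word $b_i\phi_ia_{i+1}$ into maximal rising subsequences w.r.t. $\tau$: $b_i\phi_ia_{i+1}=\phi^{(i,1)}\cdots\phi^{(i,l_i)}$, with $\ell(w)$ denoting the length of a word $w$. Let $\mathrm{mt}^\mu_\tau(\phi)=\sum_{(i,j):\ \ell(\phi^{(i,j)})>1}(\ell(\phi^{(i,j)})-2)$, $\mathrm{io}^\mu_\tau(\phi)=\sum_{i=0}^s\#\{2\le j\le l_i-1:\ell(\phi^{(i,j)})=1\}$, $\mathrm{rst}^\mu_\tau(\phi)=\sum_{j=0}^s\ell(\phi_j)-\mathrm{mt}^\mu_\tau(\phi)-\mathrm{io}^\mu_\tau(\phi)$, and $z^\mu_{\phi,\tau}(t)=(t-1)^{\mathrm{mt}^\mu_\tau(\phi)}t^{\mathrm{rst}^\mu_\tau(\phi)}(t+1)^{\mathrm{io}^\mu_\tau(\phi)}$.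
   Formalization: The sign (-1)^s is replaced by (-1)^(s+ℓ(φ_0)+...+ℓ(φ_s)); with (-1)^s the formula fails for τ=123 at φ=321, where s=2 and the component of the antipode is -q(q-1), not +q(q-1), times the trivial character. *)

theory Defs
  imports Complex_Main "HOL-Combinatorics.Multiset_Permutations" "HOL-Library.Cardinality"
begin

text \<open>
  A linear order on a finite set \<open>K\<close> is the word listing \<open>K\<close> in increasing order, so
  \<open>L[K]\<close> is \<^term>\<open>permutations_of_set K\<close>. The field with \<open>q\<close> elements is a finite field
  type \<open>'f\<close>, with \<open>q = CARD('f)\<close>; functions on groups are complex-valued.
\<close>

definition precedes :: "'a list \<Rightarrow> 'a \<Rightarrow> 'a \<Rightarrow> bool" where
  "precedes \<phi> i j \<longleftrightarrow> (\<exists>m n. m < n \<and> n < length \<phi> \<and> \<phi> ! m = i \<and> \<phi> ! n = j)"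

definition restr :: "'a set \<Rightarrow> 'a list \<Rightarrow> 'a list" where
  "restr J \<phi> = filter (\<lambda>x. x \<in> J) \<phi>"

text \<open>An arc from \<open>i\<close> to \<open>j\<close> is the pair \<open>(i, j)\<close>.\<close>

definition set_partitions :: "'a list \<Rightarrow> ('a \<times> 'a) set set" where
  "set_partitions \<phi> = {\<Lambda>. (\<forall>(i, j) \<in> \<Lambda>. precedes \<phi> i j) \<and>
     (\<forall>(i, l) \<in> \<Lambda>. \<forall>(j, k) \<in> \<Lambda>. i = j \<longleftrightarrow> k = l)}"


section \<open>The groups and their superclass functions\<close>

text \<open>A matrix indexed by \<open>K\<close> is a function of two indices that vanishes outside \<open>K \<times> K\<close>.\<close>

type_synonym ('a, 'f) matr = "'a \<Rightarrow> 'a \<Rightarrow> 'f"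

definition matrices :: "'a set \<Rightarrow> ('a, 'f::field) matr set" where
  "matrices K = {u. \<forall>i j. i \<notin> K \<or> j \<notin> K \<longrightarrow> u i j = 0}"

definition mat_one :: "'a set \<Rightarrow> ('a, 'f::field) matr" where
  "mat_one K = (\<lambda>i j. if i = j \<and> i \<in> K then 1 else 0)"

definition mat_mult :: "'a set \<Rightarrow> ('a, 'f::field) matr \<Rightarrow> ('a, 'f) matr \<Rightarrow> ('a, 'f) matr" where
  "mat_mult K u v = (\<lambda>i j. \<Sum>k\<in>K. u i k * v k j)"

definition mat_minus :: "('a, 'f::field) matr \<Rightarrow> ('a, 'f) matr \<Rightarrow> ('a, 'f) matr" where
  "mat_minus u v = (\<lambda>i j. u i j - v i j)"

definition arc_mat :: "'a set \<Rightarrow> ('a \<times> 'a) set \<Rightarrow> ('a, 'f::field) matr" where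
  "arc_mat K \<mu> = (\<lambda>i j. mat_one K i j + (if (i, j) \<in> \<mu> then 1 else 0))"

text \<open>Invertibility need not be required: these matrices are unitriangular along \<open>\<phi>\<close>.\<close>

definition unitri :: "'a list \<Rightarrow> ('a, 'f::field) matr set" where
  "unitri \<phi> = {u \<in> matrices (set \<phi>). (\<forall>i \<in> set \<phi>. u i i = 1) \<and>
     (\<forall>i \<in> set \<phi>. \<forall>j \<in> set \<phi>. u i j \<noteq> 0 \<longrightarrow> i = j \<or> precedes \<phi> i j)}"

text \<open>
  The relation \<open>v - 1 = t a (u - 1) b\<inverse> t\<inverse>\<close>, where \<open>b'\<close> is the inverse of \<open>b\<close> and the
  diagonal matrix is given by its diagonal \<open>t\<close>.
\<close>

definition same_superclass :: "'a list \<Rightarrow> ('a, 'f::field) matr \<Rightarrow> ('a, 'f) matr \<Rightarrow> bool" where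
  "same_superclass \<phi> u v \<longleftrightarrow> u \<in> unitri \<phi> \<and> v \<in> unitri \<phi> \<and>
     (\<exists>a \<in> unitri \<phi>. \<exists>b \<in> unitri \<phi>. \<exists>b' \<in> unitri \<phi>. \<exists>t.
        mat_mult (set \<phi>) b b' = mat_one (set \<phi>) \<and>
        mat_mult (set \<phi>) b' b = mat_one (set \<phi>) \<and>
        (\<forall>i \<in> set \<phi>. t i \<noteq> 0) \<and>
        (\<forall>i \<in> set \<phi>. \<forall>j \<in> set \<phi>. mat_minus v (mat_one (set \<phi>)) i j =
           t i * mat_mult (set \<phi>) (mat_mult (set \<phi>) a (mat_minus u (mat_one (set \<phi>)))) b' i j
             * inverse (t j)))"

definition scf :: "'a list \<Rightarrow> (('a, 'f::field) matr \<Rightarrow> complex) set" where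
  "scf \<phi> = {f. (\<forall>u. u \<notin> unitri \<phi> \<longrightarrow> f u = 0) \<and>
     (\<forall>u v. same_superclass \<phi> u v \<longrightarrow> f u = f v)}"


section \<open>The Hopf monoid of superclass functions\<close>

text \<open>
  An element of the direct sum is the family of its components, indexed by words.
  Likewise the tensor product of the spaces at \<open>I\<close> and \<open>J\<close> is the direct sum over
  \<open>(\<alpha>, \<beta>)\<close> of \<open>scf \<alpha> \<otimes> scf \<beta>\<close>, and the latter consists of functions on the product of the
  groups \<open>unitri \<alpha>\<close> and \<open>unitri \<beta>\<close>.
\<close>

type_synonym ('a, 'f) family = "'a list \<Rightarrow> ('a, 'f) matr \<Rightarrow> complex"
type_synonym ('a, 'f) family2 =
  "'a list \<Rightarrow> 'a list \<Rightarrow> ('a, 'f) matr \<Rightarrow> ('a, 'f) matr \<Rightarrow> complex"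

definition scfU :: "'a set \<Rightarrow> ('a, 'f::field) family set" where
  "scfU K = {F. (\<forall>\<phi> \<in> permutations_of_set K. F \<phi> \<in> scf \<phi>) \<and>
     (\<forall>\<phi>. \<phi> \<notin> permutations_of_set K \<longrightarrow> F \<phi> = (\<lambda>_. 0))}"

definition diag_block :: "'a set \<Rightarrow> ('a, 'f::field) matr \<Rightarrow> ('a, 'f) matr" where
  "diag_block J u = (\<lambda>i j. if i \<in> J \<and> j \<in> J then u i j else 0)"

definition block_sum :: "('a, 'f::field) matr \<Rightarrow> ('a, 'f) matr \<Rightarrow> ('a, 'f) matr" where
  "block_sum u v = (\<lambda>i j. u i j + v i j)"

text \<open>
  The product (on the tensor product) and the coproduct, for disjoint \<open>I\<close> and \<open>J\<close>. The
  component at \<open>(\<alpha>, \<beta>)\<close> of the coproduct collects the restrictions from all \<open>\<phi>\<close> with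
  \<open>\<phi>|\<^sub>I = \<alpha>\<close> and \<open>\<phi>|\<^sub>J = \<beta>\<close>.
\<close>

definition hm_mult :: "'a set \<Rightarrow> 'a set \<Rightarrow> ('a, 'f::field) family2 \<Rightarrow> ('a, 'f) family" where
  "hm_mult I J T = (\<lambda>\<rho> w.
     if \<rho> \<in> permutations_of_set (I \<union> J) \<and> \<rho> = restr I \<rho> @ restr J \<rho> \<and> w \<in> unitri \<rho>
     then T (restr I \<rho>) (restr J \<rho>) (diag_block I w) (diag_block J w) else 0)"

definition hm_comult :: "'a set \<Rightarrow> 'a set \<Rightarrow> ('a, 'f::field) family \<Rightarrow> ('a, 'f) family2" where
  "hm_comult I J F = (\<lambda>\<alpha> \<beta> u v.
     if \<alpha> \<in> permutations_of_set I \<and> \<beta> \<in> permutations_of_set J \<and> u \<in> unitri \<alpha> \<and> v \<in> unitri \<beta>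
     then \<Sum>\<phi> \<in> {\<phi> \<in> permutations_of_set (I \<union> J). restr I \<phi> = \<alpha> \<and> restr J \<phi> = \<beta>}.
            F \<phi> (block_sum u v)
     else 0)"

text \<open>\<open>f \<otimes> g\<close> applies \<open>g\<close> in the second variables and \<open>f\<close> in the first ones.\<close>

definition tensor_map ::
  "(('a, 'f::field) family \<Rightarrow> ('a, 'f) family) \<Rightarrow> (('a, 'f) family \<Rightarrow> ('a, 'f) family) \<Rightarrow>
     ('a, 'f) family2 \<Rightarrow> ('a, 'f) family2" where
  "tensor_map f g T = (\<lambda>\<alpha> \<beta> u v. f (\<lambda>\<alpha>' u'. g (\<lambda>\<beta>' v'. T \<alpha>' \<beta>' u' v') \<beta> v) \<alpha> u)"

definition convolution ::
  "('a set \<Rightarrow> ('a, 'f::field) family \<Rightarrow> ('a, 'f) family) \<Rightarrow>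
   ('a set \<Rightarrow> ('a, 'f) family \<Rightarrow> ('a, 'f) family) \<Rightarrow>
   'a set \<Rightarrow> ('a, 'f) family \<Rightarrow> ('a, 'f) family" where
  "convolution f g K F = (\<lambda>\<rho> w. \<Sum>I \<in> Pow K.
     hm_mult I (K - I) (tensor_map (f I) (g (K - I)) (hm_comult I (K - I) F)) \<rho> w)"

text \<open>
  Unit after counit. The space at the empty set is one-dimensional, so there the composite is
  the identity; elsewhere it vanishes.
\<close>

definition unit_counit :: "'a set \<Rightarrow> ('a, 'f::field) family \<Rightarrow> ('a, 'f) family" where
  "unit_counit K F = (if K = {} then F else (\<lambda>_ _. 0))"

definition is_antipode :: "('a set \<Rightarrow> ('a, 'f::field) family \<Rightarrow> ('a, 'f) family) \<Rightarrow> bool" where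
  "is_antipode S \<longleftrightarrow> (\<forall>K. finite K \<longrightarrow>
     (\<forall>F \<in> scfU K. S K F \<in> scfU K) \<and>
     (\<forall>F \<in> scfU K. \<forall>G \<in> scfU K. \<forall>c.
        S K (\<lambda>\<phi> u. F \<phi> u + c * G \<phi> u) = (\<lambda>\<phi> u. S K F \<phi> u + c * S K G \<phi> u)) \<and>
     (\<forall>F \<in> scfU K. convolution S (\<lambda>_ G. G) K F = unit_counit K F \<and>
                    convolution (\<lambda>_ G. G) S K F = unit_counit K F))"

text \<open>
  Being a two-sided convolution inverse of the identity, an antipode is uniquely determined on
  \<^term>\<open>scfU K\<close> for every finite \<open>K\<close> (hence also natural in \<open>K\<close>); the choice only affects
  arguments outside these spaces.
\<close>

definition antipode :: "'a set \<Rightarrow> ('a, 'f::field) family \<Rightarrow> ('a, 'f) family" where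
  "antipode = (SOME S. is_antipode S)"


section \<open>Supercharacters\<close>

definition arc_dim :: "'a list \<Rightarrow> ('a \<times> 'a) set \<Rightarrow> nat" where
  "arc_dim \<phi> \<Lambda> = (\<Sum>(i, k) \<in> \<Lambda>. card {j. precedes \<phi> i j \<and> (precedes \<phi> j k \<or> j = k)})"

definition nst :: "'a list \<Rightarrow> ('a \<times> 'a) set \<Rightarrow> ('a \<times> 'a) set \<Rightarrow> nat" where
  "nst \<phi> \<Lambda> \<mu> = card {((i, l), (j, k)) | i j k l. (i, l) \<in> \<Lambda> \<and> (j, k) \<in> \<mu> \<and>
     precedes \<phi> i j \<and> precedes \<phi> j k \<and> precedes \<phi> k l}"

definition supervalue :: "nat \<Rightarrow> 'a list \<Rightarrow> ('a \<times> 'a) set \<Rightarrow> ('a \<times> 'a) set \<Rightarrow> complex" where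
  "supervalue q \<phi> \<Lambda> \<mu> =
     (if \<exists>i j k. precedes \<phi> i j \<and> precedes \<phi> j k \<and> (i, k) \<in> \<Lambda> \<and> ((i, j) \<in> \<mu> \<or> (j, k) \<in> \<mu>)
      then 0
      else (-1) ^ card (\<Lambda> \<inter> \<mu>) * of_nat q powi (int (arc_dim \<phi> \<Lambda>) - int (card \<Lambda>))
        * (of_nat q - 1) ^ card (\<Lambda> - \<mu>) * of_nat q powi (- int (nst \<phi> \<Lambda> \<mu>)))"

definition superclass_index :: "'a list \<Rightarrow> ('a, 'f::field) matr \<Rightarrow> ('a \<times> 'a) set" where
  "superclass_index \<phi> u =
     (THE \<mu>. \<mu> \<in> set_partitions \<phi> \<and> same_superclass \<phi> (arc_mat (set \<phi>) \<mu>) u)"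

text \<open>The supercharacter as an element of the direct sum, concentrated in the component \<open>\<phi>\<close>.\<close>

definition supercharacter ::
  "'a list \<Rightarrow> ('a \<times> 'a) set \<Rightarrow> ('a, 'f::{finite, field}) family" where
  "supercharacter \<phi> \<Lambda> = (\<lambda>\<psi> u. if \<psi> = \<phi> \<and> u \<in> unitri \<phi>
     then supervalue CARD('f) \<phi> \<Lambda> (superclass_index \<phi> u) else 0)"


section \<open>Factorizations and their statistics\<close>

text \<open>
  A factorization is given by the words \<open>ps = [\<phi>\<^sub>0, \<dots>, \<phi>\<^sub>s]\<close> and the blocks
  \<open>ws = [a\<^sub>1\<psi>\<^sub>1b\<^sub>1, \<dots>, a\<^sub>s\<psi>\<^sub>sb\<^sub>s]\<close>, so that \<open>a\<^sub>i\<close> and \<open>b\<^sub>i\<close> are the first and last letters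
  of the \<open>i\<close>-th block.
\<close>

definition is_factorization ::
  "'a list \<Rightarrow> 'a list \<Rightarrow> ('a \<times> 'a) set \<Rightarrow> 'a list list \<Rightarrow> 'a list list \<Rightarrow> bool" where
  "is_factorization \<tau> \<phi> \<mu> ps ws \<longleftrightarrow>
     length ws \<ge> 1 \<and> length ps = length ws + 1 \<and>
     \<phi> = hd ps @ concat (map2 (@) ws (tl ps)) \<and>
     (\<forall>w \<in> set ws. w \<noteq> [] \<and> (hd w = last w \<longrightarrow> w = [hd w] \<and> hd w \<in> {hd \<tau>, last \<tau>})) \<and>
     \<mu> = {(hd w, last w) | w. w \<in> set ws \<and> hd w \<noteq> last w} \<and>
     (\<forall>w \<in> set ws. sorted_wrt (precedes \<tau>) w) \<and>
     hd \<tau> \<in> hd ` set ws \<and> last \<tau> \<in> last ` set ws"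

text \<open>A factorization is determined by \<open>\<tau>\<close>, \<open>\<phi>\<close> and \<open>\<mu>\<close> if \<open>\<tau>\<close> has at least two letters.\<close>

definition factorization ::
  "'a list \<Rightarrow> 'a list \<Rightarrow> ('a \<times> 'a) set \<Rightarrow> 'a list list \<times> 'a list list" where
  "factorization \<tau> \<phi> \<mu> = (THE (ps, ws). is_factorization \<tau> \<phi> \<mu> ps ws)"

text \<open>The alphabet with the letters \<open>a\<^bsub>s+1\<^esub>\<close> (smallest) and \<open>b\<^sub>0\<close> (largest) adjoined.\<close>

datatype 'a letter = Bot | Letter 'a | Top

definition ext_order :: "'a list \<Rightarrow> 'a letter list" where
  "ext_order \<tau> = Bot # map Letter \<tau> @ [Top]"

fun rising_runs :: "('b \<Rightarrow> 'b \<Rightarrow> bool) \<Rightarrow> 'b list \<Rightarrow> 'b list list" where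
  "rising_runs R [] = []"
| "rising_runs R [x] = [[x]]"
| "rising_runs R (x # y # w) =
     (let rs = rising_runs R (y # w) in
      if R x y then (x # hd rs) # tl rs else [x] # rs)"

text \<open>The runs of the word \<open>b\<^sub>i\<phi>\<^sub>ia\<^bsub>i+1\<^esub>\<close>.\<close>

definition gap_runs ::
  "'a list \<Rightarrow> 'a list list \<Rightarrow> 'a list list \<Rightarrow> nat \<Rightarrow> 'a letter list list" where
  "gap_runs \<tau> ps ws i = rising_runs (precedes (ext_order \<tau>))
     ([if i = 0 then Top else Letter (last (ws ! (i - 1)))] @ map Letter (ps ! i) @
      [if i = length ws then Bot else Letter (hd (ws ! i))])"

definition stat_mt :: "'a list \<Rightarrow> 'a list list \<Rightarrow> 'a list list \<Rightarrow> nat" where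
  "stat_mt \<tau> ps ws = (\<Sum>i \<le> length ws.
     \<Sum>j \<in> {j. j < length (gap_runs \<tau> ps ws i) \<and> length (gap_runs \<tau> ps ws i ! j) > 1}.
       length (gap_runs \<tau> ps ws i ! j) - 2)"

text \<open>With runs numbered from 0, this excludes the first and the last run of each word.\<close>

definition stat_io :: "'a list \<Rightarrow> 'a list list \<Rightarrow> 'a list list \<Rightarrow> nat" where
  "stat_io \<tau> ps ws = (\<Sum>i \<le> length ws.
     card {j. 1 \<le> j \<and> j + 1 < length (gap_runs \<tau> ps ws i) \<and>
              length (gap_runs \<tau> ps ws i ! j) = 1})"

text \<open>
  The total number of letters outside the blocks. In the antipode formula each of them
  contributes a factor \<open>-1\<close>, so the sign is \<open>(-1)\<close> to the power \<open>s + \<ell>(\<phi>\<^sub>0) + \<dots> + \<ell>(\<phi>\<^sub>s)\<close>.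
  With \<open>(-1)\<close> to the power \<open>s\<close> alone the formula fails for three letters: at the reverse
  \<open>321\<close> of \<open>\<tau> = 123\<close>, where \<open>s = 2\<close>, the component of the antipode is \<open>-q(q - 1)\<close> times the
  trivial character.
\<close>

definition total_gap :: "'a list list \<Rightarrow> nat" where
  "total_gap ps = (\<Sum>p\<leftarrow>ps. length p)"

text \<open>No truncation occurs below: the letters counted are distinct letters of the \<open>\<phi>\<^sub>i\<close>.\<close>

definition stat_rst :: "'a list \<Rightarrow> 'a list list \<Rightarrow> 'a list list \<Rightarrow> nat" where
  "stat_rst \<tau> ps ws = total_gap ps - stat_mt \<tau> ps ws - stat_io \<tau> ps ws"

definition zpoly :: "'a list \<Rightarrow> 'a list list \<Rightarrow> 'a list list \<Rightarrow> complex \<Rightarrow> complex" where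
  "zpoly \<tau> ps ws t =
     (t - 1) ^ stat_mt \<tau> ps ws * t ^ stat_rst \<tau> ps ws * (t + 1) ^ stat_io \<tau> ps ws"

end

theory Submission
  imports Defs
begin

text \<open>
  Takeuchi's formula expresses the antipode at a word \<open>\<rho>\<close> as a signed sum over the ways to cut \<open>\<rho>\<close>
  into segments; for an element concentrated at \<open>\<tau>\<close> only cuts into \<open>\<tau>\<close>-increasing segments
  contribute, and restricting the supercharacter of the arc from the minimum to the maximum to
  the blocks gives a product of one factor per segment. Cutting is a transfer-matrix problem on the
  positions of \<open>\<rho>\<close>: the sum is an entry of \<open>M\<inverse>\<close>, where \<open>M i j\<close> is the factor of the segment between
  positions \<open>i\<close> and \<open>j\<close>. Taking differences of \<open>M\<close> in both indices (multiplying by bidiagonal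
  matrices on either side) turns the factor of a segment into \<open>q - 1\<close> times the supercharacter of
  the single arc spanning it, plus a bidiagonal part carrying the weights \<open>q - 2\<close>, \<open>q - 1\<close>, \<open>q\<close>
  of the letters outside the arcs. Expanding the inverse of the new matrix gives the sum over
  factorizations.
\<close>

section \<open>Superclasses of unitriangular matrices\<close>

text \<open>The value of a single-arc supercharacter carries only one factor \<open>q - 1\<close> or
  \<open>-1\<close>, but a cut may separate the minimum from the maximum, and then a product over
  segments needs a \<open>q - 1\<close> for each of their two segments. Hence the whole computation
  is done for \<open>q - 1\<close> times the antipode; cancelling the surplus factor at the very end
  turns the exponent \<open>s\<close> into \<open>s - 1\<close>.

  Differences help because a segment without extreme letters has the factor \<open>q\<close> to the
  power (letters minus arcs inside). A new end letter multiplies it by \<open>q\<close>, or by 1 if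
  it brings an arc along, so the second difference splits into one factor per end unless an arc
  joins the two ends, and then it changes in the way the value of a supercharacter does. Extreme
  letters are exempt: their factors have the form of a difference from the start.

  The antipode and the index of a superclass are both given by choice operators. Takeuchi's formula
  and evaluation at arc matrices therefore become available only after existence and uniqueness have
  been shown, for the convolution inverse and for the normal form of a superclass.\<close>

lemma precedes_Nil [simp]: "\<not> precedes [] i j"
  by (simp add: precedes_def)

lemma precedes_Cons [simp]:
  "precedes (x # xs) i j \<longleftrightarrow> (i = x \<and> j \<in> set xs) \<or> precedes xs i j"
proof
  assume "precedes (x # xs) i j"
  then obtain m n where mn: "m < n" "n < Suc (length xs)" "(x # xs) ! m = i" "(x # xs) ! n = j"
    by (auto simp: precedes_def)
  show "(i = x \<and> j \<in> set xs) \<or> precedes xs i j"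
  proof (cases m)
    case 0
    with mn show ?thesis by (cases n) auto
  next
    case (Suc m')
    with mn show ?thesis
      unfolding precedes_def by (cases n) auto
  qed
next
  assume "(i = x \<and> j \<in> set xs) \<or> precedes xs i j"
  then show "precedes (x # xs) i j"
  proof
    assume "i = x \<and> j \<in> set xs"
    then obtain n where "n < length xs" "xs ! n = j" "i = x" by (auto simp: in_set_conv_nth)
    then show ?thesis unfolding precedes_def by (intro exI[of _ 0] exI[of _ "Suc n"]) auto
  next
    assume "precedes xs i j"
    then obtain m n where "m < n" "n < length xs" "xs ! m = i" "xs ! n = j"
      by (auto simp: precedes_def)
    then show ?thesis unfolding precedes_def by (intro exI[of _ "Suc m"] exI[of _ "Suc n"]) auto
  qed
qed

lemma precedes_append [simp]:
  "precedes (xs @ ys) i j \<longleftrightarrow> precedes xs i j \<or> precedes ys i j \<or> (i \<in> set xs \<and> j \<in> set ys)"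
  by (induction xs) auto

lemma precedes_in_set: "precedes \<phi> i j \<Longrightarrow> i \<in> set \<phi> \<and> j \<in> set \<phi>"
  by (induction \<phi>) auto

lemma precedes_irrefl [simp]: "distinct \<phi> \<Longrightarrow> \<not> precedes \<phi> i i"
  by (induction \<phi>) auto

lemma precedes_trans: "distinct \<phi> \<Longrightarrow> precedes \<phi> i j \<Longrightarrow> precedes \<phi> j k \<Longrightarrow> precedes \<phi> i k"
  by (induction \<phi>) (auto dest: precedes_in_set)

lemma precedes_asym: "distinct \<phi> \<Longrightarrow> precedes \<phi> i j \<Longrightarrow> \<not> precedes \<phi> j i"
  using precedes_trans precedes_irrefl by metis

lemma precedes_total:
  "i \<in> set \<phi> \<Longrightarrow> j \<in> set \<phi> \<Longrightarrow> i \<noteq> j \<Longrightarrow> precedes \<phi> i j \<or> precedes \<phi> j i"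
  by (induction \<phi>) auto

lemma precedes_restr [simp]:
  "precedes (restr J \<phi>) i j \<longleftrightarrow> precedes \<phi> i j \<and> i \<in> J \<and> j \<in> J"
  by (induction \<phi>) (auto simp: restr_def dest: precedes_in_set)

lemma set_restr [simp]: "set (restr J \<phi>) = set \<phi> \<inter> J"
  by (auto simp: restr_def)

lemma sorted_wrt_precedes_self: "sorted_wrt (precedes \<phi>) \<phi>"
  by (induction \<phi>) (auto simp: sorted_wrt_append elim: sorted_wrt_mono_rel[rotated])

lemma wf_precedes:
  assumes "distinct \<phi>"
  shows "wf {(i, j). precedes \<phi> i j}"
proof -
  have "{(i, j). precedes \<phi> i j} \<subseteq> set \<phi> \<times> set \<phi>"
    by (auto dest: precedes_in_set)
  then have "finite {(i, j). precedes \<phi> i j}"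
    using finite_subset by blast
  moreover have "trans {(i, j). precedes \<phi> i j}"
    using precedes_trans[OF assms] by (auto simp: trans_def)
  then have "acyclic {(i, j). precedes \<phi> i j}"
    using precedes_irrefl[OF assms] by (simp add: acyclic_def)
  ultimately show ?thesis
    by (rule finite_acyclic_wf)
qed

lemma first_satisfying:
  assumes "distinct \<phi>" "j \<in> set \<phi>" "P j"
  obtains i where "i \<in> set \<phi>" "P i" "\<And>k. precedes \<phi> k i \<Longrightarrow> \<not> P k"
  using wfE_min[OF wf_precedes[OF assms(1)], of j "{j \<in> set \<phi>. P j}"] assms(2,3)
  by simp (metis precedes_in_set)

section \<open>Invertible triangular matrices\<close>

definition upper_tri :: "'a list \<Rightarrow> ('a, 'f::field) matr set" where
  "upper_tri \<phi> = {u \<in> matrices (set \<phi>). \<forall>i j. u i j \<noteq> 0 \<longrightarrow> i = j \<or> precedes \<phi> i j}"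

definition borel :: "'a list \<Rightarrow> ('a, 'f::field) matr set" where
  "borel \<phi> = {u \<in> upper_tri \<phi>. \<forall>i \<in> set \<phi>. u i i \<noteq> 0}"

lemma unitri_iff_borel: "u \<in> unitri \<phi> \<longleftrightarrow> u \<in> borel \<phi> \<and> (\<forall>i \<in> set \<phi>. u i i = 1)"
  unfolding unitri_def borel_def upper_tri_def matrices_def by auto metis

lemma borel_upper: "u \<in> borel \<phi> \<Longrightarrow> u \<in> upper_tri \<phi>"
  by (simp add: borel_def)

lemma unitri_borel: "u \<in> unitri \<phi> \<Longrightarrow> u \<in> borel \<phi>"
  by (simp add: unitri_iff_borel)

lemma unitri_upper: "u \<in> unitri \<phi> \<Longrightarrow> u \<in> upper_tri \<phi>"
  by (simp add: unitri_borel borel_upper)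

lemma unitri_diag: "u \<in> unitri \<phi> \<Longrightarrow> i \<in> set \<phi> \<Longrightarrow> u i i = 1"
  by (simp add: unitri_iff_borel)

lemma upper_tri_outside: "u \<in> upper_tri \<phi> \<Longrightarrow> i \<notin> set \<phi> \<or> j \<notin> set \<phi> \<Longrightarrow> u i j = 0"
  by (auto simp: upper_tri_def matrices_def)

lemma upper_tri_zero: "u \<in> upper_tri \<phi> \<Longrightarrow> i \<noteq> j \<Longrightarrow> \<not> precedes \<phi> i j \<Longrightarrow> u i j = 0"
  by (auto simp: upper_tri_def)

lemma mat_mult_one_left: "finite K \<Longrightarrow> u \<in> matrices K \<Longrightarrow> mat_mult K (mat_one K) u = u"
proof (intro ext)
  fix i j assume *: "finite K" "u \<in> matrices K"
  have "mat_mult K (mat_one K) u i j = (\<Sum>k\<in>K. if k = i then u i j else 0)"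
    unfolding mat_mult_def mat_one_def by (rule sum.cong) auto
  also have "\<dots> = u i j" using * by (auto simp: matrices_def)
  finally show "mat_mult K (mat_one K) u i j = u i j" .
qed

lemma mat_mult_one_right: "finite K \<Longrightarrow> u \<in> matrices K \<Longrightarrow> mat_mult K u (mat_one K) = u"
proof (intro ext)
  fix i j assume *: "finite K" "u \<in> matrices K"
  have "mat_mult K u (mat_one K) i j = (\<Sum>k\<in>K. if k = j then u i j else 0)"
    unfolding mat_mult_def mat_one_def by (rule sum.cong) auto
  also have "\<dots> = u i j" using * by (auto simp: matrices_def)
  finally show "mat_mult K u (mat_one K) i j = u i j" .
qed

lemma mat_mult_assoc: "mat_mult K (mat_mult K u v) w = mat_mult K u (mat_mult K v w)"
proof (intro ext)
  fix i j
  have "mat_mult K (mat_mult K u v) w i j = (\<Sum>k\<in>K. \<Sum>l\<in>K. u i l * v l k * w k j)"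
    by (simp add: mat_mult_def sum_distrib_right)
  also have "\<dots> = (\<Sum>l\<in>K. \<Sum>k\<in>K. u i l * v l k * w k j)"
    by (rule sum.swap)
  also have "\<dots> = mat_mult K u (mat_mult K v w) i j"
    by (simp add: mat_mult_def sum_distrib_left mult.assoc)
  finally show "mat_mult K (mat_mult K u v) w i j = mat_mult K u (mat_mult K v w) i j" .
qed

lemma mat_mult_upper:
  assumes "distinct \<phi>" "u \<in> upper_tri \<phi>" "v \<in> upper_tri \<phi>"
  shows "mat_mult (set \<phi>) u v \<in> upper_tri \<phi>"
    and "i \<in> set \<phi> \<Longrightarrow> mat_mult (set \<phi>) u v i i = u i i * v i i"
proof -
  have "mat_mult (set \<phi>) u v \<in> matrices (set \<phi>)"
    using assms unfolding upper_tri_def matrices_def by (auto simp: mat_mult_def)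
  moreover have "i = j \<or> precedes \<phi> i j" if "mat_mult (set \<phi>) u v i j \<noteq> 0" for i j
  proof -
    from that obtain k where "u i k * v k j \<noteq> 0"
      unfolding mat_mult_def by (meson sum.neutral)
    then have "(i = k \<or> precedes \<phi> i k) \<and> (k = j \<or> precedes \<phi> k j)"
      using assms(2,3) by (auto simp: upper_tri_def)
    then show ?thesis
      using precedes_trans[OF assms(1)] by blast
  qed
  ultimately show "mat_mult (set \<phi>) u v \<in> upper_tri \<phi>"
    by (simp add: upper_tri_def)
  assume i: "i \<in> set \<phi>"
  have "mat_mult (set \<phi>) u v i i = (\<Sum>k\<in>set \<phi>. if k = i then u i i * v i i else 0)"
    unfolding mat_mult_def
  proof (rule sum.cong)
    fix k assume "k \<in> set \<phi>"
    show "u i k * v k i = (if k = i then u i i * v i i else 0)"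
      using upper_tri_zero[OF assms(2), of i k] upper_tri_zero[OF assms(3), of k i]
        precedes_asym[OF assms(1), of i k] by auto
  qed simp
  then show "mat_mult (set \<phi>) u v i i = u i i * v i i"
    using i by simp
qed

lemma mat_mult_borel:
  assumes "distinct \<phi>" "u \<in> borel \<phi>" "v \<in> borel \<phi>"
  shows "mat_mult (set \<phi>) u v \<in> borel \<phi>"
  using mat_mult_upper[OF assms(1) borel_upper[OF assms(2)] borel_upper[OF assms(3)]] assms
  by (simp add: borel_def)

lemma mat_one_unitri: "mat_one (set \<phi>) \<in> unitri \<phi>"
  by (auto simp: unitri_def mat_one_def matrices_def)

lemma mat_one_matrices: "mat_one K \<in> matrices K"
  by (auto simp: mat_one_def matrices_def)

lemma upper_tri_matrices: "u \<in> upper_tri \<phi> \<Longrightarrow> u \<in> matrices (set \<phi>)"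
  by (simp add: upper_tri_def)

text \<open>Induction on the word: on the later letters the matrix is a smaller invertible
  triangular one, and the column of the first letter vanishes there, so only one new row has to be
  solved for.\<close>

lemma borel_right_inverse:
  assumes "distinct \<phi>" "u \<in> borel \<phi>"
  shows "\<exists>v \<in> borel \<phi>. mat_mult (set \<phi>) u v = mat_one (set \<phi>)"
  using assms
proof (induction \<phi> arbitrary: u)
  case Nil
  show ?case
    by (rule bexI[of _ "\<lambda>_ _. 0"]) (auto simp: mat_mult_def mat_one_def borel_def upper_tri_def matrices_def)
next
  case (Cons x \<phi>)
  have x: "x \<notin> set \<phi>" and d: "distinct \<phi>" using Cons.prems by auto
  define u' where "u' = diag_block (set \<phi>) u"
  have u: "u i j = 0" if "i \<noteq> j" "\<not> precedes (x # \<phi>) i j" for i j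
    using upper_tri_zero[OF borel_upper[OF Cons.prems(2)] that] .
  have uxx: "u x x \<noteq> 0" using Cons.prems by (auto simp: borel_def)
  have ui: "u i x = 0" if "i \<in> set \<phi>" for i
    using u[of i x] that x precedes_in_set[of \<phi> i x] by auto
  have "u' \<in> borel \<phi>"
    using Cons.prems(2) x unfolding u'_def borel_def upper_tri_def matrices_def diag_block_def
    by (auto split: if_splits dest: precedes_in_set)
  then obtain v' where v': "v' \<in> borel \<phi>" "mat_mult (set \<phi>) u' v' = mat_one (set \<phi>)"
    using Cons.IH d by blast
  \<comment> \<open>Row \<open>x\<close> is solved from \<open>u x x * v x j\<close> plus the sum
    over the later letters being \<open>mat_one\<close> at \<open>x\<close> and \<open>j\<close>;
    that sum vanishes for \<open>j = x\<close>.\<close>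
  define v where "v = (\<lambda>i j. if i = x then (if j = x then inverse (u x x)
    else - inverse (u x x) * (\<Sum>k\<in>set \<phi>. u x k * v' k j)) else v' i j)"
  have v'x: "v' i j = 0" if "i \<notin> set \<phi> \<or> j \<notin> set \<phi>" for i j
    using upper_tri_outside[OF borel_upper[OF v'(1)] that] .
  have "v \<in> borel (x # \<phi>)"
    using v'(1) uxx x sum.neutral[of "set \<phi>" "\<lambda>k. u x k * v' k _"]
    unfolding borel_def upper_tri_def matrices_def v_def
    by (auto simp: v'x) (metis mult_zero_right v'x)
  moreover have "mat_mult (set (x # \<phi>)) u v i j = mat_one (set (x # \<phi>)) i j" for i j
  proof -
    have s: "mat_mult (set (x # \<phi>)) u v i j = u i x * v x j + (\<Sum>k\<in>set \<phi>. u i k * v' k j)"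
      using x by (auto simp: mat_mult_def v_def intro!: sum.cong)
    show ?thesis
    proof (cases "i \<in> set \<phi>")
      case True
      have "(\<Sum>k\<in>set \<phi>. u i k * v' k j) = mat_mult (set \<phi>) u' v' i j"
        using True by (simp add: mat_mult_def u'_def diag_block_def cong: sum.cong)
      then show ?thesis
        using s v'(2) True x ui by (auto simp: mat_one_def)
    next
      case False
      show ?thesis
      proof (cases "i = x")
        case True
        show ?thesis
        proof (cases "j = x")
          case True
          then show ?thesis using s \<open>i = x\<close> uxx x by (simp add: v_def mat_one_def v'x)
        next
          case False
          then show ?thesis using s \<open>i = x\<close> uxx by (simp add: v_def mat_one_def)
        qed
      next
        case ix: False
        then have "u i k = 0" for k
          using False upper_tri_outside[OF borel_upper[OF Cons.prems(2)], of i k] by auto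
        then show ?thesis using s False ix by (simp add: mat_one_def)
      qed
    qed
  qed
  ultimately show ?case by (intro bexI[of _ v]) auto
qed

text \<open>A right inverse of the right inverse is again \<open>u\<close>, so one-sided inverses
  are two-sided.\<close>

lemma borel_inverse:
  assumes "distinct \<phi>" "u \<in> borel \<phi>"
  obtains v where "v \<in> borel \<phi>" "mat_mult (set \<phi>) u v = mat_one (set \<phi>)"
    "mat_mult (set \<phi>) v u = mat_one (set \<phi>)" "\<And>i. i \<in> set \<phi> \<Longrightarrow> v i i = inverse (u i i)"
proof -
  obtain v where v: "v \<in> borel \<phi>" "mat_mult (set \<phi>) u v = mat_one (set \<phi>)"
    using borel_right_inverse[OF assms] by blast
  obtain w where w: "w \<in> borel \<phi>" "mat_mult (set \<phi>) v w = mat_one (set \<phi>)"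
    using borel_right_inverse[OF assms(1) v(1)] by blast
  have "u = mat_mult (set \<phi>) u (mat_mult (set \<phi>) v w)"
    using w assms by (simp add: mat_mult_one_right borel_def upper_tri_def)
  also have "\<dots> = mat_mult (set \<phi>) (mat_mult (set \<phi>) u v) w"
    by (simp only: mat_mult_assoc)
  also have "\<dots> = w"
    using v w by (simp add: mat_mult_one_left borel_def upper_tri_def)
  finally have "u = w" .
  moreover have "v i i = inverse (u i i)" if "i \<in> set \<phi>" for i
    using mat_mult_upper(2)[OF assms(1) borel_upper[OF assms(2)] borel_upper[OF v(1)] that] v(2) that
    by (simp add: mat_one_def inverse_unique)
  ultimately show thesis using that v w by blast
qed

text \<open>The diagonal matrix is absorbed into the two triangular factors.\<close>

definition tri_equiv :: "'a list \<Rightarrow> ('a, 'f::field) matr \<Rightarrow> ('a, 'f) matr \<Rightarrow> bool" where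
  "tri_equiv \<phi> X Y \<longleftrightarrow> (\<exists>P \<in> borel \<phi>. \<exists>Q \<in> borel \<phi>. (\<forall>i \<in> set \<phi>. P i i * Q i i = 1) \<and>
     Y = mat_mult (set \<phi>) (mat_mult (set \<phi>) P X) Q)"

lemma tri_equivI:
  assumes "P \<in> borel \<phi>" "Q \<in> borel \<phi>" "\<And>i. i \<in> set \<phi> \<Longrightarrow> P i i * Q i i = 1"
    "Y = mat_mult (set \<phi>) (mat_mult (set \<phi>) P X) Q"
  shows "tri_equiv \<phi> X Y"
  using assms unfolding tri_equiv_def by blast

lemma tri_equiv_trans:
  assumes d: "distinct \<phi>" and "tri_equiv \<phi> X Y" "tri_equiv \<phi> Y Z"
  shows "tri_equiv \<phi> X Z"
proof -
  obtain P Q where PQ: "P \<in> borel \<phi>" "Q \<in> borel \<phi>" "\<forall>i \<in> set \<phi>. P i i * Q i i = 1"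
     "Y = mat_mult (set \<phi>) (mat_mult (set \<phi>) P X) Q" using assms unfolding tri_equiv_def by blast
  obtain P' Q' where PQ': "P' \<in> borel \<phi>" "Q' \<in> borel \<phi>" "\<forall>i \<in> set \<phi>. P' i i * Q' i i = 1"
     "Z = mat_mult (set \<phi>) (mat_mult (set \<phi>) P' Y) Q'" using assms unfolding tri_equiv_def by blast
  show ?thesis
  proof (rule tri_equivI[where P = "mat_mult (set \<phi>) P' P" and Q = "mat_mult (set \<phi>) Q Q'"])
    fix i assume i: "i \<in> set \<phi>"
    have "P' i i * P i i * (Q i i * Q' i i) = (P' i i * Q' i i) * (P i i * Q i i)" by simp
    also have "\<dots> = 1" using PQ PQ' i by simp
    finally show "mat_mult (set \<phi>) P' P i i * mat_mult (set \<phi>) Q Q' i i = 1"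
      using PQ PQ' d i by (simp add: mat_mult_upper borel_upper)
  qed (use PQ PQ' d in \<open>auto simp: mat_mult_borel mat_mult_assoc\<close>)
qed

lemma tri_equiv_refl:
  assumes "X \<in> matrices (set \<phi>)"
  shows "tri_equiv \<phi> X X"
  using assms
  by (intro tri_equivI[where P = "mat_one (set \<phi>)" and Q = "mat_one (set \<phi>)"])
     (simp_all add: unitri_borel mat_one_unitri mat_mult_one_left mat_mult_one_right unitri_diag[OF mat_one_unitri])

lemma tri_equiv_sym:
  assumes d: "distinct \<phi>" and X: "X \<in> matrices (set \<phi>)" and "tri_equiv \<phi> X Y"
  shows "tri_equiv \<phi> Y X"
proof -
  obtain P Q where PQ: "P \<in> borel \<phi>" "Q \<in> borel \<phi>" "\<forall>i \<in> set \<phi>. P i i * Q i i = 1"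
     "Y = mat_mult (set \<phi>) (mat_mult (set \<phi>) P X) Q" using assms unfolding tri_equiv_def by blast
  obtain P' where P': "P' \<in> borel \<phi>" "mat_mult (set \<phi>) P' P = mat_one (set \<phi>)"
    "\<And>i. i \<in> set \<phi> \<Longrightarrow> P' i i = inverse (P i i)"
    using borel_inverse[OF d PQ(1)] by metis
  obtain Q' where Q': "Q' \<in> borel \<phi>" "mat_mult (set \<phi>) Q Q' = mat_one (set \<phi>)"
    "\<And>i. i \<in> set \<phi> \<Longrightarrow> Q' i i = inverse (Q i i)"
    using borel_inverse[OF d PQ(2)] by metis
  have "mat_mult (set \<phi>) (mat_mult (set \<phi>) P' Y) Q' =
    mat_mult (set \<phi>) (mat_mult (set \<phi>) (mat_mult (set \<phi>) P' P) X) (mat_mult (set \<phi>) Q Q')"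
    by (simp add: PQ(4) mat_mult_assoc)
  also have "\<dots> = X"
    using X by (simp add: P' Q' mat_mult_one_left mat_mult_one_right)
  finally show ?thesis
    using P' Q' PQ(3)
    by (intro tri_equivI[where P = P' and Q = Q'])
       (auto simp: inverse_mult_distrib[symmetric] simp del: inverse_mult_distrib)
qed

text \<open>With \<open>P = t a\<close> and \<open>Q = b' / t\<close> the diagonals are
  \<open>t\<close> and \<open>1 / t\<close>, which is why they are required to multiply to 1.
  Conversely the diagonal of \<open>P\<close> recovers \<open>t\<close>.\<close>

lemma same_superclass_iff:
  assumes d: "distinct \<phi>"
  shows "same_superclass \<phi> u v \<longleftrightarrow> u \<in> unitri \<phi> \<and> v \<in> unitri \<phi> \<and>
    tri_equiv \<phi> (mat_minus u (mat_one (set \<phi>))) (mat_minus v (mat_one (set \<phi>)))"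
    (is "_ \<longleftrightarrow> _ \<and> _ \<and> tri_equiv \<phi> ?X ?Y")
proof (intro iffI conjI; (elim conjE)?)
  show "u \<in> unitri \<phi>" "v \<in> unitri \<phi>" if "same_superclass \<phi> u v"
    using that by (auto simp: same_superclass_def)
  assume "same_superclass \<phi> u v"
  then obtain a b b' t where *: "u \<in> unitri \<phi>" "v \<in> unitri \<phi>" "a \<in> unitri \<phi>" "b' \<in> unitri \<phi>"
    "\<And>i. i \<in> set \<phi> \<Longrightarrow> t i \<noteq> 0"
    "\<And>i j. i \<in> set \<phi> \<Longrightarrow> j \<in> set \<phi> \<Longrightarrow> ?Y i j = t i * mat_mult (set \<phi>) (mat_mult (set \<phi>) a ?X) b' i j * inverse (t j)"
    unfolding same_superclass_def by blast
  define P where "P = (\<lambda>i j. if i \<in> set \<phi> then t i * a i j else 0)"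
  define Q where "Q = (\<lambda>i j. if j \<in> set \<phi> then b' i j * inverse (t j) else 0)"
  have out: "?Y i j = 0" if "i \<notin> set \<phi> \<or> j \<notin> set \<phi>" for i j
    using that upper_tri_outside[OF unitri_upper[OF *(2)] that] by (auto simp: mat_minus_def mat_one_def)
  have "P \<in> borel \<phi>" "Q \<in> borel \<phi>"
    using *(5) unitri_diag[OF *(3)] unitri_diag[OF *(4)]
      upper_tri_zero[OF unitri_upper[OF *(3)]] upper_tri_zero[OF unitri_upper[OF *(4)]]
      upper_tri_outside[OF unitri_upper[OF *(3)]] upper_tri_outside[OF unitri_upper[OF *(4)]]
    unfolding P_def Q_def borel_def upper_tri_def matrices_def
    by auto blast+
  moreover have "P i i * Q i i = 1" if "i \<in> set \<phi>" for i
    using that *(3,4,5) by (simp add: P_def Q_def unitri_diag)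
  moreover have "?Y i j = mat_mult (set \<phi>) (mat_mult (set \<phi>) P ?X) Q i j" for i j
  proof (cases "i \<in> set \<phi> \<and> j \<in> set \<phi>")
    case True
    then show ?thesis
      using *(6)[of i j] by (simp add: mat_mult_def P_def Q_def sum_distrib_left sum_distrib_right mult_ac)
  next
    case False
    then show ?thesis
      using out[of i j] by (auto simp: mat_mult_def P_def Q_def)
  qed
  ultimately show "tri_equiv \<phi> ?X ?Y"
    by (intro tri_equivI[where P = P and Q = Q] ext) auto
next
  assume uv: "u \<in> unitri \<phi>" "v \<in> unitri \<phi>" and "tri_equiv \<phi> ?X ?Y"
  then obtain P Q where PQ: "P \<in> borel \<phi>" "Q \<in> borel \<phi>" "\<forall>i \<in> set \<phi>. P i i * Q i i = 1"
     "?Y = mat_mult (set \<phi>) (mat_mult (set \<phi>) P ?X) Q" unfolding tri_equiv_def by blast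
  define t where "t = (\<lambda>i. P i i)"
  have t: "t i \<noteq> 0" "Q i i = inverse (t i)" if "i \<in> set \<phi>" for i
    using PQ(3) that by (auto simp: t_def inverse_unique)
  define a where "a = (\<lambda>i j. inverse (t i) * P i j)"
  define b' where "b' = (\<lambda>i j. Q i j * t j)"
  have a: "a \<in> unitri \<phi>"
    using PQ(1) t(1) unfolding a_def unitri_def borel_def upper_tri_def matrices_def
    by (auto simp: t_def)
  have b': "b' \<in> unitri \<phi>"
    using PQ(2) t(1) unfolding b'_def unitri_def borel_def upper_tri_def matrices_def
    by (auto simp: t(2))
  obtain b where b: "b \<in> borel \<phi>" "mat_mult (set \<phi>) b' b = mat_one (set \<phi>)"
    "mat_mult (set \<phi>) b b' = mat_one (set \<phi>)" "\<And>i. i \<in> set \<phi> \<Longrightarrow> b i i = inverse (b' i i)"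
    using borel_inverse[OF d unitri_borel[OF b']] by metis
  have b1: "b \<in> unitri \<phi>"
    using b b' by (simp add: unitri_iff_borel)
  have "?Y i j = t i * mat_mult (set \<phi>) (mat_mult (set \<phi>) a ?X) b' i j * inverse (t j)"
    if "i \<in> set \<phi>" "j \<in> set \<phi>" for i j
  proof -
    have "t i * mat_mult (set \<phi>) (mat_mult (set \<phi>) a ?X) b' i j * inverse (t j) =
      (t i * inverse (t i)) * (t j * inverse (t j)) * mat_mult (set \<phi>) (mat_mult (set \<phi>) P ?X) Q i j"
      by (simp add: mat_mult_def a_def b'_def sum_distrib_left sum_distrib_right mult_ac del: left_inverse right_inverse)
    then show ?thesis using t(1) that PQ(4) by simp
  qed
  then show "same_superclass \<phi> u v"
    unfolding same_superclass_def using uv a b' b b1 t(1) by blast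
qed

lemma mat_minus_one_matrices:
  "u \<in> unitri \<phi> \<Longrightarrow> mat_minus u (mat_one (set \<phi>)) \<in> matrices (set \<phi>)"
  by (auto simp: unitri_def mat_minus_def mat_one_def matrices_def)

lemma same_superclass_sym: "distinct \<phi> \<Longrightarrow> same_superclass \<phi> u v \<Longrightarrow> same_superclass \<phi> v u"
  by (auto simp: same_superclass_iff mat_minus_one_matrices intro: tri_equiv_sym)

lemma same_superclass_trans:
  "distinct \<phi> \<Longrightarrow> same_superclass \<phi> u v \<Longrightarrow> same_superclass \<phi> v w \<Longrightarrow> same_superclass \<phi> u w"
  by (auto simp: same_superclass_iff intro: tri_equiv_trans)

lemma same_superclass_refl: "distinct \<phi> \<Longrightarrow> u \<in> unitri \<phi> \<Longrightarrow> same_superclass \<phi> u u"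
  by (auto simp: same_superclass_iff mat_minus_one_matrices intro: tri_equiv_refl)

section \<open>Normal forms of superclasses\<close>

definition arc_part :: "('a \<times> 'a) set \<Rightarrow> ('a, 'f::field) matr" where
  "arc_part \<mu> = (\<lambda>i j. if (i, j) \<in> \<mu> then 1 else 0)"

lemma set_partitionsD:
  assumes "\<mu> \<in> set_partitions \<phi>"
  shows "(i, j) \<in> \<mu> \<Longrightarrow> precedes \<phi> i j"
    and "(i, j) \<in> \<mu> \<Longrightarrow> (i, k) \<in> \<mu> \<Longrightarrow> j = k"
    and "(i, k) \<in> \<mu> \<Longrightarrow> (j, k) \<in> \<mu> \<Longrightarrow> i = j"
  using assms unfolding set_partitions_def by fastforce+

lemma set_partitionsI:
  assumes "\<And>i j. (i, j) \<in> \<mu> \<Longrightarrow> precedes \<phi> i j"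
    and "\<And>i j k. (i, j) \<in> \<mu> \<Longrightarrow> (i, k) \<in> \<mu> \<Longrightarrow> j = k"
    and "\<And>i j k. (i, k) \<in> \<mu> \<Longrightarrow> (j, k) \<in> \<mu> \<Longrightarrow> i = j"
  shows "\<mu> \<in> set_partitions \<phi>"
  using assms unfolding set_partitions_def by fast

lemma set_partitions_sub: "\<mu> \<in> set_partitions \<phi> \<Longrightarrow> \<mu> \<subseteq> set \<phi> \<times> set \<phi>"
  by (auto dest!: set_partitionsD(1) dest: precedes_in_set)

lemma finite_set_partition: "\<mu> \<in> set_partitions \<phi> \<Longrightarrow> finite \<mu>"
  using set_partitions_sub finite_subset by blast

lemma arc_mat_minus_one: "mat_minus (arc_mat K \<mu>) (mat_one K) = arc_part \<mu>"
  by (auto simp: mat_minus_def arc_mat_def arc_part_def)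

lemma arc_mat_unitri:
  assumes "distinct \<phi>" "\<mu> \<in> set_partitions \<phi>"
  shows "arc_mat (set \<phi>) \<mu> \<in> unitri \<phi>"
  using set_partitionsD(1)[OF assms(2)] precedes_irrefl[OF assms(1)]
  unfolding unitri_def arc_mat_def mat_one_def matrices_def
  by (auto dest: precedes_in_set)

text \<open>With \<open>R\<close> inverse to \<open>Q\<close> the relation becomes an equation
  between \<open>arc_part \<nu>\<close> times \<open>R\<close> and \<open>P\<close> times
  \<open>arc_part \<mu>\<close>. Nonzero diagonal entries of \<open>P\<close> and \<open>R\<close>
  show up at arcs: an arc of \<open>\<mu>\<close> from \<open>k\<close> to \<open>j\<close> forces
  an arc of \<open>\<nu>\<close> from \<open>k\<close> that ends at \<open>j\<close> or earlier, and
  an arc of \<open>\<nu>\<close> into \<open>l\<close> forces an arc of \<open>\<mu>\<close> into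
  \<open>l\<close>. Induction on the right end excludes an earlier end.\<close>

lemma tri_equiv_arc_part_eq:
  assumes d: "distinct \<phi>" and \<mu>: "\<mu> \<in> set_partitions \<phi>" and \<nu>: "\<nu> \<in> set_partitions \<phi>"
    and eq: "tri_equiv \<phi> (arc_part \<mu> :: ('a, 'f::field) matr) (arc_part \<nu>)"
  shows "\<mu> = \<nu>"
proof -
  obtain P Q :: "('a, 'f) matr" where PQ: "P \<in> borel \<phi>" "Q \<in> borel \<phi>"
     "arc_part \<nu> = mat_mult (set \<phi>) (mat_mult (set \<phi>) P (arc_part \<mu>)) Q"
    using eq unfolding tri_equiv_def by blast
  obtain R where R: "R \<in> borel \<phi>" "mat_mult (set \<phi>) Q R = mat_one (set \<phi>)"
    using borel_inverse[OF d PQ(2)] by metis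
  have "(arc_part \<mu> :: ('a, 'f) matr) \<in> matrices (set \<phi>)"
    using set_partitions_sub[OF \<mu>] by (auto simp: arc_part_def matrices_def)
  then have "mat_mult (set \<phi>) P (arc_part \<mu>) \<in> matrices (set \<phi>)"
    using PQ(1) unfolding borel_def upper_tri_def matrices_def by (auto simp: mat_mult_def)
  then have key: "mat_mult (set \<phi>) (arc_part \<nu>) R = mat_mult (set \<phi>) P (arc_part \<mu>)"
    by (subst PQ(3), subst mat_mult_assoc, subst R(2)) (simp add: mat_mult_one_right)
  have entry\<mu>: "mat_mult (set \<phi>) P (arc_part \<mu>) i j = P i k" if "(k, j) \<in> \<mu>" for i j k
  proof -
    have "mat_mult (set \<phi>) P (arc_part \<mu>) i j = (\<Sum>l\<in>set \<phi>. if l = k then P i k else 0)"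
      unfolding mat_mult_def arc_part_def
      by (intro sum.cong) (use that in \<open>auto dest: set_partitionsD(3)[OF \<mu>]\<close>)
    also have "\<dots> = P i k" using set_partitions_sub[OF \<mu>] that by auto
    finally show ?thesis .
  qed
  have entry\<nu>: "mat_mult (set \<phi>) (arc_part \<nu>) R i j = R l j" if "(i, l) \<in> \<nu>" for i j l
  proof -
    have "mat_mult (set \<phi>) (arc_part \<nu>) R i j = (\<Sum>k\<in>set \<phi>. if k = l then R l j else 0)"
      unfolding mat_mult_def arc_part_def
      by (intro sum.cong) (use that in \<open>auto dest: set_partitionsD(2)[OF \<nu>]\<close>)
    also have "\<dots> = R l j" using set_partitions_sub[OF \<nu>] that by auto
    finally show ?thesis .
  qed
  have row: "\<exists>l. (k, l) \<in> \<nu> \<and> (l = j \<or> precedes \<phi> l j)" if "(k, j) \<in> \<mu>" for k j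
  proof -
    have "k \<in> set \<phi>" using set_partitions_sub[OF \<mu>] that by auto
    then have "mat_mult (set \<phi>) (arc_part \<nu>) R k j \<noteq> 0"
      using PQ(1) key entry\<mu>[OF that, of k] by (auto simp: borel_def)
    then obtain l where "arc_part \<nu> k l * R l j \<noteq> 0"
      unfolding mat_mult_def by (meson sum.neutral)
    then show ?thesis
      using upper_tri_zero[OF borel_upper[OF R(1)], of l j]
      by (intro exI[of _ l]) (auto simp: arc_part_def split: if_splits)
  qed
  have col: "\<exists>k. (k, l) \<in> \<mu> \<and> (i = k \<or> precedes \<phi> i k)" if "(i, l) \<in> \<nu>" for i l
  proof -
    have "l \<in> set \<phi>" using set_partitions_sub[OF \<nu>] that by auto
    then have "mat_mult (set \<phi>) P (arc_part \<mu>) i l \<noteq> 0"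
      using R(1) key[symmetric] entry\<nu>[OF that, of l] by (auto simp: borel_def)
    then obtain k where "P i k * arc_part \<mu> k l \<noteq> 0"
      unfolding mat_mult_def by (meson sum.neutral)
    then show ?thesis
      using upper_tri_zero[OF borel_upper[OF PQ(1)], of i k]
      by (intro exI[of _ k]) (auto simp: arc_part_def split: if_splits)
  qed
  have sub: "(k, j) \<in> \<mu> \<longrightarrow> (k, j) \<in> \<nu>" for k j
    using wf_precedes[OF d]
  proof (induction j arbitrary: k rule: wf_induct_rule)
    case (less j)
    show ?case
    proof
      assume kj: "(k, j) \<in> \<mu>"
      obtain l where l: "(k, l) \<in> \<nu>" "l = j \<or> precedes \<phi> l j"
        using row[OF kj] by blast
      show "(k, j) \<in> \<nu>"
      proof (cases "l = j")
        case False
        obtain k' where k': "(k', l) \<in> \<mu>" using col[OF l(1)] by blast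
        with less.IH[of l k'] False l have "k' = k"
          using set_partitionsD(3)[OF \<nu>] by auto
        then show ?thesis using set_partitionsD(2)[OF \<mu> kj] k' False by blast
      qed (use l in simp)
    qed
  qed
  moreover have "(i, l) \<in> \<mu>" if "(i, l) \<in> \<nu>" for i l
    using col[OF that] sub set_partitionsD(3)[OF \<nu> that] by metis
  ultimately show ?thesis by auto
qed

text \<open>The operations on the block are extended by a 1 at \<open>x\<close>. Since
  \<open>x\<close> comes first and its column is zero, only the row of \<open>x\<close> changes
  outside the block, and its new content is left open.\<close>

lemma tri_equiv_Cons_zero_col:
  assumes d: "distinct (x # \<phi>)"
    and X: "X \<in> upper_tri (x # \<phi>)" "\<And>i. X i x = 0"
    and "tri_equiv \<phi> (diag_block (set \<phi>) X) Y'"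
  shows "\<exists>Z. tri_equiv (x # \<phi>) X Z \<and> Z \<in> matrices (set (x # \<phi>)) \<and> (\<forall>i. Z i x = 0) \<and>
    (\<forall>i \<in> set \<phi>. \<forall>j \<in> set \<phi>. Z i j = Y' i j)"
proof -
  obtain P Q where PQ: "P \<in> borel \<phi>" "Q \<in> borel \<phi>" "\<forall>i \<in> set \<phi>. P i i * Q i i = 1"
     "Y' = mat_mult (set \<phi>) (mat_mult (set \<phi>) P (diag_block (set \<phi>) X)) Q"
    using assms unfolding tri_equiv_def by blast
  have x: "x \<notin> set \<phi>" using d by simp
  define E where "E = (\<lambda>P :: ('a, 'b) matr. \<lambda>i j. if i = x \<and> j = x then 1 else P i j)"
  have E: "E R \<in> borel (x # \<phi>)" "\<And>i. E R i x = (if i = x then 1 else 0)" "\<And>i. E R x i = (if i = x then 1 else 0)"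
    if "R \<in> borel \<phi>" for R
    using that x unfolding E_def borel_def upper_tri_def matrices_def by auto
  define Z where "Z = mat_mult (set (x # \<phi>)) (mat_mult (set (x # \<phi>)) (E P) X) (E Q)"
  have "tri_equiv (x # \<phi>) X Z"
    by (rule tri_equivI[where P = "E P" and Q = "E Q"]) (use PQ E Z_def x in \<open>auto simp: E_def\<close>)
  moreover have "Z \<in> matrices (set (x # \<phi>))"
    using mat_mult_upper(1)[OF d mat_mult_upper(1)[OF d borel_upper[OF E(1)[OF PQ(1)]] X(1)] borel_upper[OF E(1)[OF PQ(2)]]]
    unfolding Z_def by (rule upper_tri_matrices)
  moreover have "Z i x = 0" for i
    unfolding Z_def using x
    by (auto simp: mat_mult_def E(2)[OF PQ(2)] X(2) intro!: sum.neutral)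
  moreover have "Z i j = Y' i j" if ij: "i \<in> set \<phi>" "j \<in> set \<phi>" for i j
  proof -
    have "mat_mult (set (x # \<phi>)) (E P) X i k = mat_mult (set \<phi>) P (diag_block (set \<phi>) X) i k" if "k \<in> set \<phi>" for k
      using x ij that by (auto simp: mat_mult_def E_def diag_block_def E(2)[OF PQ(1)]
        upper_tri_outside[OF borel_upper[OF PQ(1)]] intro!: sum.cong)
    then show ?thesis
      using x ij unfolding Z_def PQ(4)
      by (subst (1 3) mat_mult_def) (auto simp: E_def upper_tri_outside[OF borel_upper[OF PQ(2)]] intro!: sum.cong)
  qed
  ultimately show ?thesis by blast
qed

text \<open>An arc of \<open>\<mu>\<close> from \<open>k\<close> to \<open>j\<close> means that row
  \<open>k\<close> has a single entry, in column \<open>j\<close>. As \<open>x\<close> precedes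
  \<open>k\<close>, a multiple of row \<open>k\<close> may be added to row \<open>x\<close>, and
  this clears column \<open>j\<close> there.\<close>

lemma tri_equiv_clear_row:
  assumes d: "distinct (x # \<phi>)" and \<mu>: "\<mu> \<in> set_partitions \<phi>"
    and Z: "Z \<in> matrices (set (x # \<phi>))" "\<And>i. Z i x = 0"
      "\<And>i j. i \<in> set \<phi> \<Longrightarrow> j \<in> set \<phi> \<Longrightarrow> Z i j = arc_part \<mu> i j"
  shows "\<exists>Y. tri_equiv (x # \<phi>) Z Y \<and> Y \<in> matrices (set (x # \<phi>)) \<and> (\<forall>i. Y i x = 0) \<and>
    (\<forall>i \<in> set \<phi>. \<forall>j \<in> set \<phi>. Y i j = arc_part \<mu> i j) \<and> (\<forall>k j. (k, j) \<in> \<mu> \<longrightarrow> Y x j = 0)"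
proof -
  have x: "x \<notin> set \<phi>" using d by simp
  let ?K = "set (x # \<phi>)"
  \<comment> \<open>At most one summand is nonzero: \<open>s k\<close> is minus the entry of row
    \<open>x\<close> that row \<open>k\<close> has to clear.\<close>
  define s where "s = (\<lambda>k. \<Sum>l\<in>set \<phi>. if (k, l) \<in> \<mu> then - Z x l else 0)"
  define P where "P = (\<lambda>i j. mat_one ?K i j + (if i = x \<and> j \<in> set \<phi> then s j else 0))"
  define Y where "Y = mat_mult ?K P Z"
  have s: "s k = - Z x j" if "(k, j) \<in> \<mu>" for k j
  proof -
    have "s k = (\<Sum>l\<in>set \<phi>. if l = j then - Z x j else 0)"
      unfolding s_def by (intro sum.cong) (use that in \<open>auto dest: set_partitionsD(2)[OF \<mu>]\<close>)
    also have "\<dots> = - Z x j" using set_partitions_sub[OF \<mu>] that by auto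
    finally show ?thesis .
  qed
  have P: "P \<in> unitri (x # \<phi>)"
    using x unfolding P_def unitri_def matrices_def mat_one_def by auto
  have entry: "Y i j = Z i j + (if i = x then \<Sum>l\<in>set \<phi>. s l * Z l j else 0)" for i j
  proof -
    have "Y i j = mat_mult ?K (mat_one ?K) Z i j + (\<Sum>l\<in>?K. (if i = x \<and> l \<in> set \<phi> then s l else 0) * Z l j)"
      unfolding Y_def mat_mult_def P_def by (simp only: distrib_right sum.distrib)
    also have "mat_mult ?K (mat_one ?K) Z = Z"
      using Z(1) by (intro mat_mult_one_left) auto
    also have "(\<Sum>l\<in>?K. (if i = x \<and> l \<in> set \<phi> then s l else 0) * Z l j) =
        (if i = x then \<Sum>l\<in>set \<phi>. s l * Z l j else 0)"
      using x by (auto intro!: sum.cong)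
    finally show ?thesis .
  qed
  have "tri_equiv (x # \<phi>) Z Y"
  proof (rule tri_equivI[where P = P and Q = "mat_one ?K"])
    show "Y = mat_mult ?K (mat_mult ?K P Z) (mat_one ?K)"
      unfolding Y_def using Z(1) P
      by (intro mat_mult_one_right[symmetric]) (auto simp: matrices_def mat_mult_def unitri_def)
  qed (use P in \<open>simp_all add: unitri_borel mat_one_unitri unitri_diag unitri_diag[OF mat_one_unitri] del: set_simps\<close>)
  moreover have "Y \<in> matrices ?K"
    unfolding Y_def using Z(1) P by (auto simp: matrices_def mat_mult_def unitri_def)
  moreover have "Y i x = 0" for i
    by (simp add: entry Z(2))
  moreover have "Y i j = arc_part \<mu> i j" if "i \<in> set \<phi>" "j \<in> set \<phi>" for i j
    using that x by (auto simp: entry Z(3))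
  moreover have "Y x j = 0" if "(k, j) \<in> \<mu>" for k j
  proof -
    have kj: "k \<in> set \<phi>" "j \<in> set \<phi>" using set_partitions_sub[OF \<mu>] that by auto
    have "(\<Sum>l\<in>set \<phi>. s l * Z l j) = (\<Sum>l\<in>set \<phi>. if l = k then - Z x j else 0)"
      by (intro sum.cong)
         (use that kj s in \<open>auto simp: Z(3) arc_part_def dest: set_partitionsD(3)[OF \<mu>]\<close>)
    then show ?thesis using kj by (simp add: entry)
  qed
  ultimately show ?thesis by blast
qed

text \<open>No arc of \<open>\<mu>\<close> ends at \<open>j\<close>, so column \<open>j\<close> has
  no entry besides the one in row \<open>x\<close>. Adding multiples of it to later columns clears
  the rest of row \<open>x\<close> and touches no other row.\<close>

lemma tri_equiv_pivot:
  assumes d: "distinct (x # \<phi>)" and \<mu>: "\<mu> \<in> set_partitions \<phi>"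
    and Z: "Z \<in> matrices (set (x # \<phi>))" "\<And>i. Z i x = 0"
      "\<And>i j. i \<in> set \<phi> \<Longrightarrow> j \<in> set \<phi> \<Longrightarrow> Z i j = arc_part \<mu> i j"
      "\<And>k j. (k, j) \<in> \<mu> \<Longrightarrow> Z x j = 0"
    and j: "j \<in> set \<phi>" "Z x j \<noteq> 0" "\<And>k. precedes \<phi> k j \<Longrightarrow> Z x k = 0"
  shows "tri_equiv (x # \<phi>) Z (arc_part (insert (x, j) \<mu>))"
proof -
  have x: "x \<notin> set \<phi>" using d by simp
  let ?K = "set (x # \<phi>)"
  define c where "c = Z x j"
  define p where "p = (\<lambda>i. if i = x then inverse c else 1)"
  define P where "P = (\<lambda>i k. if i = k \<and> i \<in> ?K then p i else 0)"
  \<comment> \<open>Scaling row \<open>x\<close> by \<open>inverse c\<close> forces a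
    \<open>c\<close> here, because the two diagonals must be inverse to each other; it does no harm
    since column \<open>x\<close> is zero.\<close>
  define D where "D = (\<lambda>i k. if i = k \<and> i \<in> ?K then (if i = x then c else 1) else 0)"
  define r where "r = (\<lambda>k. if precedes \<phi> j k then - Z x k / c else 0)"
  define Q where "Q = (\<lambda>i k. D i k + (if i = j then r k else 0))"
  have c: "c \<noteq> 0" using j by (simp add: c_def)
  have jx: "j \<noteq> x" using j x by auto
  have rx: "r x = 0" using x precedes_in_set by (fastforce simp: r_def)
  have rj: "r j = 0" using d by (simp add: r_def)
  have P: "P \<in> borel (x # \<phi>)"
    using c x unfolding P_def p_def borel_def upper_tri_def matrices_def by auto
  have Q: "Q \<in> borel (x # \<phi>)"
    using c x j jx rj unfolding Q_def D_def borel_def upper_tri_def matrices_def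
    by (auto simp: r_def dest: precedes_in_set)
  have entry: "mat_mult ?K (mat_mult ?K P Z) Q i k =
      p i * (Z i k + Z i j * r k)" if "i \<in> ?K" "k \<in> ?K" for i k
  proof -
    have "mat_mult ?K P Z i l = (\<Sum>m\<in>?K. if m = i then p i * Z i l else 0)" for l
      unfolding mat_mult_def P_def using that(1) by (intro sum.cong) auto
    then have PZ: "mat_mult ?K P Z i l = p i * Z i l" for l
      using that(1) by (simp add: sum.delta del: set_simps)
    have "mat_mult ?K (mat_mult ?K P Z) Q i k =
      (\<Sum>l\<in>?K. (if l = k then p i * Z i k * D k k else 0) +
         (if l = j then p i * Z i j * r k else 0))"
      unfolding mat_mult_def[of _ _ Q] PZ
      by (intro sum.cong) (auto simp: Q_def D_def algebra_simps)
    also have "\<dots> = p i * Z i k * D k k +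
        p i * Z i j * r k"
      using that(2) j(1) by (simp add: sum.distrib sum.delta del: set_simps) auto
    finally show ?thesis
      using Z(2)[of i] that(2) by (auto simp: D_def algebra_simps)
  qed
  have nj: "(i, j) \<notin> \<mu>" for i using Z(4)[of i j] j(2) by auto
  have \<mu>x: "(x, k) \<notin> \<mu>" "(k, x) \<notin> \<mu>" for k using set_partitions_sub[OF \<mu>] x by auto
  show ?thesis
  proof (rule tri_equivI[OF P Q])
    fix i assume "i \<in> ?K"
    then show "P i i * Q i i = 1"
      using c jx rj by (auto simp: P_def Q_def D_def p_def)
  next
    show "arc_part (insert (x, j) \<mu>) = mat_mult ?K (mat_mult ?K P Z) Q"
    proof (intro ext)
      fix i k
      show "arc_part (insert (x, j) \<mu>) i k = mat_mult ?K (mat_mult ?K P Z) Q i k"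
      proof (cases "i \<in> ?K \<and> k \<in> ?K")
        case False
        then have "arc_part (insert (x, j) \<mu>) i k = 0"
          using set_partitions_sub[OF \<mu>] j(1) by (auto simp: arc_part_def)
        moreover have "mat_mult ?K (mat_mult ?K P Z) Q i k = 0"
          using False upper_tri_outside[OF borel_upper[OF P], of i]
            upper_tri_outside[OF borel_upper[OF Q], of _ k]
          by (auto simp: mat_mult_def simp del: set_simps)
        ultimately show ?thesis by simp
      next
        case True
        show ?thesis
        proof (cases "k = x")
          case True
          then show ?thesis using \<open>i \<in> ?K \<and> k \<in> ?K\<close>
            by (simp add: entry Z(2) rx arc_part_def \<mu>x jx[symmetric] del: set_simps)
        next
          case kx: False
          then have k: "k \<in> set \<phi>" using True by auto
          show ?thesis
          proof (cases "i = x")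
            case True
            have "k = j \<or> precedes \<phi> j k \<or> precedes \<phi> k j"
              using precedes_total[OF k j(1)] by auto
            moreover have "\<not> precedes \<phi> k j" if "precedes \<phi> j k"
              using precedes_asym[of \<phi>] d that by auto
            ultimately show ?thesis
              using \<open>i \<in> ?K \<and> k \<in> ?K\<close> True c rj j(3) d
              by (auto simp add: entry arc_part_def \<mu>x c_def r_def p_def simp del: set_simps)
          next
            case False
            then have "i \<in> set \<phi>" using \<open>i \<in> ?K \<and> k \<in> ?K\<close> by auto
            then show ?thesis
              using \<open>i \<in> ?K \<and> k \<in> ?K\<close> False k j(1) nj
              by (simp add: entry arc_part_def Z(3) p_def del: set_simps)
          qed
        qed
      qed
    qed
  qed
qed

text \<open>Gaussian elimination with triangular operations only, from the last row upwards. In the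
  row of the first letter the columns where arcs of \<open>\<mu>\<close> end are cleared by row
  operations, and the leftmost remaining entry, if there is one, becomes the only new arc.\<close>

lemma tri_equiv_arc_part_ex:
  assumes "distinct \<phi>" "X \<in> upper_tri \<phi>" "\<And>i. X i i = 0"
  shows "\<exists>\<mu> \<in> set_partitions \<phi>. tri_equiv \<phi> X (arc_part \<mu>)"
  using assms
proof (induction \<phi> arbitrary: X)
  case Nil
  then have "X = arc_part {}"
    by (auto simp: upper_tri_def matrices_def arc_part_def)
  moreover have "tri_equiv [] X X"
    using Nil by (intro tri_equiv_refl) (simp add: upper_tri_def)
  ultimately show ?case by (intro bexI[of _ "{}"]) (auto simp: set_partitions_def)
next
  case (Cons x \<phi>)
  have x: "x \<notin> set \<phi>" and d: "distinct \<phi>" using Cons.prems by auto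
  have Xx: "X i x = 0" for i
    using Cons.prems(3)[of x] upper_tri_zero[OF Cons.prems(2), of i x] x precedes_in_set[of \<phi> i x]
    by (cases "i = x") auto
  have "diag_block (set \<phi>) X \<in> upper_tri \<phi>"
    using Cons.prems(2) x unfolding upper_tri_def matrices_def diag_block_def
    by (auto split: if_splits)
  moreover have "diag_block (set \<phi>) X i i = 0" for i
    using Cons.prems(3) by (simp add: diag_block_def)
  ultimately obtain \<mu> where \<mu>: "\<mu> \<in> set_partitions \<phi>" "tri_equiv \<phi> (diag_block (set \<phi>) X) (arc_part \<mu>)"
    using Cons.IH[OF d] by blast
  obtain Z where Z: "tri_equiv (x # \<phi>) X Z" "Z \<in> matrices (set (x # \<phi>))" "\<And>i. Z i x = 0"
    "\<And>i j. i \<in> set \<phi> \<Longrightarrow> j \<in> set \<phi> \<Longrightarrow> Z i j = arc_part \<mu> i j"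
    using tri_equiv_Cons_zero_col[OF Cons.prems(1,2) Xx \<mu>(2)] by blast
  obtain Y where Y: "tri_equiv (x # \<phi>) Z Y" "Y \<in> matrices (set (x # \<phi>))" "\<And>i. Y i x = 0"
    "\<And>i j. i \<in> set \<phi> \<Longrightarrow> j \<in> set \<phi> \<Longrightarrow> Y i j = arc_part \<mu> i j"
    "\<And>k j. (k, j) \<in> \<mu> \<Longrightarrow> Y x j = 0"
    using tri_equiv_clear_row[OF Cons.prems(1) \<mu>(1) Z(2-4)] by blast
  have XY: "tri_equiv (x # \<phi>) X Y"
    using tri_equiv_trans[OF Cons.prems(1) Z(1) Y(1)] .
  have \<mu>x: "(x, k) \<notin> \<mu>" "(k, x) \<notin> \<mu>" for k using set_partitions_sub[OF \<mu>(1)] x by auto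
  show ?case
  proof (cases "\<exists>j \<in> set \<phi>. Y x j \<noteq> 0")
    case True
    then obtain j where j: "j \<in> set \<phi>" "Y x j \<noteq> 0" "\<And>k. precedes \<phi> k j \<Longrightarrow> \<not> Y x k \<noteq> 0"
      using first_satisfying[OF d, of _ "\<lambda>j. Y x j \<noteq> 0"] by metis
    have "tri_equiv (x # \<phi>) Y (arc_part (insert (x, j) \<mu>))"
      by (rule tri_equiv_pivot[OF Cons.prems(1) \<mu>(1)]) (use Y(2-5) j in blast)+
    moreover have "(k, j) \<notin> \<mu>" for k using Y(5)[of k j] j(2) by auto
    then have "insert (x, j) \<mu> \<in> set_partitions (x # \<phi>)"
      using set_partitionsD[OF \<mu>(1)] j(1) \<mu>x by (intro set_partitionsI) auto
    ultimately show ?thesis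
      using tri_equiv_trans[OF Cons.prems(1) XY] by blast
  next
    case False
    have "Y = arc_part \<mu>"
    proof (intro ext)
      fix i j
      have "Y i j = arc_part \<mu> i j" if "\<not> (i \<in> set \<phi> \<and> j \<in> set \<phi>)"
      proof -
        have "arc_part \<mu> i j = (0 :: 'b)"
          using that set_partitions_sub[OF \<mu>(1)] by (auto simp: arc_part_def)
        moreover have "Y i j = 0"
          using that False Y(2,3) by (cases "i = x"; cases "j = x") (auto simp: matrices_def)
        ultimately show ?thesis by simp
      qed
      then show "Y i j = arc_part \<mu> i j" using Y(4) by blast
    qed
    moreover have "\<mu> \<in> set_partitions (x # \<phi>)"
      using set_partitionsD[OF \<mu>(1)] by (intro set_partitionsI) auto
    ultimately show ?thesis using XY by blast
  qed
qed

lemma superclass_index: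
  assumes d: "distinct \<phi>" and u: "(u :: ('a, 'f::field) matr) \<in> unitri \<phi>"
  shows "superclass_index \<phi> u \<in> set_partitions \<phi>"
    and "same_superclass \<phi> (arc_mat (set \<phi>) (superclass_index \<phi> u)) u"
proof -
  let ?X = "mat_minus u (mat_one (set \<phi>))"
  have "?X \<in> upper_tri \<phi>"
    using u by (auto simp: mat_minus_def mat_one_def upper_tri_def unitri_iff_borel borel_def matrices_def)
  moreover have "?X i i = 0" for i
    using u by (auto simp: mat_minus_def mat_one_def unitri_def matrices_def)
  ultimately obtain \<mu> where \<mu>: "\<mu> \<in> set_partitions \<phi>" "tri_equiv \<phi> ?X (arc_part \<mu>)"
    using tri_equiv_arc_part_ex[OF d] by blast
  have "same_superclass \<phi> (arc_mat (set \<phi>) \<mu>) u"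
    using \<mu> d u mat_minus_one_matrices[OF u]
    by (simp add: same_superclass_iff arc_mat_minus_one arc_mat_unitri tri_equiv_sym)
  moreover have "\<nu> = \<mu>" if "\<nu> \<in> set_partitions \<phi>" "same_superclass \<phi> (arc_mat (set \<phi>) \<nu>) u" for \<nu>
    using tri_equiv_arc_part_eq[OF d that(1) \<mu>(1)] that(2) \<mu>(2) tri_equiv_trans[OF d]
    by (auto simp: same_superclass_iff[OF d] arc_mat_minus_one)
  ultimately have "\<exists>!\<mu>. \<mu> \<in> set_partitions \<phi> \<and> same_superclass \<phi> (arc_mat (set \<phi>) \<mu>) u"
    using \<mu>(1) by blast
  from theI'[OF this]
  show "superclass_index \<phi> u \<in> set_partitions \<phi>"
    and "same_superclass \<phi> (arc_mat (set \<phi>) (superclass_index \<phi> u)) u"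
    unfolding superclass_index_def by blast+
qed

lemma superclass_index_unique:
  fixes u :: "('a, 'f::field) matr"
  assumes d: "distinct \<phi>" and "\<mu> \<in> set_partitions \<phi>" "same_superclass \<phi> (arc_mat (set \<phi>) \<mu>) u"
  shows "superclass_index \<phi> u = \<mu>"
proof -
  have u: "u \<in> unitri \<phi>" using assms(3) by (simp add: same_superclass_def)
  have "same_superclass \<phi> (arc_mat (set \<phi>) \<mu> :: ('a, 'f) matr) (arc_mat (set \<phi>) (superclass_index \<phi> u))"
    using same_superclass_trans[OF d assms(3) same_superclass_sym[OF d superclass_index(2)[OF d u]]] .
  then show ?thesis
    using tri_equiv_arc_part_eq[OF d assms(2) superclass_index(1)[OF d u]]
    by (auto simp: same_superclass_iff[OF d] arc_mat_minus_one)
qed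

lemma superclass_index_cong:
  assumes d: "distinct \<phi>" and "same_superclass \<phi> u v"
  shows "superclass_index \<phi> u = superclass_index \<phi> v"
proof -
  have v: "v \<in> unitri \<phi>" using assms(2) by (simp add: same_superclass_def)
  show ?thesis
    using superclass_index[OF d v] same_superclass_trans[OF d _ same_superclass_sym[OF d assms(2)]]
    by (intro superclass_index_unique[OF d]) auto
qed

lemma superclass_index_arc_mat:
  assumes "distinct \<phi>" "\<mu> \<in> set_partitions \<phi>"
  shows "superclass_index \<phi> (arc_mat (set \<phi>) \<mu> :: ('a, 'f::field) matr) = \<mu>"
  using assms by (intro superclass_index_unique same_superclass_refl arc_mat_unitri)

lemma supercharacter_scfU:
  assumes "\<tau> \<in> permutations_of_set K"
  shows "(supercharacter \<tau> \<Lambda> :: ('a, 'f::{finite, field}) family) \<in> scfU K"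
proof -
  have "distinct \<tau>" using assms by (simp add: permutations_of_setD)
  then have sc: "supercharacter \<tau> \<Lambda> \<tau> u = supercharacter \<tau> \<Lambda> \<tau> v"
    if "same_superclass \<tau> u v" for u v :: "('a, 'f) matr"
    using that superclass_index_cong[OF _ that] by (simp add: supercharacter_def same_superclass_def)
  have zero: "supercharacter \<tau> \<Lambda> \<phi> u = (0 :: complex)" if "\<phi> \<noteq> \<tau> \<or> u \<notin> unitri \<phi>"
    for \<phi> and u :: "('a, 'f) matr"
    using that by (auto simp: supercharacter_def)
  have "(supercharacter \<tau> \<Lambda> \<phi> :: ('a, 'f) matr \<Rightarrow> complex) \<in> scf \<phi>" for \<phi>
    unfolding scf_def by (cases "\<phi> = \<tau>") (auto simp: zero dest: sc)
  moreover have "(supercharacter \<tau> \<Lambda> \<phi> :: ('a, 'f) matr \<Rightarrow> complex) = (\<lambda>_. 0)"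
    if "\<phi> \<notin> permutations_of_set K" for \<phi>
    using zero[of \<phi>] that assms by (intro ext) auto
  ultimately show ?thesis
    unfolding scfU_def by blast
qed

section \<open>The antipode\<close>

definition segmentations :: "'a list \<Rightarrow> 'a list list set" where
  "segmentations \<rho> = {ss. [] \<notin> set ss \<and> concat ss = \<rho>}"

lemma segmentations_Nil [simp]: "segmentations [] = {[]}"
  by (auto simp: segmentations_def) (metis list.set_intros(1) neq_Nil_conv)

lemma finite_segmentations [simp]: "finite (segmentations \<rho>)"
proof (rule finite_subset)
  have "length ss \<le> length (concat ss)" if "[] \<notin> set ss" for ss :: "'a list list"
    using that
  proof (induction ss)
    case (Cons s ss)
    then have "length s > 0" by auto
    then have "1 \<le> length s" by linarith
    with Cons show ?case by simp
  qed simp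
  moreover have "length s \<le> length (concat ss)" if "s \<in> set ss" for s and ss :: "'a list list"
    using that by (induction ss) auto
  ultimately show "segmentations \<rho> \<subseteq> {ss. set ss \<subseteq> {s. set s \<subseteq> set \<rho> \<and> length s \<le> length \<rho>} \<and> length ss \<le> length \<rho>}"
    by (auto simp: segmentations_def)
  show "finite {ss. set ss \<subseteq> {s. set s \<subseteq> set \<rho> \<and> length s \<le> length \<rho>} \<and> length ss \<le> length \<rho>}"
    by (intro finite_lists_length_le) simp
qed

lemma sum_segmentations_first:
  fixes f :: "'a list list \<Rightarrow> 'b::comm_monoid_add"
  assumes "\<rho> \<noteq> []"
  shows "(\<Sum>ss\<in>segmentations \<rho>. f ss) =
    (\<Sum>k\<in>{1..length \<rho>}. \<Sum>ss\<in>segmentations (drop k \<rho>). f (take k \<rho> # ss))"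
proof -
  have "(\<Sum>ss\<in>segmentations \<rho>. f ss) =
    (\<Sum>(k, ss)\<in>(SIGMA k:{1..length \<rho>}. segmentations (drop k \<rho>)). f (take k \<rho> # ss))"
  proof (rule sum.reindex_bij_witness[where i = "\<lambda>(k, ss). take k \<rho> # ss" and j = "\<lambda>ss. (length (hd ss), tl ss)"])
    fix ss assume "ss \<in> segmentations \<rho>"
    then obtain s ss' where "ss = s # ss'" "s \<noteq> []" "[] \<notin> set ss'" "\<rho> = s @ concat ss'"
      using assms by (cases ss) (auto simp: segmentations_def)
    then show "(case (length (hd ss), tl ss) of (k, ss) \<Rightarrow> take k \<rho> # ss) = ss"
      "(length (hd ss), tl ss) \<in> (SIGMA k:{1..length \<rho>}. segmentations (drop k \<rho>))"
      "(case (length (hd ss), tl ss) of (k, ss) \<Rightarrow> f (take k \<rho> # ss)) = f ss"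
      by (auto simp: segmentations_def Suc_le_eq)
  qed (auto simp: segmentations_def min_def append_eq_conv_conj)
  then show ?thesis by (simp add: sum.Sigma)
qed

lemma sum_segmentations_last:
  fixes f :: "'a list list \<Rightarrow> 'b::comm_monoid_add"
  assumes "\<rho> \<noteq> []"
  shows "(\<Sum>ss\<in>segmentations \<rho>. f ss) =
    (\<Sum>k<length \<rho>. \<Sum>ss\<in>segmentations (take k \<rho>). f (ss @ [drop k \<rho>]))"
proof -
  have "(\<Sum>ss\<in>segmentations \<rho>. f ss) =
    (\<Sum>(k, ss)\<in>(SIGMA k:{..<length \<rho>}. segmentations (take k \<rho>)). f (ss @ [drop k \<rho>]))"
  proof (rule sum.reindex_bij_witness[where i = "\<lambda>(k, ss). ss @ [drop k \<rho>]"
        and j = "\<lambda>ss. (length \<rho> - length (last ss), butlast ss)"])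
    fix ss assume "ss \<in> segmentations \<rho>"
    then obtain s ss' where "ss = ss' @ [s]" "s \<noteq> []" "[] \<notin> set ss'" "\<rho> = concat ss' @ s"
      using assms by (cases ss rule: rev_cases) (auto simp: segmentations_def)
    then show "(case (length \<rho> - length (last ss), butlast ss) of (k, ss) \<Rightarrow> ss @ [drop k \<rho>]) = ss"
      "(length \<rho> - length (last ss), butlast ss) \<in> (SIGMA k:{..<length \<rho>}. segmentations (take k \<rho>))"
      "(case (length \<rho> - length (last ss), butlast ss) of (k, ss) \<Rightarrow> f (ss @ [drop k \<rho>])) = f ss"
      by (auto simp: segmentations_def)
  qed (auto simp: segmentations_def)
  then show ?thesis by (simp add: sum.Sigma)
qed

section \<open>Block-diagonal parts along a cut\<close>

lemma distinct_concat_eq: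
  "distinct (concat ss) \<Longrightarrow> s \<in> set ss \<Longrightarrow> s' \<in> set ss \<Longrightarrow> x \<in> set s \<Longrightarrow> x \<in> set s' \<Longrightarrow> s = s'"
  by (induction ss) auto

definition compatible :: "'a set \<Rightarrow> 'a list list \<Rightarrow> 'a list set" where
  "compatible K ss = {\<phi> \<in> permutations_of_set K. \<forall>s \<in> set ss. restr (set s) \<phi> = s}"

definition cut_blocks :: "'a list list \<Rightarrow> ('a, 'f::field) matr \<Rightarrow> ('a, 'f) matr" where
  "cut_blocks ss u = (\<lambda>i j. if \<exists>s \<in> set ss. i \<in> set s \<and> j \<in> set s then u i j else 0)"

text \<open>The alternating sum of iterated coproducts followed by iterated products, written out at
  the component \<open>\<rho>\<close>. Of all ordered decompositions of \<open>K\<close> only those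
  into consecutive segments of \<open>\<rho>\<close> survive the product, and
  \<open>compatible\<close> collects the orders that the coproduct sends to these segments.\<close>

definition takeuchi :: "'a set \<Rightarrow> ('a, 'f::field) family \<Rightarrow> ('a, 'f) family" where
  "takeuchi K F = (\<lambda>\<rho> w. if \<rho> \<in> permutations_of_set K \<and> w \<in> unitri \<rho>
     then \<Sum>ss\<in>segmentations \<rho>. (-1) ^ length ss * (\<Sum>\<phi>\<in>compatible K ss. F \<phi> (cut_blocks ss w))
     else 0)"

lemma finite_compatible [simp]: "finite (compatible K ss)"
  by (simp add: compatible_def)

lemma restr_superset: "set \<phi> \<subseteq> J \<Longrightarrow> restr J \<phi> = \<phi>"
  unfolding restr_def by (simp add: filter_id_conv subset_iff)

lemma restr_disjoint: "set \<phi> \<inter> J = {} \<Longrightarrow> restr J \<phi> = []"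
  unfolding restr_def by (auto simp: filter_empty_conv)

lemma restr_append: "restr J (\<alpha> @ \<beta>) = restr J \<alpha> @ restr J \<beta>"
  by (simp add: restr_def)

lemma restr_restr: "restr I (restr J \<phi>) = restr (I \<inter> J) \<phi>"
  unfolding restr_def by (auto intro: filter_cong)

lemma restr_permutation:
  "\<phi> \<in> permutations_of_set K \<Longrightarrow> I \<subseteq> K \<Longrightarrow> restr I \<phi> \<in> permutations_of_set I"
  by (auto simp: permutations_of_set_def restr_def)

lemma segment_split:
  assumes "ss \<in> segmentations \<rho>" "s \<in> set ss"
  obtains \<alpha> \<gamma> where "\<rho> = \<alpha> @ s @ \<gamma>"
proof -
  obtain xs ys where "ss = xs @ s # ys" using assms(2) by (meson split_list)
  then have "\<rho> = concat xs @ s @ concat ys" using assms(1) by (auto simp: segmentations_def)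
  then show thesis by (rule that)
qed

lemma segment_restr:
  assumes "distinct \<rho>" "ss \<in> segmentations \<rho>" "s \<in> set ss"
  shows "restr (set s) \<rho> = s"
proof -
  obtain \<alpha> \<gamma> where "\<rho> = \<alpha> @ s @ \<gamma>" using segment_split[OF assms(2,3)] .
  then show ?thesis
    using assms(1) by (simp add: restr_append restr_superset restr_disjoint Int_Un_distrib inf_commute)
qed

lemma segment_convex:
  assumes "distinct \<rho>" "ss \<in> segmentations \<rho>" "s \<in> set ss"
    "i \<in> set s" "j \<in> set s" "precedes \<rho> i k" "precedes \<rho> k j"
  shows "k \<in> set s"
proof -
  obtain \<alpha> \<gamma> where \<rho>: "\<rho> = \<alpha> @ s @ \<gamma>" using segment_split[OF assms(2,3)] .
  have "i \<notin> set \<alpha>" "i \<notin> set \<gamma>" "j \<notin> set \<alpha>" "j \<notin> set \<gamma>" "set \<alpha> \<inter> set \<gamma> = {}"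
    using assms(1,4,5) \<rho> by auto
  then show ?thesis
    using assms(6,7) unfolding \<rho> by (auto dest: precedes_in_set)
qed

lemma segment_cover: "ss \<in> segmentations \<rho> \<Longrightarrow> i \<in> set \<rho> \<Longrightarrow> \<exists>s \<in> set ss. i \<in> set s"
  by (auto simp: segmentations_def)

lemma compatible_set: "\<phi> \<in> compatible K ss \<Longrightarrow> set \<phi> = K" "\<phi> \<in> compatible K ss \<Longrightarrow> distinct \<phi>"
  by (auto simp: compatible_def permutations_of_set_def)

lemma compatible_precedes:
  assumes "distinct \<rho>" "ss \<in> segmentations \<rho>" "\<phi> \<in> compatible K ss" "s \<in> set ss" "i \<in> set s" "j \<in> set s"
  shows "precedes \<phi> i j \<longleftrightarrow> precedes \<rho> i j"
proof -
  have "restr (set s) \<phi> = restr (set s) \<rho>"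
    using assms segment_restr[OF assms(1,2,4)] by (simp add: compatible_def)
  then show ?thesis
    using precedes_restr[of "set s" \<phi> i j] precedes_restr[of "set s" \<rho> i j] assms(5,6) by simp
qed

lemma cut_blocks_upper:
  assumes "distinct \<rho>" "ss \<in> segmentations \<rho>" "\<phi> \<in> compatible (set \<rho>) ss" "u \<in> upper_tri \<rho>"
  shows "cut_blocks ss u \<in> upper_tri \<phi>"
  using assms(4) compatible_precedes[OF assms(1-3)] compatible_set(1)[OF assms(3)]
  unfolding upper_tri_def matrices_def cut_blocks_def by auto blast

lemma cut_blocks_diag: "ss \<in> segmentations \<rho> \<Longrightarrow> i \<in> set \<rho> \<Longrightarrow> cut_blocks ss u i i = u i i"
  using segment_cover[of ss \<rho> i] by (auto simp: cut_blocks_def)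

lemma cut_blocks_borel:
  assumes "distinct \<rho>" "ss \<in> segmentations \<rho>" "\<phi> \<in> compatible (set \<rho>) ss" "u \<in> borel \<rho>"
  shows "cut_blocks ss u \<in> borel \<phi>"
  using assms cut_blocks_upper[OF assms(1-3) borel_upper[OF assms(4)]] compatible_set(1)[OF assms(3)]
  by (simp add: borel_def cut_blocks_diag)

lemma cut_blocks_unitri:
  assumes "distinct \<rho>" "ss \<in> segmentations \<rho>" "\<phi> \<in> compatible (set \<rho>) ss" "u \<in> unitri \<rho>"
  shows "cut_blocks ss u \<in> unitri \<phi>"
  using assms cut_blocks_borel[OF assms(1-3) unitri_borel[OF assms(4)]] compatible_set(1)[OF assms(3)]
  by (simp add: unitri_iff_borel cut_blocks_diag)

text \<open>Segments are intervals of \<open>\<rho>\<close>: for \<open>i\<close> and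
  \<open>j\<close> in one segment, a nonzero product \<open>u i k * v k j\<close> places
  \<open>k\<close> weakly between them, hence in the same segment.\<close>

lemma cut_blocks_mult:
  assumes d: "distinct \<rho>" and ss: "ss \<in> segmentations \<rho>" and "u \<in> upper_tri \<rho>" "v \<in> upper_tri \<rho>"
  shows "cut_blocks ss (mat_mult (set \<rho>) u v) = mat_mult (set \<rho>) (cut_blocks ss u) (cut_blocks ss v)"
proof (intro ext)
  fix i j
  have dc: "distinct (concat ss)" using d ss by (simp add: segmentations_def)
  show "cut_blocks ss (mat_mult (set \<rho>) u v) i j = mat_mult (set \<rho>) (cut_blocks ss u) (cut_blocks ss v) i j"
  proof (cases "\<exists>s \<in> set ss. i \<in> set s \<and> j \<in> set s")
    case True
    then obtain s where s: "s \<in> set ss" "i \<in> set s" "j \<in> set s" by blast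
    have "u i k * v k j = cut_blocks ss u i k * cut_blocks ss v k j" for k
    proof (cases "k \<in> set s")
      case True
      then show ?thesis using s by (auto simp: cut_blocks_def)
    next
      case False
      have "\<not> (\<exists>s' \<in> set ss. i \<in> set s' \<and> k \<in> set s')"
        using distinct_concat_eq[OF dc] s False by blast
      then have "cut_blocks ss u i k = 0" unfolding cut_blocks_def by (simp only: if_False)
      moreover have "u i k * v k j = 0"
        using False s segment_convex[OF d ss s] upper_tri_zero[OF assms(3), of i k]
          upper_tri_zero[OF assms(4), of k j] by fastforce
      ultimately show ?thesis by simp
    qed
    then have "mat_mult (set \<rho>) u v i j = mat_mult (set \<rho>) (cut_blocks ss u) (cut_blocks ss v) i j"
      by (simp add: mat_mult_def)
    moreover have "cut_blocks ss (mat_mult (set \<rho>) u v) i j = mat_mult (set \<rho>) u v i j"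
      using True by (auto simp: cut_blocks_def)
    ultimately show ?thesis by simp
  next
    case False
    then have z: "cut_blocks ss u i k * cut_blocks ss v k j = 0" for k
      using distinct_concat_eq[OF dc] by (auto simp: cut_blocks_def)
    have "mat_mult (set \<rho>) (cut_blocks ss u) (cut_blocks ss v) i j = 0"
      by (simp only: mat_mult_def z sum.neutral_const)
    moreover have "cut_blocks ss (mat_mult (set \<rho>) u v) i j = 0"
      unfolding cut_blocks_def using False by (simp only: if_False)
    ultimately show ?thesis by simp
  qed
qed

text \<open>By multiplicativity the triangular factors witnessing the relation can be cut along with
  the matrices. The results are triangular for every compatible order, because it agrees with
  \<open>\<rho>\<close> inside each segment.\<close>

lemma cut_blocks_same_superclass:
  assumes d: "distinct \<rho>" and ss: "ss \<in> segmentations \<rho>" and \<phi>: "\<phi> \<in> compatible (set \<rho>) ss"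
    and uv: "same_superclass \<rho> u v"
  shows "same_superclass \<phi> (cut_blocks ss u) (cut_blocks ss v)"
proof -
  have d\<phi>: "distinct \<phi>" and K: "set \<phi> = set \<rho>" using compatible_set[OF \<phi>] by auto
  let ?one = "mat_one (set \<rho>)"
  have u: "u \<in> unitri \<rho>" and v: "v \<in> unitri \<rho>"
    and eq: "tri_equiv \<rho> (mat_minus u ?one) (mat_minus v ?one)"
    using uv same_superclass_iff[OF d] by blast+
  obtain P Q where PQ: "P \<in> borel \<rho>" "Q \<in> borel \<rho>" "\<forall>i \<in> set \<rho>. P i i * Q i i = 1"
     "mat_minus v ?one = mat_mult (set \<rho>) (mat_mult (set \<rho>) P (mat_minus u ?one)) Q"
    using eq unfolding tri_equiv_def by blast
  have minus: "mat_minus (cut_blocks ss x) ?one = cut_blocks ss (mat_minus x ?one)" for x :: "('a, 'b) matr"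
    using segment_cover[OF ss] by (auto simp: mat_minus_def cut_blocks_def mat_one_def fun_eq_iff)
  have X: "mat_minus u ?one \<in> upper_tri \<rho>"
    using u by (auto simp: mat_minus_def mat_one_def upper_tri_def unitri_iff_borel borel_def matrices_def)
  have "tri_equiv \<phi> (mat_minus (cut_blocks ss u) ?one) (mat_minus (cut_blocks ss v) ?one)"
  proof (rule tri_equivI)
    show "cut_blocks ss P \<in> borel \<phi>" "cut_blocks ss Q \<in> borel \<phi>"
      using cut_blocks_borel[OF d ss \<phi>] PQ by auto
    show "cut_blocks ss P i i * cut_blocks ss Q i i = 1" if "i \<in> set \<phi>" for i
      using that K PQ(3) by (simp add: cut_blocks_diag[OF ss])
    show "mat_minus (cut_blocks ss v) ?one =
      mat_mult (set \<phi>) (mat_mult (set \<phi>) (cut_blocks ss P) (mat_minus (cut_blocks ss u) ?one)) (cut_blocks ss Q)"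
      using PQ X d by (simp add: minus K cut_blocks_mult[OF d ss] mat_mult_upper borel_upper)
  qed
  then show ?thesis
    using cut_blocks_unitri[OF d ss \<phi> u] cut_blocks_unitri[OF d ss \<phi> v] by (simp add: same_superclass_iff[OF d\<phi>] K)
qed

lemma takeuchi_scfU:
  assumes F: "F \<in> scfU K"
  shows "takeuchi K F \<in> scfU K"
proof -
  have "takeuchi K F \<rho> u = takeuchi K F \<rho> v"
    if \<rho>: "\<rho> \<in> permutations_of_set K" and uv: "same_superclass \<rho> u v" for \<rho> u v
  proof -
    have d: "distinct \<rho>" and K: "set \<rho> = K" using \<rho> by (auto simp: permutations_of_set_def)
    have "F \<phi> (cut_blocks ss u) = F \<phi> (cut_blocks ss v)"
      if "ss \<in> segmentations \<rho>" "\<phi> \<in> compatible K ss" for ss \<phi>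
      using cut_blocks_same_superclass[OF d that(1) _ uv, of \<phi>] that F K
      by (auto simp: scfU_def scf_def compatible_def)
    moreover have "u \<in> unitri \<rho>" "v \<in> unitri \<rho>" using uv by (auto simp: same_superclass_def)
    ultimately show ?thesis by (simp add: takeuchi_def cong: sum.cong)
  qed
  moreover have "takeuchi K F \<rho> w = 0" if "w \<notin> unitri \<rho>" for \<rho> w
    using that by (simp add: takeuchi_def)
  ultimately have "takeuchi K F \<rho> \<in> scf \<rho>" if "\<rho> \<in> permutations_of_set K" for \<rho>
    using that unfolding scf_def by blast
  then show ?thesis by (auto simp: scfU_def takeuchi_def)
qed

lemma set_diff_take:
  assumes "distinct \<rho>"
  shows "set \<rho> - set (take k \<rho>) = set (drop k \<rho>)"
proof -
  have "set \<rho> = set (take k \<rho>) \<union> set (drop k \<rho>)"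
    by (metis append_take_drop_id set_append)
  then show ?thesis
    using set_take_disj_set_drop_if_distinct[OF assms, of k k] by blast
qed

text \<open>The product at \<open>\<rho>\<close> vanishes unless \<open>I\<close> consists of the
  letters of an initial piece of \<open>\<rho>\<close>, so the subsets are replaced by lengths of
  prefixes.\<close>

lemma sum_hm_mult:
  assumes \<rho>: "\<rho> \<in> permutations_of_set K" and w: "w \<in> unitri \<rho>"
  shows "(\<Sum>I\<in>Pow K. hm_mult I (K - I) (T I) \<rho> w) =
    (\<Sum>k\<le>length \<rho>. T (set (take k \<rho>)) (take k \<rho>) (drop k \<rho>)
       (diag_block (set (take k \<rho>)) w) (diag_block (set (drop k \<rho>)) w))"
proof -
  have d: "distinct \<rho>" and K: "set \<rho> = K" using \<rho> by (auto simp: permutations_of_set_def)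
  have fin: "finite K" using K by auto
  have diff: "K - set (take k \<rho>) = set (drop k \<rho>)" for k
    using set_diff_take[OF d] K by simp
  have restr: "restr (set (take k \<rho>)) \<rho> = take k \<rho>" "restr (set (drop k \<rho>)) \<rho> = drop k \<rho>" for k
  proof -
    have "set (take k \<rho>) \<inter> set (drop k \<rho>) = {}" using diff[of k] by blast
    then show "restr (set (take k \<rho>)) \<rho> = take k \<rho>" "restr (set (drop k \<rho>)) \<rho> = drop k \<rho>"
      using restr_append[of _ "take k \<rho>" "drop k \<rho>"] by (simp_all add: restr_superset restr_disjoint inf_commute)
  qed
  let ?A = "{I \<in> Pow K. \<rho> = restr I \<rho> @ restr (K - I) \<rho>}"
  have bij: "bij_betw (\<lambda>k. set (take k \<rho>)) {..length \<rho>} ?A"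
  proof (rule bij_betw_imageI)
    show "inj_on (\<lambda>k. set (take k \<rho>)) {..length \<rho>}"
    proof (rule inj_onI)
      fix k l assume "k \<in> {..length \<rho>}" "l \<in> {..length \<rho>}" "set (take k \<rho>) = set (take l \<rho>)"
      moreover have "card (set (take n \<rho>)) = n" if "n \<in> {..length \<rho>}" for n
        using d that by (simp add: distinct_card)
      ultimately show "k = l" by metis
    qed
    show "(\<lambda>k. set (take k \<rho>)) ` {..length \<rho>} = ?A"
    proof (intro equalityI subsetI)
      fix I assume "I \<in> (\<lambda>k. set (take k \<rho>)) ` {..length \<rho>}"
      then show "I \<in> ?A" using K restr diff by (auto dest: in_set_takeD)
    next
      fix I assume I: "I \<in> ?A"
      then have "restr I \<rho> = take (length (restr I \<rho>)) \<rho>" by (metis (mono_tags, lifting) append_eq_conv_conj mem_Collect_eq)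
      moreover have "set (restr I \<rho>) = I" using I K by auto
      ultimately have "I = set (take (length (restr I \<rho>)) \<rho>)" by simp
      moreover have "length (restr I \<rho>) \<le> length \<rho>" by (simp add: restr_def)
      ultimately show "I \<in> (\<lambda>k. set (take k \<rho>)) ` {..length \<rho>}" by blast
    qed
  qed
  have "(\<Sum>I\<in>Pow K. hm_mult I (K - I) (T I) \<rho> w) = (\<Sum>I\<in>?A. hm_mult I (K - I) (T I) \<rho> w)"
    using fin by (intro sum.mono_neutral_right) (auto simp: hm_mult_def)
  also have "\<dots> = (\<Sum>k\<le>length \<rho>. hm_mult (set (take k \<rho>)) (K - set (take k \<rho>)) (T (set (take k \<rho>))) \<rho> w)"
    by (rule sum.reindex_bij_betw[OF bij, symmetric])
  also have "\<dots> = (\<Sum>k\<le>length \<rho>. T (set (take k \<rho>)) (take k \<rho>) (drop k \<rho>)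
       (diag_block (set (take k \<rho>)) w) (diag_block (set (drop k \<rho>)) w))"
  proof (rule sum.cong)
    fix k
    have "set (take k \<rho>) \<union> set (drop k \<rho>) = K"
      using K by (metis append_take_drop_id set_append)
    then show "hm_mult (set (take k \<rho>)) (K - set (take k \<rho>)) (T (set (take k \<rho>))) \<rho> w =
      T (set (take k \<rho>)) (take k \<rho>) (drop k \<rho>) (diag_block (set (take k \<rho>)) w) (diag_block (set (drop k \<rho>)) w)"
      using \<rho> w by (simp add: hm_mult_def diff restr)
  qed simp
  finally show ?thesis .
qed

lemma sum_fibres:
  assumes "finite A" "finite P"
  shows "(\<Sum>y\<in>A. \<Sum>x\<in>{x \<in> P. r x = y \<and> Q x}. h x) = (\<Sum>x\<in>{x \<in> P. r x \<in> A \<and> Q x}. h x :: 'b::comm_monoid_add)"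
proof -
  have "(\<Sum>x\<in>{x \<in> P. r x \<in> A \<and> Q x}. h x) = (\<Sum>y\<in>A. \<Sum>x\<in>{x \<in> {x \<in> P. r x \<in> A \<and> Q x}. r x = y}. h x)"
    using assms by (intro sum.group[symmetric]) auto
  also have "\<dots> = (\<Sum>y\<in>A. \<Sum>x\<in>{x \<in> P. r x = y \<and> Q x}. h x)"
    by (intro sum.cong refl arg_cong[where f = "sum h"]) auto
  finally show ?thesis by simp
qed

section \<open>Takeuchi's formula\<close>

lemma diag_block_unitri:
  assumes "w \<in> unitri \<rho>" "distinct \<rho>" "J \<subseteq> set \<rho>"
  shows "diag_block J w \<in> unitri (restr J \<rho>)"
  using assms unfolding unitri_def diag_block_def matrices_def by auto

definition cut_term :: "'a set \<Rightarrow> ('a, 'f::field) family \<Rightarrow> ('a, 'f) matr \<Rightarrow> 'a list list \<Rightarrow> complex" where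
  "cut_term K F w ss = (\<Sum>\<phi>\<in>compatible K ss. F \<phi> (cut_blocks ss w))"

text \<open>Needed at the two extreme prefixes of the convolution sum, where one factor is empty and
  must not count as a segment.\<close>

lemma cut_term_Nil: "cut_term K F w (ss @ [[]]) = cut_term K F w ss" "cut_term K F w ([] # ss) = cut_term K F w ss"
proof -
  have "compatible K (ss @ [[]]) = compatible K ss" "compatible K ([] # ss) = compatible K ss"
    by (auto simp: compatible_def restr_def)
  moreover have "cut_blocks (ss @ [[]]) w = cut_blocks ss w" "cut_blocks ([] # ss) w = cut_blocks ss w"
    by (auto simp: cut_blocks_def)
  ultimately show "cut_term K F w (ss @ [[]]) = cut_term K F w ss" "cut_term K F w ([] # ss) = cut_term K F w ss"
    by (simp_all add: cut_term_def)
qed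

text \<open>Cutting after the coproduct is cutting with one more segment: an order compatible with
  \<open>ss @ [\<beta>]\<close> is one that restricts to \<open>\<beta>\<close> and whose
  restriction to the letters of \<open>\<alpha>\<close> is compatible with
  \<open>ss\<close>.\<close>

lemma takeuchi_comult:
  assumes d: "distinct (\<alpha> @ \<beta>)" and w: "w \<in> unitri (\<alpha> @ \<beta>)"
  shows "takeuchi (set \<alpha>) (\<lambda>\<alpha>' u'. hm_comult (set \<alpha>) (set \<beta>) F \<alpha>' \<beta> u' (diag_block (set \<beta>) w)) \<alpha> (diag_block (set \<alpha>) w) =
      (\<Sum>ss\<in>segmentations \<alpha>. (-1) ^ length ss * cut_term (set (\<alpha> @ \<beta>)) F w (ss @ [\<beta>]))" (is ?left)
    and "takeuchi (set \<beta>) (\<lambda>\<beta>' v'. hm_comult (set \<alpha>) (set \<beta>) F \<alpha> \<beta>' (diag_block (set \<alpha>) w) v') \<beta> (diag_block (set \<beta>) w) =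
      (\<Sum>ss\<in>segmentations \<beta>. (-1) ^ length ss * cut_term (set (\<alpha> @ \<beta>)) F w (\<alpha> # ss))" (is ?right)
proof -
  let ?I = "set \<alpha>" let ?J = "set \<beta>" let ?K = "set (\<alpha> @ \<beta>)"
  let ?P = "permutations_of_set (?I \<union> ?J)"
  let ?u = "diag_block ?I w" let ?v = "diag_block ?J w"
  have disj: "?I \<inter> ?J = {}" and d\<alpha>: "distinct \<alpha>" and d\<beta>: "distinct \<beta>" using d by auto
  have restr: "restr ?I (\<alpha> @ \<beta>) = \<alpha>" "restr ?J (\<alpha> @ \<beta>) = \<beta>"
    using disj by (simp_all add: restr_append restr_superset restr_disjoint inf_commute)
  have u: "?u \<in> unitri \<alpha>" and v: "?v \<in> unitri \<beta>"
    using diag_block_unitri[OF w d, of ?I] diag_block_unitri[OF w d, of ?J] restr by auto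
  have perm: "\<alpha> \<in> permutations_of_set ?I" "\<beta> \<in> permutations_of_set ?J"
    using d by (auto simp: permutations_of_set_def)
  show ?left
  proof -
    have "(\<Sum>\<phi>'\<in>compatible ?I ss. hm_comult ?I ?J F \<phi>' \<beta> (cut_blocks ss ?u) ?v) =
        cut_term ?K F w (ss @ [\<beta>])" if ss: "ss \<in> segmentations \<alpha>" for ss
    proof -
      have sub: "s \<in> set ss \<Longrightarrow> set s \<subseteq> ?I" for s using ss by (auto simp: segmentations_def)
      have blocks: "block_sum (cut_blocks ss ?u) ?v = cut_blocks (ss @ [\<beta>]) w"
        using sub disj by (intro ext) (auto simp: block_sum_def cut_blocks_def diag_block_def)
      have "(\<Sum>\<phi>'\<in>compatible ?I ss. hm_comult ?I ?J F \<phi>' \<beta> (cut_blocks ss ?u) ?v) =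
        (\<Sum>\<phi>'\<in>compatible ?I ss. \<Sum>\<phi>\<in>{\<phi> \<in> ?P. restr ?I \<phi> = \<phi>' \<and> restr ?J \<phi> = \<beta>}.
            F \<phi> (cut_blocks (ss @ [\<beta>]) w))"
        using cut_blocks_unitri[OF d\<alpha> ss _ u] v perm
        by (intro sum.cong) (auto simp: hm_comult_def blocks compatible_def)
      also have "\<dots> = (\<Sum>\<phi>\<in>{\<phi> \<in> ?P. restr ?I \<phi> \<in> compatible ?I ss \<and> restr ?J \<phi> = \<beta>}.
            F \<phi> (cut_blocks (ss @ [\<beta>]) w))"
        by (rule sum_fibres) auto
      also have "{\<phi> \<in> ?P. restr ?I \<phi> \<in> compatible ?I ss \<and> restr ?J \<phi> = \<beta>} =
          compatible ?K (ss @ [\<beta>])"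
        using sub by (auto simp: compatible_def restr_restr Int_absorb2 restr_permutation)
      finally show ?thesis by (simp add: cut_term_def)
    qed
    then show ?thesis using u perm by (simp add: takeuchi_def cong: sum.cong)
  qed
  show ?right
  proof -
    have "(\<Sum>\<phi>'\<in>compatible ?J ss. hm_comult ?I ?J F \<alpha> \<phi>' ?u (cut_blocks ss ?v)) =
        cut_term ?K F w (\<alpha> # ss)" if ss: "ss \<in> segmentations \<beta>" for ss
    proof -
      have sub: "s \<in> set ss \<Longrightarrow> set s \<subseteq> ?J" for s using ss by (auto simp: segmentations_def)
      have blocks: "block_sum ?u (cut_blocks ss ?v) = cut_blocks (\<alpha> # ss) w"
        using sub disj by (intro ext) (auto simp: block_sum_def cut_blocks_def diag_block_def)
      have swap: "{\<phi> \<in> ?P. restr ?I \<phi> = \<alpha> \<and> restr ?J \<phi> = \<phi>'} =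
        {\<phi> \<in> ?P. restr ?J \<phi> = \<phi>' \<and> restr ?I \<phi> = \<alpha>}" for \<phi>'
        by auto
      have "(\<Sum>\<phi>'\<in>compatible ?J ss. hm_comult ?I ?J F \<alpha> \<phi>' ?u (cut_blocks ss ?v)) =
        (\<Sum>\<phi>'\<in>compatible ?J ss. \<Sum>\<phi>\<in>{\<phi> \<in> ?P. restr ?J \<phi> = \<phi>' \<and> restr ?I \<phi> = \<alpha>}.
            F \<phi> (cut_blocks (\<alpha> # ss) w))"
        using cut_blocks_unitri[OF d\<beta> ss _ v] u perm
        by (intro sum.cong) (auto simp: hm_comult_def blocks compatible_def swap)
      also have "\<dots> = (\<Sum>\<phi>\<in>{\<phi> \<in> ?P. restr ?J \<phi> \<in> compatible ?J ss \<and> restr ?I \<phi> = \<alpha>}.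
            F \<phi> (cut_blocks (\<alpha> # ss) w))"
        by (rule sum_fibres) auto
      also have "{\<phi> \<in> ?P. restr ?J \<phi> \<in> compatible ?J ss \<and> restr ?I \<phi> = \<alpha>} =
          compatible ?K (\<alpha> # ss)"
        using sub by (auto simp: compatible_def restr_restr Int_absorb2 restr_permutation)
      finally show ?thesis by (simp add: cut_term_def)
    qed
    then show ?thesis using v perm by (simp add: takeuchi_def cong: sum.cong)
  qed
qed

lemma convolution_alt:
  assumes \<rho>: "\<rho> \<in> permutations_of_set K" and w: "w \<in> unitri \<rho>"
  shows "convolution f g K F \<rho> w =
    (\<Sum>k\<le>length \<rho>. tensor_map (f (set (take k \<rho>))) (g (set (drop k \<rho>)))
       (hm_comult (set (take k \<rho>)) (set (drop k \<rho>)) F) (take k \<rho>) (drop k \<rho>)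
       (diag_block (set (take k \<rho>)) w) (diag_block (set (drop k \<rho>)) w))"
proof -
  have d: "distinct \<rho>" and K: "set \<rho> = K" using \<rho> by (auto simp: permutations_of_set_def)
  have "K - set (take k \<rho>) = set (drop k \<rho>)" for k
    using set_diff_take[OF d] K by simp
  then show ?thesis
    unfolding convolution_def by (subst sum_hm_mult[OF \<rho> w]) simp
qed

lemma convolution_outside:
  assumes "\<not> (\<rho> \<in> permutations_of_set K \<and> w \<in> unitri \<rho>)"
  shows "convolution f g K F \<rho> w = 0"
  unfolding convolution_def
proof (intro sum.neutral ballI)
  fix I assume "I \<in> Pow K"
  then have "I \<union> (K - I) = K" by auto
  then show "hm_mult I (K - I) (tensor_map (f I) (g (K - I)) (hm_comult I (K - I) F)) \<rho> w = 0"
    using assms by (auto simp: hm_mult_def)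
qed

text \<open>Every cut of a nonempty word is counted twice: once with all its segments on the
  Takeuchi side, and once with its outermost segment handed over to the identity factor. The second
  count has one segment fewer in its sign, so the two cancel.\<close>

lemma takeuchi_convolution:
  assumes F: "F \<in> scfU K"
  shows "convolution takeuchi (\<lambda>_ G. G) K F = unit_counit K F"
    and "convolution (\<lambda>_ G. G) takeuchi K F = unit_counit K F"
proof -
  have "convolution takeuchi (\<lambda>_ G. G) K F \<rho> w = unit_counit K F \<rho> w \<and>
    convolution (\<lambda>_ G. G) takeuchi K F \<rho> w = unit_counit K F \<rho> w" for \<rho> w
  proof (cases "\<rho> \<in> permutations_of_set K \<and> w \<in> unitri \<rho>")
    case False
    then have "unit_counit K F \<rho> w = 0"
      using F by (auto simp: unit_counit_def scfU_def scf_def)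
    then show ?thesis by (simp add: convolution_outside[OF False])
  next
    case True
    then have \<rho>: "\<rho> \<in> permutations_of_set K" and w: "w \<in> unitri \<rho>" by auto
    have d: "distinct \<rho>" and K: "set \<rho> = K" using \<rho> by (auto simp: permutations_of_set_def)
    let ?Z = "cut_term K F w"
    note tc = takeuchi_comult[of "take k \<rho>" "drop k \<rho>" w F for k, unfolded append_take_drop_id, OF d w, unfolded K]
    have left: "convolution takeuchi (\<lambda>_ G. G) K F \<rho> w =
      (\<Sum>k\<le>length \<rho>. \<Sum>ss\<in>segmentations (take k \<rho>). (-1) ^ length ss * ?Z (ss @ [drop k \<rho>]))"
      unfolding convolution_alt[OF \<rho> w] tensor_map_def by (simp only: tc(1))
    have right: "convolution (\<lambda>_ G. G) takeuchi K F \<rho> w =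
      (\<Sum>k\<le>length \<rho>. \<Sum>ss\<in>segmentations (drop k \<rho>). (-1) ^ length ss * ?Z (take k \<rho> # ss))"
      unfolding convolution_alt[OF \<rho> w] tensor_map_def by (simp only: tc(2))
    show ?thesis
    proof (cases "\<rho> = []")
      case True
      then have "K = {}" using K by simp
      have "w = (\<lambda>_ _. 0)" using w True by (auto simp: unitri_def matrices_def)
      then have "?Z [] = F [] w"
        using \<open>K = {}\<close> by (simp add: cut_term_def compatible_def cut_blocks_def)
      then show ?thesis
        unfolding left right using True \<open>K = {}\<close> cut_term_Nil(1)[of K F w "[]"]
        by (simp add: unit_counit_def)
    next
      case False
      then have "K \<noteq> {}" using K by auto
      let ?f = "\<lambda>ss. (-1) ^ length ss * ?Z ss"
      have "(\<Sum>k<length \<rho>. \<Sum>ss\<in>segmentations (take k \<rho>). (-1) ^ length ss * ?Z (ss @ [drop k \<rho>])) =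
        - (\<Sum>ss\<in>segmentations \<rho>. ?f ss)"
        by (simp add: sum_segmentations_last[OF False] sum_negf)
      then have "convolution takeuchi (\<lambda>_ G. G) K F \<rho> w = 0"
        unfolding left by (simp add: lessThan_Suc_atMost[symmetric] cut_term_Nil)
      moreover have "(\<Sum>k\<in>{1..length \<rho>}. \<Sum>ss\<in>segmentations (drop k \<rho>). (-1) ^ length ss * ?Z (take k \<rho> # ss)) =
        - (\<Sum>ss\<in>segmentations \<rho>. ?f ss)"
        by (simp add: sum_segmentations_first[OF False] sum_negf)
      then have "convolution (\<lambda>_ G. G) takeuchi K F \<rho> w = 0"
        unfolding right by (simp add: atMost_atLeast0 sum.atLeast_Suc_atMost cut_term_Nil)
      ultimately show ?thesis using \<open>K \<noteq> {}\<close> by (simp add: unit_counit_def)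
    qed
  qed
  then show "convolution takeuchi (\<lambda>_ G. G) K F = unit_counit K F"
    and "convolution (\<lambda>_ G. G) takeuchi K F = unit_counit K F"
    by (auto simp: fun_eq_iff)
qed

lemma is_antipode_takeuchi: "is_antipode takeuchi"
  unfolding is_antipode_def
  by (auto simp: takeuchi_scfU takeuchi_convolution)
     (auto simp: takeuchi_def fun_eq_iff sum.distrib sum_distrib_left algebra_simps)

section \<open>Uniqueness of the antipode\<close>

lemma mat_mult_block_sum:
  assumes "finite I" "finite J" "I \<inter> J = {}" "a \<in> matrices I" "c \<in> matrices I" "b \<in> matrices J" "d \<in> matrices J"
  shows "mat_mult (I \<union> J) (block_sum a b) (block_sum c d) = block_sum (mat_mult I a c) (mat_mult J b d)"
proof (intro ext)
  fix i j
  have "(\<Sum>k\<in>I. (a i k + b i k) * (c k j + d k j)) = (\<Sum>k\<in>I. a i k * c k j)"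
    using assms(3,6,7) by (intro sum.cong) (auto simp: matrices_def disjoint_iff)
  moreover have "k \<notin> I" if "k \<in> J" for k using assms(3) that by blast
  then have "(\<Sum>k\<in>J. (a i k + b i k) * (c k j + d k j)) = (\<Sum>k\<in>J. b i k * d k j)"
    using assms(4,5) by (intro sum.cong) (auto simp: matrices_def)
  ultimately show "mat_mult (I \<union> J) (block_sum a b) (block_sum c d) i j = block_sum (mat_mult I a c) (mat_mult J b d) i j"
    using assms(1-3) by (simp add: mat_mult_def block_sum_def sum.union_disjoint)
qed

lemma block_sum_borel:
  assumes \<phi>: "\<phi> \<in> permutations_of_set (I \<union> J)" "I \<inter> J = {}"
    and "u \<in> borel (restr I \<phi>)" "v \<in> borel (restr J \<phi>)"
  shows "block_sum u v \<in> borel \<phi>"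
proof -
  have K: "set \<phi> = I \<union> J" using \<phi> by (simp add: permutations_of_set_def)
  have u: "u i j = 0" if "i \<notin> I \<or> j \<notin> I" for i j
    using upper_tri_outside[OF borel_upper[OF assms(3)], of i j] that by auto
  have v: "v i j = 0" if "i \<notin> J \<or> j \<notin> J" for i j
    using upper_tri_outside[OF borel_upper[OF assms(4)], of i j] that by auto
  have "i = j \<or> precedes \<phi> i j" if "u i j + v i j \<noteq> 0" for i j
  proof -
    have "u i j \<noteq> 0 \<or> v i j \<noteq> 0" using that by auto
    then show ?thesis
      using upper_tri_zero[OF borel_upper[OF assms(3)], of i j]
        upper_tri_zero[OF borel_upper[OF assms(4)], of i j] by auto
  qed
  moreover have "u i i + v i i \<noteq> 0" if "i \<in> I \<union> J" for i
  proof -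
    have "u i i \<noteq> 0" if "i \<in> I" using assms(3) K that by (auto simp: borel_def)
    moreover have "v i i \<noteq> 0" if "i \<in> J" using assms(4) K that by (auto simp: borel_def)
    moreover have "i \<notin> I \<or> i \<notin> J" using \<phi>(2) by blast
    ultimately show ?thesis using that u[of i i] v[of i i] by auto
  qed
  ultimately show ?thesis
    using K u v unfolding borel_def upper_tri_def block_sum_def matrices_def by auto
qed

text \<open>The witnesses on \<open>I\<close> are continued by the identity on
  \<open>J\<close>.\<close>

lemma block_sum_same_superclass:
  assumes \<phi>: "\<phi> \<in> permutations_of_set (I \<union> J)" and disj: "I \<inter> J = {}"
    and uv: "same_superclass (restr I \<phi>) u u'" and v: "v \<in> unitri (restr J \<phi>)"
  shows "same_superclass \<phi> (block_sum u v) (block_sum u' v)"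
proof -
  have K: "set \<phi> = I \<union> J" and d: "distinct \<phi>" using \<phi> by (auto simp: permutations_of_set_def)
  have I: "set (restr I \<phi>) = I" and J: "set (restr J \<phi>) = J" using K by auto
  have fin: "finite I" "finite J" using K by (metis List.finite_set finite_Un)+
  have dI: "distinct (restr I \<phi>)" using d by (simp add: restr_def)
  have u: "u \<in> unitri (restr I \<phi>)" "u' \<in> unitri (restr I \<phi>)" using uv by (auto simp: same_superclass_def)
  obtain P Q where PQ: "P \<in> borel (restr I \<phi>)" "Q \<in> borel (restr I \<phi>)" "\<forall>i \<in> I. P i i * Q i i = 1"
     "mat_minus u' (mat_one I) = mat_mult I (mat_mult I P (mat_minus u (mat_one I))) Q"
    using uv unfolding same_superclass_iff[OF dI] tri_equiv_def I by blast
  have minus: "mat_minus (block_sum x v) (mat_one (set \<phi>)) =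
    block_sum (mat_minus x (mat_one I)) (mat_minus v (mat_one J))" for x
    using disj unfolding K by (intro ext) (auto simp: mat_minus_def block_sum_def mat_one_def)
  let ?P = "block_sum P (mat_one J)" and ?Q = "block_sum Q (mat_one J)"
  have one: "mat_one J \<in> unitri (restr J \<phi>)" using mat_one_unitri[of "restr J \<phi>"] unfolding J .
  have PQ': "?P \<in> borel \<phi>" "?Q \<in> borel \<phi>"
    using block_sum_borel[OF \<phi> disj] PQ unitri_borel[OF one] by auto
  have in_I: "P \<in> matrices I" "Q \<in> matrices I" "mat_minus u (mat_one I) \<in> matrices I"
    using PQ(1,2) mat_minus_one_matrices[OF u(1)] I by (auto simp: borel_def upper_tri_def simp del: set_restr)
  have in_J: "mat_minus v (mat_one J) \<in> matrices J"
    using mat_minus_one_matrices[OF v] J by (auto simp del: set_restr)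
  have "P i j = 0" if "i \<in> J" for i j using that disj in_I(1) by (auto simp: matrices_def)
  moreover have "Q i j = 0" if "i \<in> J" for i j using that disj in_I(2) by (auto simp: matrices_def)
  ultimately have diag: "?P i i * ?Q i i = 1" if "i \<in> set \<phi>" for i
    using that disj PQ(3) unfolding K by (auto simp: block_sum_def mat_one_def)
  have mat: "mat_mult I P (mat_minus u (mat_one I)) \<in> matrices I"
    using in_I by (auto simp: mat_mult_def matrices_def)
  have "mat_minus (block_sum u' v) (mat_one (set \<phi>)) =
    mat_mult (set \<phi>) (mat_mult (set \<phi>) ?P (mat_minus (block_sum u v) (mat_one (set \<phi>)))) ?Q"
    unfolding minus unfolding K
    using fin disj in_I in_J mat PQ(4)
    by (simp add: mat_mult_block_sum mat_one_matrices mat_mult_one_left mat_mult_one_right)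
  then have "tri_equiv \<phi> (mat_minus (block_sum u v) (mat_one (set \<phi>))) (mat_minus (block_sum u' v) (mat_one (set \<phi>)))"
    using PQ' diag by (intro tri_equivI[where P = ?P and Q = ?Q])
  moreover have "block_sum x v \<in> unitri \<phi>" if "x \<in> unitri (restr I \<phi>)" for x
  proof -
    have "x i i + v i i = 1" if i: "i \<in> set \<phi>" for i
      using i disj[unfolded disjoint_iff, rule_format, of i] unitri_diag[OF \<open>x \<in> unitri (restr I \<phi>)\<close>, of i] unitri_diag[OF v, of i]
        upper_tri_outside[OF unitri_upper[OF \<open>x \<in> unitri (restr I \<phi>)\<close>], of i i]
        upper_tri_outside[OF unitri_upper[OF v], of i i] unfolding I J K
      by (metis Un_iff add.right_neutral add_0)
    then show ?thesis
      using block_sum_borel[OF \<phi> disj unitri_borel[OF that] unitri_borel[OF v]]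
      by (simp add: unitri_iff_borel) (simp add: block_sum_def)
  qed
  ultimately show ?thesis using u by (simp add: same_superclass_iff[OF d])
qed

text \<open>The axioms constrain an antipode on superclass functions only, so the induction
  hypothesis for a proper subset can be used once the slices of the coproduct are known to be such
  functions.\<close>

lemma comult_slice_scfU:
  assumes F: "F \<in> scfU (I \<union> J)" and disj: "I \<inter> J = {}"
  shows "(\<lambda>\<alpha> u. hm_comult I J F \<alpha> \<beta> u v) \<in> scfU I"
proof -
  have "hm_comult I J F \<alpha> \<beta> u v = hm_comult I J F \<alpha> \<beta> u' v" if uu: "same_superclass \<alpha> u u'" for \<alpha> u u'
  proof -
    have "u \<in> unitri \<alpha>" "u' \<in> unitri \<alpha>" using uu by (auto simp: same_superclass_def)
    moreover have "F \<phi> (block_sum u v) = F \<phi> (block_sum u' v)"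
      if "\<phi> \<in> permutations_of_set (I \<union> J)" "restr I \<phi> = \<alpha>" "restr J \<phi> = \<beta>" "v \<in> unitri \<beta>" for \<phi>
      using block_sum_same_superclass[OF that(1) disj, of u u' v] uu that F
      by (auto simp: scfU_def scf_def)
    ultimately show ?thesis by (auto simp: hm_comult_def intro!: sum.cong)
  qed
  moreover have "hm_comult I J F \<alpha> \<beta> u v = 0" if "\<alpha> \<notin> permutations_of_set I \<or> u \<notin> unitri \<alpha>" for \<alpha> u
    using that by (auto simp: hm_comult_def)
  ultimately show ?thesis
    unfolding scfU_def scf_def by blast
qed

lemma comult_empty:
  assumes F: "F \<in> scfU K" and "w \<in> unitri []"
  shows "(\<lambda>\<alpha> u. hm_comult K {} F \<alpha> [] u w) = F"
proof (intro ext)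
  fix \<alpha> u
  have w: "w = (\<lambda>_ _. 0)" using assms(2) by (auto simp: unitri_def matrices_def)
  show "hm_comult K {} F \<alpha> [] u w = F \<alpha> u"
  proof (cases "\<alpha> \<in> permutations_of_set K \<and> u \<in> unitri \<alpha>")
    case True
    have "restr K \<phi> = \<phi>" if "\<phi> \<in> permutations_of_set K" for \<phi>
      using that by (simp add: restr_superset permutations_of_set_def)
    then have "{\<phi> \<in> permutations_of_set (K \<union> {}). restr K \<phi> = \<alpha> \<and> restr {} \<phi> = []} = {\<alpha>}"
      using True by (auto simp: restr_def[of "{}"])
    then show ?thesis
      using True assms(2) by (simp add: hm_comult_def w block_sum_def)
  next
    case False
    then have "F \<alpha> u = 0" using F by (auto simp: scfU_def scf_def)
    then show ?thesis using False by (auto simp: hm_comult_def)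
  qed
qed

text \<open>In the convolution with the identity the full prefix contributes \<open>S K F\<close>
  itself, and every shorter prefix only values of \<open>S\<close> on proper subsets. The latter
  agree by induction, and the total is prescribed.\<close>

lemma antipode_unique:
  assumes S: "is_antipode S" and S': "is_antipode S'" and "finite K" "F \<in> scfU K"
  shows "S K F = S' K F"
  using assms(3,4)
proof (induction K arbitrary: F rule: finite_psubset_induct)
  case (psubset K)
  have in_scfU: "S K F \<in> scfU K" "S' K F \<in> scfU K"
    using S S' psubset by (auto simp: is_antipode_def)
  show ?case
  proof (intro ext)
    fix \<rho> w
    show "S K F \<rho> w = S' K F \<rho> w"
    proof (cases "\<rho> \<in> permutations_of_set K \<and> w \<in> unitri \<rho>")
      case False
      then show ?thesis
        using in_scfU by (cases "\<rho> \<in> permutations_of_set K") (auto simp: scfU_def scf_def)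
    next
      case True
      then have \<rho>: "\<rho> \<in> permutations_of_set K" and w: "w \<in> unitri \<rho>" by auto
      have d: "distinct \<rho>" and K: "set \<rho> = K" using \<rho> by (auto simp: permutations_of_set_def)
      let ?G = "\<lambda>k \<alpha> u. hm_comult (set (take k \<rho>)) (set (drop k \<rho>)) F
        \<alpha> (drop k \<rho>) u (diag_block (set (drop k \<rho>)) w)"
      let ?t = "\<lambda>S k. S (set (take k \<rho>)) (?G k) (take k \<rho>) (diag_block (set (take k \<rho>)) w)"
      have "convolution S (\<lambda>_ G. G) K F \<rho> w = convolution S' (\<lambda>_ G. G) K F \<rho> w"
        using S S' psubset by (simp add: is_antipode_def)
      then have eq: "(\<Sum>k\<le>length \<rho>. ?t S k) = (\<Sum>k\<le>length \<rho>. ?t S' k)"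
        by (simp add: convolution_alt[OF \<rho> w] tensor_map_def)
      have "?t S k = ?t S' k" if k: "k < length \<rho>" for k
      proof -
        have un: "set (take k \<rho>) \<union> set (drop k \<rho>) = K"
          using K by (metis append_take_drop_id set_append)
        have disj: "set (take k \<rho>) \<inter> set (drop k \<rho>) = {}"
          using set_take_disj_set_drop_if_distinct[OF d order_refl] .
        have "set (drop k \<rho>) \<noteq> {}" using k by simp
        then have "set (take k \<rho>) \<noteq> K" using un disj by (metis Int_absorb1 Un_upper2)
        then have "set (take k \<rho>) \<subset> K" using un by (metis Un_upper1 psubsetI)
        moreover have "?G k \<in> scfU (set (take k \<rho>))"
          using comult_slice_scfU[OF _ disj] psubset.prems un by simp
        ultimately show ?thesis using psubset.IH by simp
      qed
      then have "?t S (length \<rho>) = ?t S' (length \<rho>)"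
        using eq by (simp add: lessThan_Suc_atMost[symmetric])
      moreover have "diag_block {} w \<in> unitri []"
        by (simp add: unitri_def diag_block_def matrices_def)
      moreover have "diag_block K w = w"
        using w K by (auto simp: unitri_def diag_block_def matrices_def fun_eq_iff)
      ultimately show ?thesis
        using K by (simp add: comult_empty[OF psubset.prems])
    qed
  qed
qed

lemma antipode_eq_takeuchi: "finite K \<Longrightarrow> F \<in> scfU K \<Longrightarrow> antipode K F = takeuchi K F"
  using antipode_unique[OF _ is_antipode_takeuchi] someI[of is_antipode, OF is_antipode_takeuchi]
  unfolding antipode_def by blast

section \<open>Values of supercharacters on segments\<close>

definition arc_value :: "complex \<Rightarrow> 'a \<Rightarrow> 'a \<Rightarrow> 'a set \<Rightarrow> ('a \<times> 'a) set \<Rightarrow> complex" where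
  "arc_value q a b B \<mu> = (if \<exists>j\<in>B. (a, j) \<in> \<mu> \<or> (j, b) \<in> \<mu> then 0
     else (if (a, b) \<in> \<mu> then -1 else q - 1) * q ^ card B / q ^ card (\<mu> \<inter> B \<times> B))"

text \<open>The order enters the value of a single-arc supercharacter only through the set
  \<open>B\<close> of letters strictly between the ends. The same expression can therefore be used
  along \<open>\<tau>\<close> and along \<open>\<rho>\<close>.\<close>

lemma supervalue_single:
  assumes d: "distinct \<phi>" and ab: "precedes \<phi> a b" and \<mu>: "\<mu> \<in> set_partitions \<phi>" and "q > 0"
    and B: "B = {j. precedes \<phi> a j \<and> precedes \<phi> j b}"
  shows "supervalue q \<phi> {(a, b)} \<mu> = arc_value (of_nat q) a b B \<mu>"
proof -
  have fin: "finite B" unfolding B by (rule finite_subset[of _ "set \<phi>"]) (auto dest: precedes_in_set)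
  have "{j. precedes \<phi> a j \<and> (precedes \<phi> j b \<or> j = b)} = insert b B"
    using ab by (auto simp: B)
  moreover have "b \<notin> B" using d by (auto simp: B)
  ultimately have dim: "arc_dim \<phi> {(a, b)} = card B + 1"
    using fin by (simp add: arc_dim_def)
  have "{((i, l), (j, k)) | i j k l. (i, l) \<in> {(a, b)} \<and> (j, k) \<in> \<mu> \<and>
     precedes \<phi> i j \<and> precedes \<phi> j k \<and> precedes \<phi> k l} = (\<lambda>x. ((a, b), x)) ` (\<mu> \<inter> B \<times> B)"
    (is "?N = ?M")
  proof (intro equalityI subsetI)
    fix x assume "x \<in> ?N"
    then obtain j k where "x = ((a, b), (j, k))" "(j, k) \<in> \<mu>" "precedes \<phi> a j" "precedes \<phi> j k" "precedes \<phi> k b"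
      by auto
    moreover from this have "precedes \<phi> a k" "precedes \<phi> j b" using precedes_trans[OF d] by blast+
    ultimately show "x \<in> ?M" by (auto simp: B)
  next
    fix x assume "x \<in> ?M"
    then obtain j k where "x = ((a, b), (j, k))" "(j, k) \<in> \<mu>" "precedes \<phi> a j" "precedes \<phi> k b"
      by (auto simp: B)
    moreover from this have "precedes \<phi> j k" using set_partitionsD(1)[OF \<mu>] by blast
    ultimately show "x \<in> ?N" by auto
  qed
  then have nst: "nst \<phi> {(a, b)} \<mu> = card (\<mu> \<inter> B \<times> B)"
    unfolding nst_def by (simp add: card_image inj_on_def)
  have cond: "(\<exists>i j k. precedes \<phi> i j \<and> precedes \<phi> j k \<and> (i, k) \<in> {(a, b)} \<and> ((i, j) \<in> \<mu> \<or> (j, k) \<in> \<mu>)) \<longleftrightarrow>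
    (\<exists>j\<in>B. (a, j) \<in> \<mu> \<or> (j, b) \<in> \<mu>)"
    by (auto simp: B)
  have "{(a, b)} - \<mu> = (if (a, b) \<in> \<mu> then {} else {(a, b)})" "{(a, b)} \<inter> \<mu> = (if (a, b) \<in> \<mu> then {(a, b)} else {})"
    by auto
  then show ?thesis
    unfolding supervalue_def arc_value_def cond nst dim
    by (auto simp: power_int_minus power_int_add field_simps)
qed

lemma finite_nst:
  assumes "finite \<Lambda>" "finite \<mu>"
  shows "finite {((i, l), (j, k)) | i j k l. (i, l) \<in> \<Lambda> \<and> (j, k) \<in> \<mu> \<and>
     precedes \<phi> i j \<and> precedes \<phi> j k \<and> precedes \<phi> k l}"
  by (rule finite_subset[of _ "\<Lambda> \<times> \<mu>"]) (use assms in auto)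

text \<open>For fixed \<open>\<mu>\<close> all exponents are additive over the arcs of
  \<open>\<Lambda>\<close>, and the vanishing condition concerns one arc at a time.\<close>

lemma supervalue_insert:
  assumes "finite \<Lambda>" "finite \<mu>" "x \<notin> \<Lambda>" "q > 0"
  shows "supervalue q \<phi> (insert x \<Lambda>) \<mu> = supervalue q \<phi> {x} \<mu> * supervalue q \<phi> \<Lambda> \<mu>"
proof -
  let ?c = "\<lambda>\<Lambda>. \<exists>i j k. precedes \<phi> i j \<and> precedes \<phi> j k \<and> (i, k) \<in> \<Lambda> \<and> ((i, j) \<in> \<mu> \<or> (j, k) \<in> \<mu>)"
  have cond: "?c (insert x \<Lambda>) \<longleftrightarrow> ?c {x} \<or> ?c \<Lambda>" by blast
  have dim: "arc_dim \<phi> (insert x \<Lambda>) = arc_dim \<phi> {x} + arc_dim \<phi> \<Lambda>"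
    using assms by (simp add: arc_dim_def)
  let ?N = "\<lambda>\<Lambda>. {((i, l), (j, k)) | i j k l. (i, l) \<in> \<Lambda> \<and> (j, k) \<in> \<mu> \<and>
     precedes \<phi> i j \<and> precedes \<phi> j k \<and> precedes \<phi> k l}"
  have "card (?N {x} \<union> ?N \<Lambda>) = card (?N {x}) + card (?N \<Lambda>)"
    using assms finite_nst[of "{x}" \<mu> \<phi>] finite_nst[of \<Lambda> \<mu> \<phi>] by (intro card_Un_disjoint) auto
  moreover have "?N (insert x \<Lambda>) = ?N {x} \<union> ?N \<Lambda>" by auto
  ultimately have nst: "nst \<phi> (insert x \<Lambda>) \<mu> = nst \<phi> {x} \<mu> + nst \<phi> \<Lambda> \<mu>"
    unfolding nst_def by simp
  have int: "card (insert x \<Lambda> \<inter> \<mu>) = card ({x} \<inter> \<mu>) + card (\<Lambda> \<inter> \<mu>)"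
    and diff: "card (insert x \<Lambda> - \<mu>) = card ({x} - \<mu>) + card (\<Lambda> - \<mu>)"
    using assms by (auto simp: insert_Diff_if Int_insert_left)
  have q: "(of_nat q :: complex) \<noteq> 0" using assms by simp
  have card: "card (insert x \<Lambda>) = card {x} + card \<Lambda>" using assms by simp
  have e1: "int (arc_dim \<phi> {x} + arc_dim \<phi> \<Lambda>) - int (card {x} + card \<Lambda>) =
    (int (arc_dim \<phi> {x}) - int (card {x})) + (int (arc_dim \<phi> \<Lambda>) - int (card \<Lambda>))" by simp
  have e2: "- int (nst \<phi> {x} \<mu> + nst \<phi> \<Lambda> \<mu>) = - int (nst \<phi> {x} \<mu>) + (- int (nst \<phi> \<Lambda> \<mu>))" by simp
  define X where "X = (\<lambda>\<Lambda>. (-1) ^ card (\<Lambda> \<inter> \<mu>) * of_nat q powi (int (arc_dim \<phi> \<Lambda>) - int (card \<Lambda>))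
        * (of_nat q - 1) ^ card (\<Lambda> - \<mu>) * of_nat q powi (- int (nst \<phi> \<Lambda> \<mu>)) :: complex)"
  define c where "c = ?c"
  have s: "supervalue q \<phi> \<Lambda>' \<mu> = (if c \<Lambda>' then 0 else X \<Lambda>')" for \<Lambda>'
    unfolding supervalue_def X_def c_def by (rule refl)
  have "X (insert x \<Lambda>) = X {x} * X \<Lambda>"
    unfolding X_def dim nst int diff card e1 e2 power_add power_int_add[OF disjI1[OF q]]
    by (simp only: mult_ac)
  moreover have "c (insert x \<Lambda>) \<longleftrightarrow> c {x} \<or> c \<Lambda>" using cond by (simp only: c_def)
  ultimately show ?thesis by (simp add: s)
qed

lemma supervalue_prod:
  assumes "finite \<Lambda>" "finite \<mu>" "q > 0"
  shows "supervalue q \<phi> \<Lambda> \<mu> = (\<Prod>x\<in>\<Lambda>. supervalue q \<phi> {x} \<mu>)"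
  using assms(1)
proof (induction \<Lambda>)
  case empty
  have "nst \<phi> {} \<mu> = 0" by (simp add: nst_def)
  then show ?case by (simp add: supervalue_def arc_dim_def)
next
  case (insert x \<Lambda>)
  then show ?case using supervalue_insert[OF insert(1) assms(2) insert(2) assms(3)] by simp
qed

text \<open>At most one arc leaves \<open>a\<close>, and by assumption none enters it from within
  the set.\<close>

lemma card_insert_source:
  assumes "\<nu> \<in> set_partitions \<rho>" "finite P" "a \<notin> P" "\<And>x. x \<in> insert a P \<Longrightarrow> (x, a) \<notin> \<nu>"
  shows "card (\<nu> \<inter> insert a P \<times> insert a P) = card (\<nu> \<inter> P \<times> P) + (if \<exists>j\<in>P. (a, j) \<in> \<nu> then 1 else 0)"
proof (cases "\<exists>j\<in>P. (a, j) \<in> \<nu>")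
  case True
  then obtain j where j: "j \<in> P" "(a, j) \<in> \<nu>" by blast
  then have "\<nu> \<inter> insert a P \<times> insert a P = insert (a, j) (\<nu> \<inter> P \<times> P)"
    using assms(4) by (auto dest: set_partitionsD(2)[OF assms(1)])
  then show ?thesis using True assms(2,3) by simp
next
  case False
  then have "\<nu> \<inter> insert a P \<times> insert a P = \<nu> \<inter> P \<times> P" using assms(4) by auto
  then show ?thesis using False by simp
qed

lemma card_insert_target:
  assumes "\<nu> \<in> set_partitions \<rho>" "finite P" "b \<notin> P" "\<And>x. x \<in> insert b P \<Longrightarrow> (b, x) \<notin> \<nu>"
  shows "card (\<nu> \<inter> insert b P \<times> insert b P) = card (\<nu> \<inter> P \<times> P) + (if \<exists>j\<in>P. (j, b) \<in> \<nu> then 1 else 0)"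
proof (cases "\<exists>j\<in>P. (j, b) \<in> \<nu>")
  case True
  then obtain j where j: "j \<in> P" "(j, b) \<in> \<nu>" by blast
  then have "\<nu> \<inter> insert b P \<times> insert b P = insert (j, b) (\<nu> \<inter> P \<times> P)"
    using assms(4) by (auto dest: set_partitionsD(3)[OF assms(1)])
  then show ?thesis using True assms(2,3) by simp
next
  case False
  then have "\<nu> \<inter> insert b P \<times> insert b P = \<nu> \<inter> P \<times> P" using assms(4) by auto
  then show ?thesis using False by simp
qed

section \<open>Segments and blocks for a pair of orders\<close>

locale two_orders =
  fixes \<tau> \<rho> :: "'a list" and \<nu> :: "('a \<times> 'a) set" and q :: complex
  assumes distinct_\<tau>: "distinct \<tau>" and distinct_\<rho>: "distinct \<rho>" and set_\<rho>: "set \<rho> = set \<tau>"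
    and length_\<tau>: "length \<tau> \<ge> 2" and \<nu>: "\<nu> \<in> set_partitions \<rho>" and q0: "q \<noteq> 0"
begin

abbreviation lo :: 'a where "lo \<equiv> hd \<tau>"
abbreviation hi :: 'a where "hi \<equiv> last \<tau>"
abbreviation t :: complex where "t \<equiv> q - 1"
abbreviation increasing :: "'a list \<Rightarrow> bool" where "increasing \<equiv> sorted_wrt (precedes \<tau>)"

lemma lo_neq_hi: "lo \<noteq> hi"
proof -
  obtain x y zs where "\<tau> = x # y # zs" using length_\<tau> by (metis Suc_le_length_iff numeral_2_eq_2)
  then show ?thesis using distinct_\<tau> by auto
qed

lemma lo_hi_in: "lo \<in> set \<tau>" "hi \<in> set \<tau>"
  using length_\<tau> by (cases \<tau>; auto)+

lemma not_precedes_lo: "\<not> precedes \<tau> x lo"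
  using distinct_\<tau> by (cases \<tau>) (auto dest: precedes_in_set)

lemma not_hi_precedes: "\<not> precedes \<tau> hi x"
  using distinct_\<tau> by (cases \<tau> rule: rev_cases) (auto dest: precedes_in_set)

definition inner :: "'a list \<Rightarrow> 'a set" where
  "inner s = set s - {lo, hi}"

text \<open>With an extra \<open>t\<close> in front of the supercharacter, each segment containing
  an extreme letter gets a \<open>t\<close> of its own; if one segment contains both, the second
  factor is the one of the arc from \<open>lo\<close> to \<open>hi\<close>.\<close>

definition end_factor :: "'a list \<Rightarrow> complex" where
  "end_factor s = (if lo \<in> set s \<and> hi \<in> set s then t * (if (lo, hi) \<in> \<nu> then -1 else t)
     else if lo \<in> set s \<or> hi \<in> set s then t else 1)"

definition seg_value :: "'a list \<Rightarrow> complex" where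
  "seg_value s = (if \<exists>j\<in>inner s. (lo \<in> set s \<and> (lo, j) \<in> \<nu>) \<or> (hi \<in> set s \<and> (j, hi) \<in> \<nu>) then 0
     else end_factor s * q ^ card (inner s) / q ^ card (\<nu> \<inter> inner s \<times> inner s))"

text \<open>A one-letter block has no arc and contributes an empty product.\<close>

definition block_value :: "'a list \<Rightarrow> complex" where
  "block_value w = (if length w = 1 then 1
     else arc_value q (hd w) (last w) (set (butlast (tl w))) \<nu>)"

text \<open>Extreme letters must lie in blocks, hence the weight 0. In the bidiagonal multipliers
  the same zero means that no difference is taken at an extreme letter.\<close>

definition free :: "'a \<Rightarrow> complex" where
  "free x = (if x \<in> {lo, hi} then 0 else 1)"

lemma seg_value_none:
  "lo \<notin> set s \<Longrightarrow> hi \<notin> set s \<Longrightarrow> seg_value s = q ^ card (set s) / q ^ card (\<nu> \<inter> set s \<times> set s)"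
  by (simp add: seg_value_def end_factor_def inner_def)

lemma seg_value_lo:
  "lo \<in> set s \<Longrightarrow> hi \<notin> set s \<Longrightarrow> inner s = B \<Longrightarrow>
    seg_value s = (if \<exists>j\<in>B. (lo, j) \<in> \<nu> then 0 else t * q ^ card B / q ^ card (\<nu> \<inter> B \<times> B))"
  by (simp add: seg_value_def end_factor_def)

lemma seg_value_hi:
  "lo \<notin> set s \<Longrightarrow> hi \<in> set s \<Longrightarrow> inner s = B \<Longrightarrow>
    seg_value s = (if \<exists>j\<in>B. (j, hi) \<in> \<nu> then 0 else t * q ^ card B / q ^ card (\<nu> \<inter> B \<times> B))"
  by (simp add: seg_value_def end_factor_def)

lemma seg_value_both:
  "lo \<in> set s \<Longrightarrow> hi \<in> set s \<Longrightarrow> inner s = B \<Longrightarrow> seg_value s = t * arc_value q lo hi B \<nu>"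
  by (simp add: seg_value_def end_factor_def arc_value_def)

text \<open>
  Both sides vanish as soon as an arc of \<open>\<nu>\<close> leaves \<open>a\<close> or enters \<open>b\<close> inside the word:
  the second difference of \<open>q\<close> to the power (number of letters minus number of arcs) is a product
  of two first differences.
\<close>

lemma seg_value_diff:
  assumes s: "distinct (a # \<psi> @ [b])" and inc: "increasing (a # \<psi> @ [b])"
    and arcs: "\<And>i j. i \<in> set (a # \<psi> @ [b]) \<Longrightarrow> j \<in> set (a # \<psi> @ [b]) \<Longrightarrow> (i, j) \<in> \<nu> \<Longrightarrow> precedes (a # \<psi> @ [b]) i j"
  shows "seg_value (a # \<psi> @ [b]) - free a * seg_value (\<psi> @ [b]) - free b * seg_value (a # \<psi>)
     + free a * free b * seg_value \<psi> = t * block_value (a # \<psi> @ [b])"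
proof -
  let ?P = "set \<psi>"
  have ne: "a \<noteq> b" "a \<notin> ?P" "b \<notin> ?P" using s by auto
  \<comment> \<open>In an increasing word the minimum can only be the first letter and the maximum
    only the last, so the case analysis concerns \<open>a\<close> and \<open>b\<close>
    alone.\<close>
  have lohi: "lo \<notin> ?P" "hi \<notin> ?P" "b \<noteq> lo" "a \<noteq> hi"
    using inc not_precedes_lo not_hi_precedes by (auto simp: sorted_wrt_append)
  have nosrc: "(x, a) \<notin> \<nu>" if "x \<in> insert a (insert b ?P)" for x
    using arcs[of x a] that s by (auto dest: precedes_in_set)
  have notgt: "(b, x) \<notin> \<nu>" if "x \<in> insert a (insert b ?P)" for x
    using arcs[of b x] that s by (auto dest: precedes_in_set)
  define N where "N = card (\<nu> \<inter> ?P \<times> ?P)"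
  define p where "p = card ?P"
  define \<alpha> where "\<alpha> \<longleftrightarrow> (\<exists>j\<in>?P. (a, j) \<in> \<nu>)"
  define \<beta> where "\<beta> \<longleftrightarrow> (\<exists>j\<in>?P. (j, b) \<in> \<nu>)"
  define \<gamma> where "\<gamma> \<longleftrightarrow> (a, b) \<in> \<nu>"
  \<comment> \<open>An arc from \<open>a\<close> to \<open>b\<close> uses up the one arc that may
    leave \<open>a\<close> and the one that may enter \<open>b\<close>.\<close>
  have \<gamma>: "\<not> \<alpha>" "\<not> \<beta>" if \<gamma>
    using that set_partitionsD(2,3)[OF \<nu>] ne unfolding \<alpha>_def \<beta>_def \<gamma>_def by blast+
  have ca: "card (insert a ?P) = p + 1" "card (insert b ?P) = p + 1" "card (insert a (insert b ?P)) = p + 2"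
    using ne by (auto simp: p_def)
  have cA: "card (\<nu> \<inter> insert a ?P \<times> insert a ?P) = N + (if \<alpha> then 1 else 0)"
    unfolding N_def \<alpha>_def using nosrc ne by (intro card_insert_source[OF \<nu>]) auto
  have cB: "card (\<nu> \<inter> insert b ?P \<times> insert b ?P) = N + (if \<beta> then 1 else 0)"
    unfolding N_def \<beta>_def using notgt ne by (intro card_insert_target[OF \<nu>]) auto
  have cAB: "card (\<nu> \<inter> insert a (insert b ?P) \<times> insert a (insert b ?P)) =
      N + (if \<beta> then 1 else 0) + (if \<alpha> \<or> \<gamma> then 1 else 0)"
  proof -
    have "card (\<nu> \<inter> insert a (insert b ?P) \<times> insert a (insert b ?P)) =
      card (\<nu> \<inter> insert b ?P \<times> insert b ?P) + (if \<exists>j\<in>insert b ?P. (a, j) \<in> \<nu> then 1 else 0)"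
      using nosrc ne by (intro card_insert_source[OF \<nu>]) auto
    then show ?thesis unfolding cB \<alpha>_def \<gamma>_def by auto
  qed
  have block: "block_value (a # \<psi> @ [b]) = (if \<alpha> \<or> \<beta> then 0 else (if \<gamma> then -1 else t) * q ^ p / q ^ N)"
    by (auto simp: block_value_def arc_value_def \<alpha>_def \<beta>_def \<gamma>_def p_def N_def)
  have sv\<psi>: "seg_value \<psi> = q ^ p / q ^ N"
    using lohi by (simp add: seg_value_none p_def N_def)
  show ?thesis
  proof (cases "a = lo")
    case a: True
    have inner_a: "inner (a # \<psi>) = ?P" using a lohi by (auto simp: inner_def)
    show ?thesis
    proof (cases "b = hi")
      case b: True
      have "inner (a # \<psi> @ [b]) = ?P" using a b lohi by (auto simp: inner_def)
      then have "seg_value (a # \<psi> @ [b]) = t * block_value (a # \<psi> @ [b])"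
        using a b by (subst seg_value_both) (auto simp: block_value_def)
      moreover have "free a = 0" "free b = 0" using a b by (auto simp: free_def)
      ultimately show ?thesis by (simp add: block)
    next
      case b: False
      then have "free a = 0" "free b = 1" using a lohi by (auto simp: free_def)
      moreover have "seg_value (a # \<psi>) = (if \<alpha> then 0 else t * q ^ p / q ^ N)"
        using a lohi lo_neq_hi by (subst seg_value_lo[OF _ _ inner_a]) (auto simp: p_def N_def \<alpha>_def)
      moreover have inner_ab: "inner (a # \<psi> @ [b]) = insert b ?P" using a b lohi by (auto simp: inner_def)
      have cond: "(\<exists>j\<in>insert b ?P. (lo, j) \<in> \<nu>) \<longleftrightarrow> \<alpha> \<or> \<gamma>" using a by (auto simp: \<alpha>_def \<gamma>_def)
      have "seg_value (a # \<psi> @ [b]) = (if \<alpha> \<or> \<gamma> then 0 else t * q ^ (p + 1) / q ^ (N + (if \<beta> then 1 else 0)))"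
        using a b lohi lo_neq_hi by (subst seg_value_lo[OF _ _ inner_ab]) (simp_all only: cond ca cB, auto)
      ultimately show ?thesis using \<gamma> q0 by (auto simp: block field_simps)
    qed
  next
    case a: False
    then have fa: "free a = 1" using lohi by (auto simp: free_def)
    show ?thesis
    proof (cases "b = hi")
      case b: True
      then have "free b = 0" by (auto simp: free_def)
      moreover have inner_b: "inner (\<psi> @ [b]) = ?P" using b lohi by (auto simp: inner_def)
      have "seg_value (\<psi> @ [b]) = (if \<beta> then 0 else t * q ^ p / q ^ N)"
        using b lohi lo_neq_hi by (subst seg_value_hi[OF _ _ inner_b]) (auto simp: p_def N_def \<beta>_def)
      moreover have inner_ab: "inner (a # \<psi> @ [b]) = insert a ?P" using a b lohi by (auto simp: inner_def)
      have cond: "(\<exists>j\<in>insert a ?P. (j, hi) \<in> \<nu>) \<longleftrightarrow> \<beta> \<or> \<gamma>" using b by (auto simp: \<beta>_def \<gamma>_def)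
      have "seg_value (a # \<psi> @ [b]) = (if \<beta> \<or> \<gamma> then 0 else t * q ^ (p + 1) / q ^ (N + (if \<alpha> then 1 else 0)))"
        using a b lohi lo_neq_hi by (subst seg_value_hi[OF _ _ inner_ab]) (simp_all only: cond ca cA, auto)
      ultimately show ?thesis using \<gamma> q0 fa by (auto simp: block field_simps)
    next
      case b: False
      then have fb: "free b = 1" using lohi by (auto simp: free_def)
      have "set (\<psi> @ [b]) = insert b ?P" "set (a # \<psi>) = insert a ?P"
        "set (a # \<psi> @ [b]) = insert a (insert b ?P)" by auto
      then have sv: "seg_value (\<psi> @ [b]) = q ^ (p + 1) / q ^ (N + (if \<beta> then 1 else 0))"
        "seg_value (a # \<psi>) = q ^ (p + 1) / q ^ (N + (if \<alpha> then 1 else 0))"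
        "seg_value (a # \<psi> @ [b]) = q ^ (p + 2) / q ^ (N + (if \<beta> then 1 else 0) + (if \<alpha> \<or> \<gamma> then 1 else 0))"
        using a b lohi by (subst seg_value_none; simp only: ca cA cB cAB; simp)+
      show ?thesis
        unfolding sv sv\<psi> fa fb block using \<gamma> q0
        by (cases \<alpha>; cases \<beta>; cases \<gamma>) (auto simp: field_simps power2_eq_square)
    qed
  qed
qed

lemma seg_value_Nil: "seg_value [] = 1"
  by (simp add: seg_value_def inner_def end_factor_def)

text \<open>The splitting anticipates the transfer matrix: an ordinary letter gives the bidiagonal
  entry \<open>1 + t\<close>, that is \<open>q\<close>, and an extreme letter gives \<open>t\<close>
  times a one-letter block.\<close>

lemma seg_value_single: "seg_value [a] = free a * (1 + t) + (if a \<in> {lo, hi} then t else 0)"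
proof -
  have "(a, a) \<notin> \<nu>" using set_partitionsD(1)[OF \<nu>, of a a] distinct_\<rho> by auto
  then show ?thesis
    using lo_neq_hi by (auto simp: seg_value_def inner_def end_factor_def free_def)
qed

end

section \<open>From cuts to factorizations\<close>

text \<open>
  In matrix terms, with \<open>E\<close> the superdiagonal matrix of the \<open>e i\<close> and \<open>D\<close> the diagonal matrix of the
  \<open>d i\<close>, the hypotheses say that \<open>(1 - E D) M (1 - D E) = A + t W\<close> for a bidiagonal matrix \<open>A\<close>.
\<close>

lemma bidiagonal_transfer:
  fixes M W :: "nat \<Rightarrow> nat \<Rightarrow> 'b::comm_ring_1"
  assumes dn: "d n = 0"
    and T: "\<And>i. i < n \<Longrightarrow> (\<Sum>j\<in>{i..n}. M i j * T j) = 0" and Tn: "T n = 1"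
    and M0: "\<And>i. i \<le> n \<Longrightarrow> M i i = 1"
    and M1: "\<And>i. i < n \<Longrightarrow> M i (Suc i) = e i * (1 + t) + t * W i (Suc i)"
    and M2: "\<And>i j. Suc (Suc i) \<le> j \<Longrightarrow> j \<le> n \<Longrightarrow> M i j - e i * d (Suc i) * M (Suc i) j
      - (M i (j - 1) - e i * d (Suc i) * M (Suc i) (j - 1)) * (d (j - 1) * e (j - 1)) = t * W i j"
    and R: "\<And>i. i < n \<Longrightarrow> R i = - (e i * (1 + t - d i - d (Suc i)) * R (Suc i)) - t * (\<Sum>j\<in>{Suc i..n}. W i j * R j)"
    and Rn: "R n = 1"
    and i: "i \<le> n"
  shows "T i = R i - d i * e i * R (Suc i)"
proof -
  \<comment> \<open>In matrix form \<open>T' = (1 - D E) R\<close>, so the assumptions on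
    \<open>R\<close> say that \<open>(1 - E D) M T'\<close> is the last unit vector.\<close>
  define T' where "T' = (\<lambda>j. R j - d j * e j * R (Suc j))"
  define S where "S = (\<lambda>i. \<Sum>j\<in>{i..n}. M i j * T' j)"
  \<comment> \<open>These are the rows of that equation above the last. Since
    \<open>d n = 0\<close>, the downward induction that removes the factor \<open>1 - E D\<close>
    starts with zero.\<close>
  have step: "S i = e i * d (Suc i) * S (Suc i)" if i: "i < n" for i
  proof -
    \<comment> \<open>Row \<open>i\<close> of \<open>(1 - E D) M\<close>. The case distinction
      suppresses the entry of \<open>M\<close> below the diagonal, about which nothing is
      assumed.\<close>
    define C where "C = (\<lambda>j. M i j - (if i < j then e i * d (Suc i) * M (Suc i) j else 0))"
    have split: "sum f {i..n} = f i + sum f {Suc i..n}" for f :: "nat \<Rightarrow> 'b"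
      using i by (simp add: sum.atLeast_Suc_atMost)
    have "S i - e i * d (Suc i) * S (Suc i) = (\<Sum>j\<in>{i..n}. C j * T' j)"
      unfolding S_def split by (simp add: C_def sum_distrib_left algebra_simps sum_subtractf)
    also have "\<dots> = (\<Sum>j\<in>{i..n}. C j * R j) - (\<Sum>j\<in>{i..n}. C j * (d j * e j) * R (Suc j))"
      by (simp add: T'_def algebra_simps sum_subtractf)
    \<comment> \<open>The term with \<open>R (Suc n)\<close> carries the factor
      \<open>d n = 0\<close>, so the index shift stays in range.\<close>
    also have "(\<Sum>j\<in>{i..n}. C j * (d j * e j) * R (Suc j)) = (\<Sum>j\<in>{i..<n}. C j * (d j * e j) * R (Suc j))"
      using i dn by (intro sum.mono_neutral_right) (auto simp: not_less)
    also have "\<dots> = (\<Sum>j\<in>{Suc i..n}. C (j - 1) * (d (j - 1) * e (j - 1)) * R j)"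
      using sum.shift_bounds_Suc_ivl[of "\<lambda>j. C (j - 1) * (d (j - 1) * e (j - 1)) * R j" i n]
      by (simp add: atLeastLessThanSuc_atLeastAtMost)
    also have "(\<Sum>j\<in>{i..n}. C j * R j) - \<dots> =
        R i + (\<Sum>j\<in>{Suc i..n}. (C j - C (j - 1) * (d (j - 1) * e (j - 1))) * R j)"
    proof -
      have "C i = 1" using i M0 by (simp add: C_def)
      then show ?thesis unfolding split by (simp add: left_diff_distrib sum_subtractf)
    qed
    also have "(\<Sum>j\<in>{Suc i..n}. (C j - C (j - 1) * (d (j - 1) * e (j - 1))) * R j) =
      (\<Sum>j\<in>{Suc i..n}. t * (W i j * R j) +
         (if j = Suc i then e i * (1 + t - d i - d (Suc i)) * R (Suc i) else 0))"
    proof (rule sum.cong)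
      fix j assume j: "j \<in> {Suc i..n}"
      show "(C j - C (j - 1) * (d (j - 1) * e (j - 1))) * R j = t * (W i j * R j) +
         (if j = Suc i then e i * (1 + t - d i - d (Suc i)) * R (Suc i) else 0)"
      proof (cases "j = Suc i")
        case True
        then show ?thesis using i M0 M1 by (simp add: C_def algebra_simps)
      next
        case False
        then have "C j - C (j - 1) * (d (j - 1) * e (j - 1)) = t * W i j"
          using M2[of i j] j by (auto simp: C_def)
        then show ?thesis using False by (simp add: mult.assoc)
      qed
    qed simp
    also have "R i + \<dots> = 0"
      using i by (simp add: sum.distrib R[OF i] sum_distrib_left)
    finally show ?thesis by simp
  qed
  have S0: "S i = 0" if "i < n" for i
    using that
  proof (induction "n - i" arbitrary: i)
    case (Suc k)
    show ?case
    proof (cases "Suc i = n")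
      case True
      then show ?thesis using step[OF Suc.prems] dn by simp
    next
      case False
      then show ?thesis using step[OF Suc.prems] Suc by simp
    qed
  qed simp
  \<comment> \<open>Back substitution: the diagonal of \<open>M\<close> is 1, so
    \<open>M T = M T'\<close> and equality at \<open>n\<close> determine the entries from the last
    one downwards.\<close>
  have "T i = T' i" if "i \<le> n" for i
    using that
  proof (induction "n - i" arbitrary: i rule: less_induct)
    case less
    show ?case
    proof (cases "i = n")
      case True
      then show ?thesis by (simp add: T'_def Tn Rn dn)
    next
      case False
      then have i: "i < n" using less.prems by simp
      have "(\<Sum>j\<in>{Suc i..n}. M i j * T j) = (\<Sum>j\<in>{Suc i..n}. M i j * T' j)"
        using less.hyps i by (intro sum.cong) auto
      then show ?thesis
        using T[OF i] S0[OF i] M0[of i] i unfolding S_def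
        by (simp add: sum.atLeast_Suc_atMost) (metis add_right_cancel)
    qed
  qed
  then show ?thesis using i by (simp add: T'_def)
qed

section \<open>Takeuchi's formula at a supercharacter\<close>

definition cut_arcs :: "'a list list \<Rightarrow> ('a \<times> 'a) set \<Rightarrow> ('a \<times> 'a) set" where
  "cut_arcs ss \<nu> = {(i, j) \<in> \<nu>. \<exists>s \<in> set ss. i \<in> set s \<and> j \<in> set s}"

lemma cut_blocks_arc_mat:
  assumes "ss \<in> segmentations \<rho>"
  shows "cut_blocks ss (arc_mat (set \<rho>) \<nu>) = arc_mat (set \<rho>) (cut_arcs ss \<nu>)"
  using segment_cover[OF assms]
  by (intro ext) (auto simp: cut_blocks_def arc_mat_def mat_one_def cut_arcs_def)

lemma restr_sorted:
  assumes "distinct \<tau>" "sorted_wrt (precedes \<tau>) s" "set s \<subseteq> set \<tau>"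
  shows "restr (set s) \<tau> = s"
  using assms
proof (induction \<tau> arbitrary: s)
  case Nil
  then show ?case by (simp add: restr_def)
next
  case (Cons x \<tau>)
  have x: "x \<notin> set \<tau>" and d: "distinct \<tau>" using Cons.prems by auto
  have sorted: "sorted_wrt (precedes \<tau>) s'" if "sorted_wrt (precedes (x # \<tau>)) s'" "x \<notin> set s'" for s'
    using that(1) by (rule sorted_wrt_mono_rel[rotated]) (use that in auto)
  show ?case
  proof (cases "x \<in> set s")
    case False
    then have "restr (set s) \<tau> = s"
      using Cons.prems(3) sorted[OF Cons.prems(2) False] d by (intro Cons.IH) auto
    then show ?thesis using False by (simp add: restr_def)
  next
    case True
    then obtain y s' where s: "s = y # s'" by (cases s) auto
    have "y = x"
    proof (rule ccontr)
      assume "y \<noteq> x"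
      then have "precedes (x # \<tau>) y x" using True s Cons.prems(2) by auto
      then show False using x \<open>y \<noteq> x\<close> by (auto dest: precedes_in_set)
    qed
    have xs': "x \<notin> set s'"
    proof
      assume "x \<in> set s'"
      then have "precedes (x # \<tau>) x x" using s \<open>y = x\<close> Cons.prems(2) by auto
      then show False using Cons.prems(1) by (simp only: precedes_irrefl simp_thms)
    qed
    then have "restr (set s') \<tau> = s'"
      using Cons.prems(2,3) s sorted[of s'] d by (intro Cons.IH) (auto simp del: precedes_Cons)
    moreover have "restr (set s) \<tau> = restr (set s') \<tau>"
      unfolding restr_def s \<open>y = x\<close> using x by (intro filter_cong) auto
    ultimately show ?thesis using s \<open>y = x\<close> by (simp add: restr_def)
  qed
qed

context two_orders
begin

text \<open>Cutting removes the arcs between different segments, so letters and surviving arcs are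
  counted segment by segment, and the vanishing condition is local to a segment. The arc from
  \<open>lo\<close> to \<open>hi\<close> survives only if both lie in one segment; otherwise their
  two segments contribute a \<open>t\<close> each, and so does the left side.\<close>

lemma seg_value_prod:
  assumes ss: "ss \<in> segmentations \<rho>"
  shows "t * arc_value q lo hi (set \<tau> - {lo, hi}) (cut_arcs ss \<nu>) = prod_list (map seg_value ss)"
proof -
  let ?B = "set \<tau> - {lo, hi}" let ?\<mu> = "cut_arcs ss \<nu>"
  have dc: "distinct (concat ss)" and ne: "[] \<notin> set ss" and un: "\<Union>(set ` set ss) = set \<tau>"
  proof -
    have c: "\<rho> = concat ss" "[] \<notin> set ss" using ss by (auto simp: segmentations_def)
    show "distinct (concat ss)" "[] \<notin> set ss" "\<Union>(set ` set ss) = set \<tau>"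
      using distinct_\<rho> set_\<rho> c(2) unfolding c(1) set_concat by blast+
  qed
  have dss: "distinct ss" using dc ne distinct_concat_iff[of ss] by (metis removeAll_id)
  have same: "s = s'" if "s \<in> set ss" "s' \<in> set ss" "x \<in> set s" "x \<in> set s'" for s s' x
    using distinct_concat_eq[OF dc that] .
  have fin\<nu>: "finite \<nu>" using finite_set_partition[OF \<nu>] .
  define bad where "bad = (\<lambda>s. \<exists>j\<in>inner s. (lo \<in> set s \<and> (lo, j) \<in> \<nu>) \<or> (hi \<in> set s \<and> (j, hi) \<in> \<nu>))"
  have sv: "seg_value s = (if bad s then 0 else end_factor s * q ^ card (inner s) / q ^ card (\<nu> \<inter> inner s \<times> inner s))" for s
    unfolding bad_def by (rule seg_value_def)
  have bad_iff: "(\<exists>j\<in>?B. (lo, j) \<in> ?\<mu> \<or> (j, hi) \<in> ?\<mu>) \<longleftrightarrow> (\<exists>s\<in>set ss. bad s)"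
    using un by (auto simp: cut_arcs_def inner_def bad_def)
  have "?B = (\<Union>s\<in>set ss. inner s)" using un by (auto simp: inner_def)
  then have cB: "card ?B = (\<Sum>s\<in>set ss. card (inner s))"
    using same by (simp only:) (subst card_UN_disjoint, auto simp: inner_def)
  have "?\<mu> \<inter> ?B \<times> ?B = (\<Union>s\<in>set ss. \<nu> \<inter> inner s \<times> inner s)"
    using un by (auto simp: inner_def cut_arcs_def)
  then have c\<mu>: "card (?\<mu> \<inter> ?B \<times> ?B) = (\<Sum>s\<in>set ss. card (\<nu> \<inter> inner s \<times> inner s))"
    using same fin\<nu> by (simp only:) (subst card_UN_disjoint, auto simp: inner_def)
  obtain s1 where s1: "s1 \<in> set ss" "lo \<in> set s1" using un lo_hi_in by blast
  obtain s2 where s2: "s2 \<in> set ss" "hi \<in> set s2" using un lo_hi_in by blast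
  have others: "end_factor s = 1" if "s \<in> set ss - {s1, s2}" for s
    using that same[OF _ s1(1) _ s1(2)] same[OF _ s2(1) _ s2(2)] by (auto simp: end_factor_def)
  have ends: "(\<Prod>s\<in>set ss. end_factor s) = t * (if (lo, hi) \<in> ?\<mu> then -1 else t)"
  proof (cases "s1 = s2")
    case True
    have "(\<Prod>s\<in>set ss. end_factor s) = end_factor s1 * (\<Prod>s\<in>set ss - {s1}. end_factor s)"
      using s1 by (simp add: prod.remove)
    also have "(\<Prod>s\<in>set ss - {s1}. end_factor s) = 1"
      using others True by (intro prod.neutral) auto
    finally show ?thesis
      using s1 s2 True by (auto simp: end_factor_def cut_arcs_def)
  next
    case False
    have "(\<Prod>s\<in>set ss. end_factor s) = end_factor s1 * (end_factor s2 * (\<Prod>s\<in>set ss - {s1} - {s2}. end_factor s))"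
      using s1 s2 False by (simp add: prod.remove[of _ s1] prod.remove[of _ s2])
    also have "(\<Prod>s\<in>set ss - {s1} - {s2}. end_factor s) = 1"
      using others by (intro prod.neutral) auto
    also have "end_factor s1 = t" "end_factor s2 = t"
      using False s1 s2 same[OF s1(1) s2(1)] by (auto simp: end_factor_def)
    moreover have "(lo, hi) \<notin> ?\<mu>"
      using False same s1 s2 by (auto simp: cut_arcs_def) blast
    ultimately show ?thesis by simp
  qed
  have "prod_list (map seg_value ss) = (\<Prod>s\<in>set ss. seg_value s)"
    using dss by (simp add: prod.distinct_set_conv_list)
  also have "\<dots> = (if \<exists>s\<in>set ss. bad s then 0 else
     \<Prod>s\<in>set ss. end_factor s * q ^ card (inner s) / q ^ card (\<nu> \<inter> inner s \<times> inner s))"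
  proof (cases "\<exists>s\<in>set ss. bad s")
    case True
    then obtain s where "s \<in> set ss" "bad s" by blast
    then have "(\<Prod>s\<in>set ss. seg_value s) = 0"
      by (intro prod_zero) (auto simp: sv)
    then show ?thesis using True by simp
  next
    case False
    then have "(\<Prod>s\<in>set ss. seg_value s) =
        (\<Prod>s\<in>set ss. end_factor s * q ^ card (inner s) / q ^ card (\<nu> \<inter> inner s \<times> inner s))"
      by (intro prod.cong refl) (simp only: sv, simp)
    then show ?thesis using False by simp
  qed
  also have "\<dots> = (if \<exists>s\<in>set ss. bad s then 0 else
     t * (if (lo, hi) \<in> ?\<mu> then -1 else t) * q ^ card ?B / q ^ card (?\<mu> \<inter> ?B \<times> ?B))"
    by (simp only: prod.distrib prod_dividef ends cB c\<mu> power_sum)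
  also have "\<dots> = t * arc_value q lo hi ?B ?\<mu>"
    unfolding arc_value_def bad_iff by (simp add: mult.assoc)
  finally show ?thesis by simp
qed

text \<open>Inside an increasing segment the orders \<open>\<tau>\<close> and \<open>\<rho>\<close>
  agree, and cutting leaves only arcs inside segments.\<close>

lemma cut_arcs_set_partition:
  assumes ss: "ss \<in> segmentations \<rho>" and inc: "\<forall>s\<in>set ss. increasing s"
  shows "cut_arcs ss \<nu> \<in> set_partitions \<tau>"
proof (rule set_partitionsI)
  fix i j assume "(i, j) \<in> cut_arcs ss \<nu>"
  then obtain s where s: "s \<in> set ss" "i \<in> set s" "j \<in> set s" "(i, j) \<in> \<nu>" by (auto simp: cut_arcs_def)
  have "set s \<subseteq> set \<rho>" using s(1) ss by (auto simp: segmentations_def)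
  then have "restr (set s) \<tau> = s" using s inc set_\<rho>
    by (intro restr_sorted distinct_\<tau>) auto
  moreover have "restr (set s) \<rho> = s" using segment_restr[OF distinct_\<rho> ss s(1)] .
  moreover have "precedes \<rho> i j" using set_partitionsD(1)[OF \<nu> s(4)] .
  ultimately show "precedes \<tau> i j"
    using s(2,3) precedes_restr[of "set s" \<rho> i j] precedes_restr[of "set s" \<tau> i j] by simp
qed (use set_partitionsD[OF \<nu>] in \<open>auto simp: cut_arcs_def\<close>)

lemma between_lo_hi: "{j. precedes \<tau> lo j \<and> precedes \<tau> j hi} = set \<tau> - {lo, hi}"
proof (intro equalityI subsetI)
  fix j assume "j \<in> {j. precedes \<tau> lo j \<and> precedes \<tau> j hi}"
  then show "j \<in> set \<tau> - {lo, hi}"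
    using precedes_in_set[of \<tau> lo j] not_precedes_lo[of lo] not_hi_precedes[of hi] by auto
next
  fix j assume j: "j \<in> set \<tau> - {lo, hi}"
  then have "precedes \<tau> lo j \<or> precedes \<tau> j lo" "precedes \<tau> j hi \<or> precedes \<tau> hi j"
    using precedes_total[of lo \<tau> j] precedes_total[of j \<tau> hi] lo_hi_in by auto
  then show "j \<in> {j. precedes \<tau> lo j \<and> precedes \<tau> j hi}"
    using not_precedes_lo not_hi_precedes by blast
qed

lemma precedes_lo_hi: "precedes \<tau> lo hi"
  using precedes_total[of lo \<tau> hi] lo_hi_in lo_neq_hi not_precedes_lo by blast

definition cut_weight :: "'a list \<Rightarrow> complex" where
  "cut_weight s = (if increasing s then - seg_value s else 0)"

text \<open>The supercharacter lives at \<open>\<tau>\<close> alone, and \<open>\<tau>\<close> is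
  compatible with a segmentation precisely when all segments are increasing. The sign in Takeuchi's
  formula is distributed over the segments by \<open>cut_weight\<close>.\<close>

lemma takeuchi_supercharacter:
  assumes q: "q = of_nat CARD('f::{finite,field})"
  shows "t * takeuchi (set \<tau>) (supercharacter \<tau> {(lo, hi)}) \<rho> (arc_mat (set \<tau>) \<nu> :: ('a, 'f) matr) =
    (\<Sum>ss\<in>segmentations \<rho>. prod_list (map cut_weight ss))"
proof -
  let ?A = "arc_mat (set \<tau>) :: _ \<Rightarrow> ('a, 'f) matr"
  let ?\<chi> = "supercharacter \<tau> {(lo, hi)} :: ('a, 'f) family"
  have \<rho>: "\<rho> \<in> permutations_of_set (set \<tau>)" and \<tau>: "\<tau> \<in> permutations_of_set (set \<tau>)"
    using distinct_\<rho> distinct_\<tau> set_\<rho> by (auto simp: permutations_of_set_def)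
  have unitri: "(?A \<nu>) \<in> unitri \<rho>"
    using arc_mat_unitri[OF distinct_\<rho> \<nu>] set_\<rho> by simp
  have eq: "t * ((-1) ^ length ss * (\<Sum>\<phi>\<in>compatible (set \<tau>) ss.
      ?\<chi> \<phi> (cut_blocks ss (?A \<nu>)))) =
    prod_list (map cut_weight ss)" if ss: "ss \<in> segmentations \<rho>" for ss
  proof -
    have "set s \<subseteq> set \<rho>" if "s \<in> set ss" for s
      using ss that by (auto simp: segmentations_def)
    then have sub: "set s \<subseteq> set \<tau>" if "s \<in> set ss" for s
      using that set_\<rho> by simp
    have blocks: "cut_blocks ss (?A \<nu>) = arc_mat (set \<tau>) (cut_arcs ss \<nu>)"
      using cut_blocks_arc_mat[OF ss] set_\<rho> by simp
    have zero: "?\<chi> \<phi> u = 0" if "\<phi> \<noteq> \<tau>" for \<phi> u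
      using that by (simp add: supercharacter_def)
    show ?thesis
    proof (cases "\<forall>s\<in>set ss. increasing s")
      case True
      then have "\<tau> \<in> compatible (set \<tau>) ss"
        using \<tau> restr_sorted[OF distinct_\<tau>] sub by (auto simp: compatible_def)
      have arc_unitri: "(?A (cut_arcs ss \<nu>)) \<in> unitri \<tau>"
        by (intro arc_mat_unitri distinct_\<tau> cut_arcs_set_partition[OF ss True])
      from \<open>\<tau> \<in> compatible (set \<tau>) ss\<close>
      have "(\<Sum>\<phi>\<in>compatible (set \<tau>) ss. ?\<chi> \<phi> (?A (cut_arcs ss \<nu>)))
        = (\<Sum>\<phi>\<in>{\<tau>}. ?\<chi> \<phi> (?A (cut_arcs ss \<nu>)))"
        using zero by (intro sum.mono_neutral_right) auto
      also have "\<dots> = supervalue CARD('f) \<tau> {(lo, hi)} (cut_arcs ss \<nu>)"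
        using arc_unitri superclass_index_arc_mat[OF distinct_\<tau> cut_arcs_set_partition[OF ss True], where 'f = 'f]
        by (simp add: supercharacter_def)
      also have "\<dots> = arc_value q lo hi (set \<tau> - {lo, hi}) (cut_arcs ss \<nu>)"
        unfolding q
        by (intro supervalue_single distinct_\<tau> precedes_lo_hi cut_arcs_set_partition[OF ss True])
           (auto simp: between_lo_hi)
      finally have "t * (\<Sum>\<phi>\<in>compatible (set \<tau>) ss.
         ?\<chi> \<phi> (cut_blocks ss (?A \<nu>))) =
         prod_list (map seg_value ss)"
        using seg_value_prod[OF ss] by (simp add: blocks)
      moreover have "prod_list (map cut_weight ss) = (-1) ^ length ss * prod_list (map seg_value ss)"
        using True by (induction ss) (auto simp: cut_weight_def)
      ultimately show ?thesis by (simp add: mult_ac)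
    next
      case False
      then obtain s where s: "s \<in> set ss" "\<not> increasing s" by blast
      have "restr (set s) \<tau> \<noteq> s"
      proof
        assume "restr (set s) \<tau> = s"
        moreover have "increasing (restr (set s) \<tau>)"
          unfolding restr_def by (rule sorted_wrt_filter[OF sorted_wrt_precedes_self])
        ultimately show False using s(2) by simp
      qed
      then have "\<tau> \<notin> compatible (set \<tau>) ss" using s(1) by (auto simp: compatible_def)
      then have "\<phi> \<noteq> \<tau>" if "\<phi> \<in> compatible (set \<tau>) ss" for \<phi>
        using that by auto
      then have "(\<Sum>\<phi>\<in>compatible (set \<tau>) ss. ?\<chi> \<phi> (cut_blocks ss (?A \<nu>))) = 0"
        by (intro sum.neutral ballI zero) auto
      moreover have "prod_list (map cut_weight ss) = 0"
        using s by (auto simp: prod_list_zero_iff cut_weight_def)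
      ultimately show ?thesis by simp
    qed
  qed
  have "takeuchi (set \<tau>) (?\<chi>) \<rho> (?A \<nu>) =
    (\<Sum>ss\<in>segmentations \<rho>. (-1) ^ length ss * (\<Sum>\<phi>\<in>compatible (set \<tau>) ss.
      ?\<chi> \<phi> (cut_blocks ss (?A \<nu>))))"
    using \<rho> unitri by (simp add: takeuchi_def)
  then show ?thesis
    by (simp only:) (subst sum_distrib_left, intro sum.cong refl eq)
qed

end

section \<open>Factorizations by recursion along the word\<close>

fun factors :: "('a \<Rightarrow> bool) \<Rightarrow> ('a list \<Rightarrow> bool) \<Rightarrow> 'a list list \<Rightarrow> 'a list list \<Rightarrow> 'a list \<Rightarrow> bool" where
  "factors G B [p] [] v \<longleftrightarrow> v = p \<and> (\<forall>x\<in>set p. G x)"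
| "factors G B (p # ps) (w # ws) v \<longleftrightarrow>
     (\<exists>v'. v = p @ w @ v' \<and> (\<forall>x\<in>set p. G x) \<and> B w \<and> factors G B ps ws v')"
| "factors _ _ _ _ _ \<longleftrightarrow> False"

lemma factors_ne: "factors G B ps ws v \<Longrightarrow> ps \<noteq> []"
  by (cases ps) auto

lemma factors_length: "factors G B ps ws v \<Longrightarrow> length ps = length ws + 1"
  by (induction G B ps ws v rule: factors.induct) auto

lemma factors_Cons_gap:
  "factors G B ((c # p) # ps) ws (c' # v) \<longleftrightarrow> c = c' \<and> G c \<and> factors G B (p # ps) ws v"
  by (cases ps; cases ws) auto

lemma factors_Cons_block:
  assumes "factors G B ([] # ps) ws (c # v)" "\<not> B []"
  obtains w ws' v' where "ws = w # ws'" "w \<noteq> []" "c # v = w @ v'" "B w" "factors G B ps ws' v'"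
  using assms by (cases ws; cases ps) auto

definition factorings :: "('a \<Rightarrow> bool) \<Rightarrow> ('a list \<Rightarrow> bool) \<Rightarrow> 'a list \<Rightarrow> ('a list list \<times> 'a list list) set" where
  "factorings G B v = {(ps, ws). factors G B ps ws v}"

lemma factorings_Nil: "\<not> B [] \<Longrightarrow> factorings G B [] = {([[]], [])}"
proof (intro equalityI subsetI)
  fix x assume B: "\<not> B []" and "x \<in> factorings G B []"
  then obtain ps ws where x: "x = (ps, ws)" "factors G B ps ws []" by (auto simp: factorings_def)
  then show "x \<in> {([[]], [])}" using B by (cases ps; cases ws; cases "tl ps") auto
qed (simp add: factorings_def)

lemma factorings_Cons:
  assumes "\<not> B []"
  shows "factorings G B (c # v) =
    (if G c then (\<lambda>(ps, ws). ((c # hd ps) # tl ps, ws)) ` factorings G B v else {}) \<union>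
    (\<lambda>(k, ps, ws). ([] # ps, take k (c # v) # ws)) `
      (SIGMA k:{k\<in>{1..length (c # v)}. B (take k (c # v))}. factorings G B (drop k (c # v)))"
    (is "_ = ?A \<union> ?B")
proof (intro equalityI subsetI)
  fix x assume "x \<in> factorings G B (c # v)"
  then obtain ps ws where x: "x = (ps, ws)" and f: "factors G B ps ws (c # v)" by (auto simp: factorings_def)
  obtain p ps' where ps: "ps = p # ps'" using factors_ne[OF f] by (cases ps) auto
  show "x \<in> ?A \<union> ?B"
  proof (cases p)
    case (Cons c' p')
    then have "c' = c" "G c" "factors G B (p' # ps') ws v" using f ps factors_Cons_gap by metis+
    then have "x \<in> ?A" using x ps Cons by (auto simp: factorings_def intro!: image_eqI[of _ _ "(p' # ps', ws)"])
    then show ?thesis by blast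
  next
    case Nil
    then obtain w ws' v' where w: "ws = w # ws'" "w \<noteq> []" "c # v = w @ v'" "B w" "factors G B ps' ws' v'"
      using factors_Cons_block f ps assms by metis
    have "take (length w) (c # v) = w" "drop (length w) (c # v) = v'" using w(3) by simp_all
    moreover have "length w \<in> {1..length (c # v)}"
      using w(2,3) by (auto simp: Suc_le_eq)
    ultimately have "x \<in> ?B"
      using x ps Nil w by (intro image_eqI[of _ _ "(length w, ps', ws')"]) (auto simp: factorings_def)
    then show ?thesis by blast
  qed
next
  fix x assume "x \<in> ?A \<union> ?B"
  then show "x \<in> factorings G B (c # v)"
  proof
    assume "x \<in> ?A"
    then obtain ps ws where "x = ((c # hd ps) # tl ps, ws)" "factors G B ps ws v" "G c"
      by (auto simp: factorings_def split: if_splits)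
    then show ?thesis using factors_ne[of G B ps ws v] by (auto simp: factorings_def factors_Cons_gap)
  next
    assume "x \<in> ?B"
    then obtain k ps ws where "x = ([] # ps, take k (c # v) # ws)" "B (take k (c # v))"
      "factors G B ps ws (drop k (c # v))"
      by (auto simp: factorings_def)
    then show ?thesis
      by (auto simp: factorings_def) (metis append_take_drop_id)
  qed
qed

lemma finite_factorings:
  assumes "\<not> B []"
  shows "finite (factorings G B v)"
proof (induction "length v" arbitrary: v rule: less_induct)
  case less
  show ?case
  proof (cases v)
    case Nil
    then show ?thesis by (simp add: factorings_Nil[of B] assms)
  next
    case (Cons c v')
    have "finite (factorings G B v')" using less Cons by simp
    moreover have "finite (SIGMA k:{k\<in>{1..length (c # v')}. B (take k (c # v'))}. factorings G B (drop k (c # v')))"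
      using less Cons by (intro finite_SigmaI) auto
    ultimately show ?thesis unfolding Cons factorings_Cons[of B, OF assms] by simp
  qed
qed

text \<open>The first letter lies in a gap or opens a block. These alternatives will match the
  bidiagonal part and the block part of the transformed matrix.\<close>

lemma sum_factorings_Cons:
  fixes f :: "'a list list \<Rightarrow> 'a list list \<Rightarrow> 'b::comm_monoid_add"
  assumes "\<not> B []"
  shows "(\<Sum>(ps, ws)\<in>factorings G B (c # v). f ps ws) =
    (if G c then \<Sum>(ps, ws)\<in>factorings G B v. f ((c # hd ps) # tl ps) ws else 0) +
    (\<Sum>k\<in>{1..length (c # v)}. if B (take k (c # v))
       then \<Sum>(ps, ws)\<in>factorings G B (drop k (c # v)). f ([] # ps) (take k (c # v) # ws) else 0)"
proof -
  let ?A = "if G c then (\<lambda>(ps, ws). ((c # hd ps) # tl ps, ws)) ` factorings G B v else {}"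
  let ?K = "{k\<in>{1..length (c # v)}. B (take k (c # v))}"
  let ?S = "SIGMA k:?K. factorings G B (drop k (c # v))"
  let ?g = "\<lambda>(k, ps, ws). ([] # ps, take k (c # v) # ws)"
  have fin: "finite (factorings G B v')" for v' using finite_factorings[of B, OF assms] .
  have finS: "finite ?S" using fin by (intro finite_SigmaI) auto
  have "?A \<inter> ?g ` ?S = {}" by auto
  then have "(\<Sum>(ps, ws)\<in>factorings G B (c # v). f ps ws) =
    (\<Sum>(ps, ws)\<in>?A. f ps ws) + (\<Sum>(ps, ws)\<in>?g ` ?S. f ps ws)"
    unfolding factorings_Cons[of B, OF assms] using fin finS by (intro sum.union_disjoint) auto
  also have "(\<Sum>(ps, ws)\<in>?A. f ps ws) =
    (if G c then \<Sum>(ps, ws)\<in>factorings G B v. f ((c # hd ps) # tl ps) ws else 0)"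
  proof (cases "G c")
    case True
    have "inj_on (\<lambda>(ps, ws). ((c # hd ps) # tl ps, ws)) (factorings G B v)"
    proof (rule inj_onI)
      fix x y assume xy: "x \<in> factorings G B v" "y \<in> factorings G B v"
        "(case x of (ps, ws) \<Rightarrow> ((c # hd ps) # tl ps, ws)) = (case y of (ps, ws) \<Rightarrow> ((c # hd ps) # tl ps, ws))"
      then have "fst x \<noteq> []" "fst y \<noteq> []" by (auto simp: factorings_def dest: factors_ne)
      then show "x = y" using xy(3) by (cases x; cases y) (auto simp: list.expand)
    qed
    then show ?thesis using True by (simp add: sum.reindex case_prod_unfold)
  qed simp
  also have "inj_on ?g ?S"
    by (auto simp: inj_on_def) (metis (no_types, lifting) diff_is_0_eq' drop_eq_Nil length_drop length_take min.absorb2 take_Suc_Cons length_Cons)+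
  then have "(\<Sum>(ps, ws)\<in>?g ` ?S. f ps ws) = (\<Sum>(k, x)\<in>?S. case x of (ps, ws) \<Rightarrow> f ([] # ps) (take k (c # v) # ws))"
    by (simp add: sum.reindex case_prod_unfold del: take_Suc_Cons)
  also have "\<dots> = (\<Sum>k\<in>?K. \<Sum>(ps, ws)\<in>factorings G B (drop k (c # v)). f ([] # ps) (take k (c # v) # ws))"
    using fin by (subst sum.Sigma) auto
  also have "\<dots> = (\<Sum>k\<in>{1..length (c # v)}. if B (take k (c # v))
       then \<Sum>(ps, ws)\<in>factorings G B (drop k (c # v)). f ([] # ps) (take k (c # v) # ws) else 0)"
    by (simp only: sum.inter_filter[OF finite_atLeastAtMost])
  finally show ?thesis .
qed

text \<open>Only the letters strictly inside the word are weighted, since its first and last letters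
  belong to the neighbouring blocks or are adjoined. The weight is \<open>-(t - 1)\<close>,
  \<open>-t\<close> or \<open>-(t + 1)\<close> for 0, 1 or 2 descents next to the letter; these
  minus signs are the source of \<open>total_gap\<close> in the sign of the formula.\<close>

fun gap_weight :: "('b \<Rightarrow> 'b \<Rightarrow> bool) \<Rightarrow> complex \<Rightarrow> 'b list \<Rightarrow> complex" where
  "gap_weight R t (x # y # z # l) =
     - (t - 1 + (if R x y then 0 else 1) + (if R y z then 0 else 1)) * gap_weight R t (y # z # l)"
| "gap_weight R t _ = 1"

lemma precedes_map_Letter [simp]: "precedes (map Letter \<tau>) (Letter x) (Letter y) \<longleftrightarrow> precedes \<tau> x y"
  by (induction \<tau>) auto

lemma precedes_ext_order [simp]:
  "precedes (ext_order \<tau>) (Letter x) (Letter y) \<longleftrightarrow> precedes \<tau> x y"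
  "\<not> precedes (ext_order \<tau>) Top z"
  "\<not> precedes (ext_order \<tau>) z Bot"
  by (auto simp: ext_order_def dest: precedes_in_set)

section \<open>The transfer matrix along the word\<close>

context two_orders
begin

definition slice :: "nat \<Rightarrow> nat \<Rightarrow> 'a list" where
  "slice i j = take (j - i) (drop i \<rho>)"

text \<open>The diagonal matrix \<open>D\<close> of the transfer lemma: positions are the boundaries
  between letters, and ascents get 1. The two outer boundaries get 0, as they become descents once
  \<open>Top\<close> and \<open>Bot\<close> are adjoined.\<close>

definition link :: "nat \<Rightarrow> complex" where
  "link i = (if 0 < i \<and> i < length \<rho> \<and> precedes \<tau> (\<rho> ! (i - 1)) (\<rho> ! i) then 1 else 0)"

definition is_block :: "'a list \<Rightarrow> bool" where
  "is_block w \<longleftrightarrow> w \<noteq> [] \<and> (hd w = last w \<longrightarrow> w = [hd w] \<and> hd w \<in> {lo, hi}) \<and> increasing w"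

lemma slice_Cons: "i < j \<Longrightarrow> j \<le> length \<rho> \<Longrightarrow> slice i j = \<rho> ! i # slice (Suc i) j"
  unfolding slice_def by (subst Cons_nth_drop_Suc[symmetric]) (auto simp: Suc_diff_Suc[symmetric] take_Cons')

lemma slice_snoc: "i \<le> j \<Longrightarrow> j < length \<rho> \<Longrightarrow> slice i (Suc j) = slice i j @ [\<rho> ! j]"
  unfolding slice_def by (simp add: Suc_diff_le take_Suc_conv_app_nth)

lemma slice_empty [simp]: "slice i i = []"
  by (simp add: slice_def)

lemma increasing_slice:
  assumes "i \<le> j" "j \<le> length \<rho>"
  shows "increasing (slice i j) \<longleftrightarrow> (\<forall>p. i < p \<and> p < j \<longrightarrow> link p = 1)"
proof -
  have "transp (precedes \<tau>)"
    using precedes_trans[OF distinct_\<tau>] by (auto simp: transp_def)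
  then have "increasing (slice i j) \<longleftrightarrow>
      (\<forall>k. Suc k < length (slice i j) \<longrightarrow> precedes \<tau> (slice i j ! k) (slice i j ! Suc k))"
    by (rule sorted_wrt_iff_nth_Suc_transp)
  also have "\<dots> \<longleftrightarrow> (\<forall>k. Suc k < j - i \<longrightarrow> precedes \<tau> (\<rho> ! (i + k)) (\<rho> ! (Suc (i + k))))"
    using assms by (auto simp: slice_def)
  also have "\<dots> \<longleftrightarrow> (\<forall>p. i < p \<and> p < j \<longrightarrow> precedes \<tau> (\<rho> ! (p - 1)) (\<rho> ! p))"
  proof (intro iffI allI impI)
    fix p assume *: "\<forall>k. Suc k < j - i \<longrightarrow> precedes \<tau> (\<rho> ! (i + k)) (\<rho> ! (Suc (i + k)))" and p: "i < p \<and> p < j"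
    then have "Suc (p - i - 1) < j - i" by linarith
    then show "precedes \<tau> (\<rho> ! (p - 1)) (\<rho> ! p)" using *[rule_format, of "p - i - 1"] p by simp
  next
    fix k assume *: "\<forall>p. i < p \<and> p < j \<longrightarrow> precedes \<tau> (\<rho> ! (p - 1)) (\<rho> ! p)" and k: "Suc k < j - i"
    then show "precedes \<tau> (\<rho> ! (i + k)) (\<rho> ! (Suc (i + k)))" using *[rule_format, of "Suc (i + k)"] by simp
  qed
  also have "\<dots> \<longleftrightarrow> (\<forall>p. i < p \<and> p < j \<longrightarrow> link p = 1)"
    using assms by (auto simp: link_def)
  finally show ?thesis .
qed

definition cut_matrix :: "nat \<Rightarrow> nat \<Rightarrow> complex" where
  "cut_matrix i j = (if increasing (slice i j) then seg_value (slice i j) else 0)"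

definition block_matrix :: "nat \<Rightarrow> nat \<Rightarrow> complex" where
  "block_matrix i j = (if is_block (slice i j) then block_value (slice i j) else 0)"

definition cut_sum :: "nat \<Rightarrow> complex" where
  "cut_sum i = (\<Sum>ss\<in>segmentations (drop i \<rho>). prod_list (map cut_weight ss))"

text \<open>Splitting off the first segment expresses \<open>cut_sum i\<close> by later values with
  a minus sign from \<open>cut_weight\<close>; the empty slice has value 1, so
  \<open>cut_sum i\<close> itself is the term \<open>j = i\<close>.\<close>

lemma cut_sum_rec:
  assumes i: "i < length \<rho>"
  shows "(\<Sum>j\<in>{i..length \<rho>}. cut_matrix i j * cut_sum j) = 0"
proof -
  have "cut_sum i = (\<Sum>k\<in>{1..length \<rho> - i}. \<Sum>ss\<in>segmentations (drop (i + k) \<rho>).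
      cut_weight (slice i (i + k)) * prod_list (map cut_weight ss))"
    using i by (simp add: cut_sum_def sum_segmentations_first slice_def add.commute)
  also have "\<dots> = (\<Sum>k\<in>{1..length \<rho> - i}. - (cut_matrix i (i + k) * cut_sum (i + k)))"
    by (intro sum.cong) (auto simp: cut_sum_def sum_distrib_left cut_weight_def cut_matrix_def sum_negf)
  also have "\<dots> = (\<Sum>j\<in>{Suc i..length \<rho>}. - (cut_matrix i j * cut_sum j))"
    by (rule sum.reindex_bij_witness[of _ "\<lambda>j. j - i" "\<lambda>k. i + k"]) auto
  finally show ?thesis
    using i by (simp add: sum.atLeast_Suc_atMost sum_negf cut_matrix_def seg_value_Nil)
qed

lemma restr_slice:
  assumes "i \<le> j"
  shows "restr (set (slice i j)) \<rho> = slice i j"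
proof -
  have "\<rho> = take i \<rho> @ slice i j @ drop j \<rho>"
    using assms unfolding slice_def by (metis append_take_drop_id drop_drop le_add_diff_inverse2)
  then obtain \<alpha> \<gamma> where \<rho>: "\<rho> = \<alpha> @ slice i j @ \<gamma>" by blast
  then have "distinct (\<alpha> @ slice i j @ \<gamma>)" using distinct_\<rho> by metis
  then have "restr (set (slice i j)) (\<alpha> @ slice i j @ \<gamma>) = slice i j"
    by (simp add: restr_append restr_superset restr_disjoint Int_Un_distrib inf_commute)
  then show ?thesis using \<rho> by metis
qed

text \<open>If the slice is increasing, both links are 1 and this is \<open>seg_value_diff\<close>;
  otherwise every term vanishes.\<close>

lemma cut_matrix_diff:
  assumes ij: "Suc (Suc i) \<le> j" "j \<le> length \<rho>"
  shows "cut_matrix i j - free (\<rho> ! i) * link (Suc i) * cut_matrix (Suc i) j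
      - (cut_matrix i (j - 1) - free (\<rho> ! i) * link (Suc i) * cut_matrix (Suc i) (j - 1)) *
        (link (j - 1) * free (\<rho> ! (j - 1))) = t * block_matrix i j"
proof -
  define a where "a = \<rho> ! i"
  define b where "b = \<rho> ! (j - 1)"
  define \<psi> where "\<psi> = slice (Suc i) (j - 1)"
  have j: "Suc (j - 1) = j" using ij by simp
  have s1: "slice (Suc i) j = \<psi> @ [b]"
    using slice_snoc[of "Suc i" "j - 1"] ij unfolding \<psi>_def b_def j by auto
  have s0: "slice i j = a # \<psi> @ [b]"
    using slice_Cons[of i j] ij unfolding a_def s1 by auto
  have s2: "slice i (j - 1) = a # \<psi>"
    using slice_Cons[of i "j - 1"] ij unfolding a_def \<psi>_def by auto
  have inc: "increasing (slice k l) \<longleftrightarrow> (\<forall>p. k < p \<and> p < l \<longrightarrow> link p = 1)" if "k \<le> l" "l \<le> j" for k l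
    using increasing_slice[of k l] that ij by simp
  have l01: "link p = 0" if "link p \<noteq> 1" for p using that by (auto simp: link_def split: if_splits)
  show ?thesis
  proof (cases "\<forall>p. i < p \<and> p < j \<longrightarrow> link p = 1")
    case True
    have d: "distinct (a # \<psi> @ [b])"
      using distinct_\<rho> unfolding s0[symmetric] slice_def by (simp add: distinct_take)
    have increasing: "increasing (slice i j)" "increasing (slice (Suc i) j)" "increasing (slice i (j - 1))" "increasing (slice (Suc i) (j - 1))"
      using True ij by (auto simp: inc)
    have links: "link (Suc i) = 1" "link (j - 1) = 1" using True ij by simp_all
    have "precedes (slice i j) x y" if "x \<in> set (slice i j)" "y \<in> set (slice i j)" "(x, y) \<in> \<nu>" for x y
      using precedes_restr[of "set (slice i j)" \<rho> x y] restr_slice[of i j] ij that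
        set_partitionsD(1)[OF \<nu> that(3)] by simp
    then have "seg_value (a # \<psi> @ [b]) - free a * seg_value (\<psi> @ [b]) - free b * seg_value (a # \<psi>)
       + free a * free b * seg_value \<psi> = t * block_value (a # \<psi> @ [b])"
      using d increasing(1) unfolding s0 by (intro seg_value_diff) auto
    moreover have "is_block (slice i j)"
      using increasing(1) d unfolding s0 by (auto simp: is_block_def)
    ultimately show ?thesis
      using increasing unfolding cut_matrix_def block_matrix_def
      by (simp add: links s0 s1 s2 \<psi>_def[symmetric] a_def[symmetric] b_def[symmetric] algebra_simps
            del: One_nat_def sorted_wrt.simps)
  next
    case False
    \<comment> \<open>A shorter slice still contains the descent at \<open>p\<close> in its
      interior, unless \<open>p\<close> is the boundary just cut off, and then the link multiplying
      the term is 0.\<close>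
    then obtain p where p: "i < p" "p < j" "link p = 0" using l01 by blast
    have "\<not> increasing (slice i j)" using False inc[of i j] ij by simp
    then have "cut_matrix i j = 0" "block_matrix i j = 0"
      by (auto simp: cut_matrix_def block_matrix_def is_block_def)
    moreover have "link (Suc i) * cut_matrix (Suc i) j = 0"
    proof (cases "p = Suc i")
      case False
      then have "\<not> increasing (slice (Suc i) j)" using inc[of "Suc i" j] ij p by force
      then show ?thesis by (simp add: cut_matrix_def)
    qed (use p in simp)
    moreover have "cut_matrix i (j - 1) * link (j - 1) = 0"
    proof (cases "p = j - 1")
      case False
      then have "\<not> increasing (slice i (j - 1))" using inc[of i "j - 1"] ij p by force
      then show ?thesis by (simp add: cut_matrix_def)
    qed (use p in simp)
    moreover have "link (Suc i) * cut_matrix (Suc i) (j - 1) * link (j - 1) = 0"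
    proof (cases "p = Suc i \<or> p = j - 1")
      case False
      then have "\<not> increasing (slice (Suc i) (j - 1))" using inc[of "Suc i" "j - 1"] ij p by force
      then show ?thesis by (simp add: cut_matrix_def)
    qed (use p in auto)
    ultimately show ?thesis by (auto simp: algebra_simps)
  qed
qed

lemma cut_matrix_Suc:
  assumes i: "i < length \<rho>"
  shows "cut_matrix i (Suc i) = free (\<rho> ! i) * (1 + t) + t * block_matrix i (Suc i)"
proof -
  have "slice i (Suc i) = [\<rho> ! i]" using slice_Cons[of i "Suc i"] i by simp
  then show ?thesis
    by (simp add: cut_matrix_def block_matrix_def seg_value_single is_block_def block_value_def)
qed

abbreviation ext_less :: "'a letter \<Rightarrow> 'a letter \<Rightarrow> bool" where
  "ext_less \<equiv> precedes (ext_order \<tau>)"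

text \<open>The first argument carries the last letter of the preceding block, or \<open>Top\<close>
  at the start, because the weight of the first letter of a gap depends on it.\<close>

fun factor_weight :: "'a letter \<Rightarrow> 'a list list \<Rightarrow> 'a list list \<Rightarrow> complex" where
  "factor_weight x [p] [] = gap_weight ext_less t (x # map Letter p @ [Bot])"
| "factor_weight x (p # ps) (w # ws) = gap_weight ext_less t (x # map Letter p @ [Letter (hd w)]) *
     (- t * block_value w) * factor_weight (Letter (last w)) ps ws"
| "factor_weight _ _ _ = 0"

abbreviation facs :: "'a list \<Rightarrow> ('a list list \<times> 'a list list) set" where
  "facs \<equiv> factorings (\<lambda>x. x \<notin> {lo, hi}) is_block"

definition padded :: "'a letter list" where
  "padded = Top # map Letter \<rho> @ [Bot]"

definition factor_sum :: "nat \<Rightarrow> complex" where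
  "factor_sum i = (\<Sum>(ps, ws)\<in>facs (drop i \<rho>). factor_weight (padded ! i) ps ws)"

lemma padded_Suc: "i < length \<rho> \<Longrightarrow> padded ! Suc i = Letter (\<rho> ! i)"
  by (simp add: padded_def nth_append)

lemma padded_Suc_length: "padded ! Suc (length \<rho>) = Bot"
  by (simp add: padded_def nth_append)

lemma link_padded:
  assumes "i \<le> length \<rho>"
  shows "link i = 1 - (if ext_less (padded ! i) (padded ! Suc i) then 0 else 1)"
proof (cases "i = length \<rho>")
  case True
  then show ?thesis by (simp add: padded_Suc_length link_def)
next
  case False
  then show ?thesis
    using assms by (cases i) (auto simp: padded_Suc link_def, simp add: padded_def)
qed

lemma not_is_block_Nil: "\<not> is_block []"
  by (simp add: is_block_def)

lemma factor_weight_Cons: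
  assumes "factors G is_block ps ws v"
  shows "factor_weight x ((c # hd ps) # tl ps) ws =
    - (t - 1 + (if ext_less x (Letter c) then 0 else 1) +
      (if ext_less (Letter c) (if v = [] then Bot else Letter (hd v)) then 0 else 1)) *
    factor_weight (Letter c) ps ws"
proof -
  obtain p ps' where ps: "ps = p # ps'" using factors_ne[OF assms] by (cases ps) auto
  show ?thesis
  proof (cases ws)
    case Nil
    then have "ps' = []" "v = p" using assms ps by (cases ps'; auto)+
    then show ?thesis using Nil ps by (cases p) auto
  next
    case (Cons w ws')
    then obtain v' where "v = p @ w @ v'" "w \<noteq> []" using assms ps by (auto simp: is_block_def)
    then show ?thesis using Cons ps by (cases p) auto
  qed
qed

lemma factor_sum_rec:
  assumes i: "i < length \<rho>"
  shows "factor_sum i = - (free (\<rho> ! i) * (1 + t - link i - link (Suc i)) * factor_sum (Suc i)) -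
     t * (\<Sum>j\<in>{Suc i..length \<rho>}. block_matrix i j * factor_sum j)"
proof -
  have drop: "drop i \<rho> = \<rho> ! i # drop (Suc i) \<rho>" using i by (simp add: Cons_nth_drop_Suc)
  let ?x = "padded ! i" let ?c = "\<rho> ! i" let ?v = "drop (Suc i) \<rho>"
  \<comment> \<open>To the right of a gap letter stands another gap letter or the head of a block;
    in both cases it is the next letter of the word. The weight of a gap letter therefore does not
    depend on the factorization around it.\<close>
  have next_letter: "(if ?v = [] then Bot else Letter (hd ?v)) = padded ! Suc (Suc i)"
  proof (cases "Suc i = length \<rho>")
    case True
    then show ?thesis using padded_Suc_length by simp
  next
    case False
    then show ?thesis using i padded_Suc[of "Suc i"] by (auto simp: hd_drop_conv_nth)
  qed
  have "factor_weight ?x ((?c # hd ps) # tl ps) ws =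
      - (1 + t - link i - link (Suc i)) * factor_weight (padded ! Suc i) ps ws"
    if "(ps, ws) \<in> facs ?v" for ps ws
  proof -
    have "factors (\<lambda>x. x \<notin> {lo, hi}) is_block ps ws ?v" using that by (simp add: factorings_def)
    from factor_weight_Cons[OF this, of ?x ?c, unfolded next_letter]
    show ?thesis using i by (simp add: link_padded padded_Suc algebra_simps)
  qed
  then have gap: "(\<Sum>(ps, ws)\<in>facs ?v. factor_weight ?x ((?c # hd ps) # tl ps) ws) =
      - (1 + t - link i - link (Suc i)) * factor_sum (Suc i)"
    unfolding factor_sum_def sum_distrib_left by (intro sum.cong) auto
  have block: "(if is_block (take k (drop i \<rho>)) then
      \<Sum>(ps, ws)\<in>facs (drop k (drop i \<rho>)). factor_weight ?x ([] # ps) (take k (drop i \<rho>) # ws) else 0) =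
      - t * (block_matrix i (i + k) * factor_sum (i + k))" if k: "k \<in> {1..length \<rho> - i}" for k
  proof -
    have w: "take k (drop i \<rho>) = slice i (i + k)" by (simp add: slice_def)
    have "i + k = Suc (i + k - 1)" "i \<le> i + k - 1" "i + k - 1 < length \<rho>" using k by auto
    then have "last (slice i (i + k)) = \<rho> ! (i + k - 1)" "padded ! (i + k) = Letter (\<rho> ! (i + k - 1))"
      using slice_snoc[of i "i + k - 1"] padded_Suc[of "i + k - 1"] by simp_all
    then have fw: "factor_weight ?x ([] # ps) (slice i (i + k) # ws) =
      - t * block_value (slice i (i + k)) * factor_weight (padded ! (i + k)) ps ws" for ps ws
      by simp
    show ?thesis
      unfolding w fw block_matrix_def factor_sum_def
      by (simp add: add.commute sum_distrib_left case_prod_unfold mult.assoc)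
  qed
  have "factor_sum i = (\<Sum>(ps, ws)\<in>facs (?c # ?v). factor_weight ?x ps ws)"
    by (simp add: factor_sum_def drop)
  also have "\<dots> = (if ?c \<notin> {lo, hi} then \<Sum>(ps, ws)\<in>facs ?v. factor_weight ?x ((?c # hd ps) # tl ps) ws else 0) +
    (\<Sum>k\<in>{1..length \<rho> - i}. if is_block (take k (drop i \<rho>)) then
      \<Sum>(ps, ws)\<in>facs (drop k (drop i \<rho>)). factor_weight ?x ([] # ps) (take k (drop i \<rho>) # ws) else 0)"
    unfolding sum_factorings_Cons[of is_block, OF not_is_block_Nil] unfolding drop[symmetric] by simp
  also have "\<dots> = - (free ?c * (1 + t - link i - link (Suc i)) * factor_sum (Suc i)) +
    (\<Sum>k\<in>{1..length \<rho> - i}. - t * (block_matrix i (i + k) * factor_sum (i + k)))"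
    unfolding gap using block by (simp add: free_def) (auto simp: algebra_simps)
  also have "(\<Sum>k\<in>{1..length \<rho> - i}. - t * (block_matrix i (i + k) * factor_sum (i + k))) =
    (\<Sum>j\<in>{Suc i..length \<rho>}. - t * (block_matrix i j * factor_sum j))"
    by (rule sum.reindex_bij_witness[of _ "\<lambda>j. j - i" "\<lambda>k. i + k"]) auto
  also have "\<dots> = - t * (\<Sum>j\<in>{Suc i..length \<rho>}. block_matrix i j * factor_sum j)"
    by (rule sum_distrib_left[symmetric])
  finally show ?thesis by (simp add: algebra_simps)
qed

text \<open>The link at position 0 vanishes, so the correction between the two solutions of the
  transfer lemma disappears there.\<close>

lemma cut_sum_eq_factor_sum:
  "(\<Sum>ss\<in>segmentations \<rho>. prod_list (map cut_weight ss)) = (\<Sum>(ps, ws)\<in>facs \<rho>. factor_weight Top ps ws)"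
proof -
  have "cut_sum 0 = factor_sum 0 - link 0 * free (\<rho> ! 0) * factor_sum (Suc 0)"
  proof (rule bidiagonal_transfer[where n = "length \<rho>" and d = link and e = "\<lambda>i. free (\<rho> ! i)" and t = t
        and M = cut_matrix and W = block_matrix and T = cut_sum and R = factor_sum])
    show "link (length \<rho>) = 0" by (simp add: link_def)
    show "cut_sum (length \<rho>) = 1" by (simp add: cut_sum_def)
    show "factor_sum (length \<rho>) = 1"
      by (simp add: factor_sum_def factorings_Nil[of is_block, OF not_is_block_Nil])
    show "cut_matrix i i = 1" for i by (simp add: cut_matrix_def seg_value_Nil)
  qed (use cut_sum_rec cut_matrix_Suc cut_matrix_diff factor_sum_rec in auto)
  then show ?thesis by (simp add: cut_sum_def factor_sum_def link_def padded_def)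
qed

end

section \<open>Factorizations and their statistics\<close>

definition runs_mt :: "'b list list \<Rightarrow> nat" where
  "runs_mt rs = (\<Sum>j \<in> {j. j < length rs \<and> length (rs ! j) > 1}. length (rs ! j) - 2)"

definition runs_io :: "'b list list \<Rightarrow> nat" where
  "runs_io rs = card {j. 1 \<le> j \<and> j + 1 < length rs \<and> length (rs ! j) = 1}"

lemma runs_mt_alt: "runs_mt rs = (\<Sum>r\<leftarrow>rs. length r - 2)"
proof -
  have "(\<Sum>r\<leftarrow>rs. length r - 2) = (\<Sum>j<length rs. length (rs ! j) - 2)"
    by (simp add: sum_list_sum_nth atLeast0LessThan)
  also have "\<dots> = runs_mt rs"
    unfolding runs_mt_def by (rule sum.mono_neutral_right) auto
  finally show ?thesis by simp
qed

lemma runs_io_alt: "runs_io rs = length (filter (\<lambda>r. length r = 1) (butlast (tl rs)))"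
proof -
  have "{j. 1 \<le> j \<and> j + 1 < length rs \<and> length (rs ! j) = 1} =
    Suc ` {i. i < length (butlast (tl rs)) \<and> length (butlast (tl rs) ! i) = 1}"
  proof (intro equalityI subsetI)
    fix j assume j: "j \<in> {j. 1 \<le> j \<and> j + 1 < length rs \<and> length (rs ! j) = 1}"
    then obtain i where "j = Suc i" by (cases j) auto
    with j show "j \<in> Suc ` {i. i < length (butlast (tl rs)) \<and> length (butlast (tl rs) ! i) = 1}"
      by (auto simp: nth_butlast nth_tl)
  qed (auto simp: nth_butlast nth_tl)
  then show ?thesis
    by (simp add: runs_io_def card_image length_filter_conv_card)
qed

lemma rising_runs_Cons:
  "\<exists>r rs. rising_runs R (x # w) = (x # r) # rs \<and>
     (case w of [] \<Rightarrow> r = [] \<and> rs = [] | y # _ \<Rightarrow> (R x y \<longleftrightarrow> r \<noteq> []) \<and> (\<not> R x y \<longrightarrow> rs \<noteq> []))"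
proof (induction w arbitrary: x)
  case (Cons y w)
  from Cons[of y] obtain r rs where "rising_runs R (y # w) = (y # r) # rs" by blast
  then show ?case by (simp add: Let_def)
qed simp

text \<open>A new first letter \<open>x\<close> turns \<open>y\<close> from an end of the word into
  a letter of the gap. With ascents on both sides \<open>y\<close> lies inside a run, and with
  descents on both sides it is a run by itself that is neither first nor last.\<close>

lemma runs_Cons:
  "runs_mt (rising_runs R (x # y # z # w)) =
     runs_mt (rising_runs R (y # z # w)) + (if R x y \<and> R y z then 1 else 0)"
  "runs_io (rising_runs R (x # y # z # w)) =
     runs_io (rising_runs R (y # z # w)) + (if \<not> R x y \<and> \<not> R y z then 1 else 0)"
proof -
  obtain r rs where r: "rising_runs R (y # z # w) = (y # r) # rs" "R y z \<longleftrightarrow> r \<noteq> []" "\<not> R y z \<longrightarrow> rs \<noteq> []"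
    using rising_runs_Cons[of R y "z # w"] by auto
  have eq: "rising_runs R (x # y # z # w) = (if R x y then (x # y # r) # rs else [x] # (y # r) # rs)"
    using r(1) by (simp add: Let_def)
  show "runs_mt (rising_runs R (x # y # z # w)) =
     runs_mt (rising_runs R (y # z # w)) + (if R x y \<and> R y z then 1 else 0)"
    unfolding eq unfolding r(1) runs_mt_alt using r(2) by (cases r) auto
  show "runs_io (rising_runs R (x # y # z # w)) =
     runs_io (rising_runs R (y # z # w)) + (if \<not> R x y \<and> \<not> R y z then 1 else 0)"
    unfolding eq unfolding r(1) runs_io_alt using r(2,3) by (cases r) auto
qed

text \<open>Each letter of the gap is counted by exactly one of the three exponents. The inequality
  is carried through the induction so that the exponent of \<open>t\<close> is never
  truncated.\<close>

lemma gap_weight_runs: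
  assumes "length l \<ge> 2"
  shows "runs_mt (rising_runs R l) + runs_io (rising_runs R l) \<le> length l - 2 \<and>
    gap_weight R t l = (-1) ^ (length l - 2) * ((t - 1) ^ runs_mt (rising_runs R l) *
      t ^ (length l - 2 - runs_mt (rising_runs R l) - runs_io (rising_runs R l)) *
      (t + 1) ^ runs_io (rising_runs R l))"
  using assms
proof (induction R t l rule: gap_weight.induct)
  case (1 R t x y z w)
  let ?m = "runs_mt (rising_runs R (y # z # w))" and ?o = "runs_io (rising_runs R (y # z # w))"
  let ?n = "length w"
  have le: "?m + ?o \<le> ?n" and
    gw: "gap_weight R t (y # z # w) = (-1) ^ ?n * ((t - 1) ^ ?m * t ^ (?n - ?m - ?o) * (t + 1) ^ ?o)"
    using 1 by auto
  have "Suc ?n - ?m - ?o = Suc (?n - ?m - ?o)" using le by simp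
  then show ?case
    using le unfolding runs_Cons gap_weight.simps gw
    by (cases "R x y"; cases "R y z") (auto simp: algebra_simps)
qed (auto simp: runs_mt_alt runs_io_alt Let_def)

text \<open>Links the recursion used for summation to the closed form in the definition of a
  factorization.\<close>

lemma factors_iff:
  "factors G B ps ws v \<longleftrightarrow> length ps = length ws + 1 \<and> v = hd ps @ concat (map2 (@) ws (tl ps)) \<and>
     (\<forall>w\<in>set ws. B w) \<and> (\<forall>p\<in>set ps. \<forall>x\<in>set p. G x)"
proof (induction G B ps ws v rule: factors.induct)
  case (2 G B p ps w ws v)
  then show ?case by (cases ps) auto
qed auto

lemma factors_blocks:
  assumes "factors G B ps ws v"
  shows "set (concat ws) \<subseteq> set v" "distinct v \<Longrightarrow> distinct (concat ws)" "w \<in> set ws \<Longrightarrow> B w"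
    "w \<in> set ws \<Longrightarrow> \<exists>\<alpha> \<gamma>. v = \<alpha> @ w @ \<gamma>"
proof -
  have "set (concat ws) \<subseteq> set v \<and> (distinct v \<longrightarrow> distinct (concat ws)) \<and>
    (\<forall>w\<in>set ws. B w \<and> (\<exists>\<alpha> \<gamma>. v = \<alpha> @ w @ \<gamma>))"
    using assms
  proof (induction G B ps ws v rule: factors.induct)
    case (2 G B p ps w' ws v)
    then obtain v' where v': "v = p @ w' @ v'" "B w'" "factors G B ps ws v'" by auto
    note IH = "2.IH"[OF v'(3)]
    have "\<exists>\<alpha> \<gamma>. v = \<alpha> @ w @ \<gamma>" if w: "w \<in> set (w' # ws)" for w
    proof (cases "w = w'")
      case True
      then show ?thesis using v'(1) by blast
    next
      case False
      then obtain \<alpha> \<gamma> where "v' = \<alpha> @ w @ \<gamma>" using IH w by auto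
      then have "v = (p @ w' @ \<alpha>) @ w @ \<gamma>" using v'(1) by simp
      then show ?thesis by blast
    qed
    moreover have "set (concat ws) \<subseteq> set v'" "distinct v' \<longrightarrow> distinct (concat ws)" "\<forall>w\<in>set ws. B w"
      using IH by blast+
    ultimately show ?case using v'(1,2) by (auto simp del: set_concat)
  qed auto
  then show "set (concat ws) \<subseteq> set v" "distinct v \<Longrightarrow> distinct (concat ws)" "w \<in> set ws \<Longrightarrow> B w"
    "w \<in> set ws \<Longrightarrow> \<exists>\<alpha> \<gamma>. v = \<alpha> @ w @ \<gamma>"
    by blast+
qed

lemma factors_set:
  assumes "factors G B ps ws v"
  shows "set v = set (concat ps) \<union> set (concat ws) \<and>
    (distinct v \<longrightarrow> set (concat ps) \<inter> set (concat ws) = {})"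
  using assms
proof (induction G B ps ws v rule: factors.induct)
  case (2 G B p ps w ws v)
  then obtain v' where v': "v = p @ w @ v'" "factors G B ps ws v'" by auto
  have "set v' = set (concat ps) \<union> set (concat ws)"
    "distinct v' \<longrightarrow> set (concat ps) \<inter> set (concat ws) = {}"
    using "2.IH"[OF v'(2)] by blast+
  then show ?case
    unfolding v'(1) by (auto simp del: set_concat)
qed auto

section \<open>The arcs determine the factorization\<close>

definition block_arcs :: "'a list list \<Rightarrow> ('a \<times> 'a) set" where
  "block_arcs ws = {(hd w, last w) | w. w \<in> set ws \<and> hd w \<noteq> last w}"

lemma block_arcs_Cons:
  "block_arcs (w # ws) = (if hd w \<noteq> last w then {(hd w, last w)} else {}) \<union> block_arcs ws"
  by (auto simp: block_arcs_def)

lemma block_arcs_set: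
  assumes "factors G B ps ws v" "(i, j) \<in> block_arcs ws" "\<And>w. B w \<Longrightarrow> w \<noteq> []"
  shows "i \<in> set v"
proof -
  obtain w where w: "w \<in> set ws" "i = hd w" using assms(2) by (auto simp: block_arcs_def)
  then have "w \<noteq> []" using factors_blocks(3)[OF assms(1)] assms(3) by blast
  then have "i \<in> set w" using w by simp
  then show ?thesis using factors_blocks(1)[OF assms(1)] w(1) by auto
qed

text \<open>Read the word from the left. The arcs tell whether the first letter opens a longer block
  and where that block ends; if no arc starts there, \<open>G\<close> decides between a one-letter
  block and a gap letter.\<close>

lemma factors_unique:
  assumes B: "\<And>w. B w \<Longrightarrow> w \<noteq> [] \<and> (hd w = last w \<longrightarrow> w = [hd w] \<and> \<not> G (hd w))"
    and "distinct v" "factors G B ps ws v" "factors G B ps' ws' v" "block_arcs ws = block_arcs ws'"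
  shows "ps = ps' \<and> ws = ws'"
  using assms(2-)
proof (induction "length v" arbitrary: v ps ws ps' ws' rule: less_induct)
  case less
  have B0: "\<not> B []" using B by blast
  have Bne: "B w \<Longrightarrow> w \<noteq> []" for w using B by blast
  obtain p qs where ps: "ps = p # qs" using factors_ne[OF less.prems(2)] by (cases ps) auto
  obtain p' qs' where ps': "ps' = p' # qs'" using factors_ne[OF less.prems(3)] by (cases ps') auto
  show ?case
  proof (cases v)
    case Nil
    then have "(ps, ws) \<in> factorings G B []" "(ps', ws') \<in> factorings G B []"
      using less.prems by (auto simp: factorings_def)
    then show ?thesis by (simp add: factorings_Nil[of B, OF B0])
  next
    case (Cons c v')
    have c: "c \<notin> set v'" and d: "distinct v'" using less.prems(1) Cons by auto
    \<comment> \<open>If \<open>c\<close> opens a block in one factorization and lies in a gap in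
      the other, then \<open>G c\<close> rules out a one-letter block, so an arc starts at
      \<open>c\<close>. In the other factorization all arcs start in the rest of the word.\<close>
    have mixed: False if gap_first: "factors G B ((c1 # r) # rs) us (c # v')"
      and block_first: "factors G B ([] # rs') us' (c # v')"
      and sub: "block_arcs us' \<subseteq> block_arcs us" for c1 r rs us rs' us'
    proof -
      have gap: "G c" "factors G B (r # rs) us v'" using gap_first by (auto simp only: factors_Cons_gap)
      obtain w us1 v1 where w: "us' = w # us1" "w \<noteq> []" "c # v' = w @ v1" "B w"
        using factors_Cons_block[OF block_first B0] by metis
      have "hd w = c" using w(2,3) by (cases w) auto
      then have "hd w \<noteq> last w" using B[OF w(4)] gap(1) by auto
      then have "(c, last w) \<in> block_arcs us"
        using sub w(1) \<open>hd w = c\<close> by (auto simp: block_arcs_Cons)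
      then show False using block_arcs_set[OF gap(2) _ Bne] c by blast
    qed
    show ?thesis
    proof (cases p)
      case p: (Cons c1 r)
      show ?thesis
      proof (cases p')
        case Nil
        then show ?thesis using mixed less.prems p Cons ps ps' by blast
      next
        case p': (Cons c2 r')
        have "c1 = c" "factors G B (r # qs) ws v'" "c2 = c" "factors G B (r' # qs') ws' v'"
          using less.prems(2,3) unfolding ps ps' p p' Cons factors_Cons_gap by auto
        then show ?thesis
          using less.hyps[of v' "r # qs" ws "r' # qs'" ws'] d less.prems(4) Cons p p' ps ps' by simp
      qed
    next
      case p: Nil
      show ?thesis
      proof (cases p')
        case p': (Cons c2 r')
        then show ?thesis using mixed less.prems p Cons ps ps' by blast
      next
        case p': Nil
        obtain w us v1 where w: "ws = w # us" "w \<noteq> []" "c # v' = w @ v1" "B w" "factors G B qs us v1"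
          using factors_Cons_block[of G B qs ws c v'] B0 less.prems(2) ps p Cons by metis
        obtain w' us' v1' where w': "ws' = w' # us'" "w' \<noteq> []" "c # v' = w' @ v1'" "B w'" "factors G B qs' us' v1'"
          using factors_Cons_block[of G B qs' ws' c v'] B0 less.prems(3) ps' p' Cons by metis
        have hd: "hd w = c" "hd w' = c" using w(2,3) w'(2,3) by (cases w; cases w'; auto)+
        have dd: "distinct (w @ v1)" "distinct (w' @ v1')"
          using less.prems(1) Cons w(3) w'(3) by metis+
        have c1: "c \<notin> set v1" "c \<notin> set v1'"
          using dd hd w(2) w'(2) hd_in_set[of w] hd_in_set[of w'] by auto
        have nsrc: "(c, x) \<notin> block_arcs us" "(c, x) \<notin> block_arcs us'" for x
          using block_arcs_set[OF w(5) _ Bne] block_arcs_set[OF w'(5) _ Bne] c1 by blast+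
        let ?A = "(if c \<noteq> last w then {(c, last w)} else {}) \<union> block_arcs us"
        let ?A' = "(if c \<noteq> last w' then {(c, last w')} else {}) \<union> block_arcs us'"
        have arcs: "?A = ?A'"
          using less.prems(4) unfolding w(1) w'(1) block_arcs_Cons hd .
        \<comment> \<open>Only the first block can have an arc starting at \<open>c\<close>, so the
          target of this arc, or its absence, is common to both factorizations.\<close>
        have "last w = last w'"
        proof (cases "c = last w")
          case True
          then have "(c, last w') \<notin> ?A"
            using nsrc by simp
          then show ?thesis using True unfolding arcs by (auto split: if_splits)
        next
          case False
          then have "(c, last w) \<in> ?A'"
            unfolding arcs[symmetric] by simp
          then show ?thesis using nsrc by (auto split: if_splits)
        qed
        then have "(c # v') ! (length w - 1) = (c # v') ! (length w' - 1)"
          using w(2,3) w'(2,3) by (metis diff_less last_conv_nth length_greater_0_conv nth_append zero_less_one)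
        moreover have "length w - 1 < length (c # v')" "length w' - 1 < length (c # v')"
        proof -
          have "length w > 0" "length w' > 0" using w(2) w'(2) by auto
          moreover have "length (c # v') = length w + length v1" "length (c # v') = length w' + length v1'"
            using w(3) w'(3) by (metis length_append)+
          ultimately show "length w - 1 < length (c # v')" "length w' - 1 < length (c # v')"
            by linarith+
        qed
        ultimately have "length w - 1 = length w' - 1"
          using less.prems(1) Cons by (metis nth_eq_iff_index_eq)
        then have len: "length w = length w'" using w(2) w'(2) by (cases w; cases w') auto
        then have ww: "w = w'" "v1 = v1'" using w(3) w'(3) by (metis append_eq_append_conv)+
        have "block_arcs us = block_arcs us'"
        proof -
          have "block_arcs us = ?A - {(c, last w)}"
            using nsrc by auto
          also have "\<dots> = ?A' - {(c, last w)}"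
            using arcs by simp
          also have "\<dots> = block_arcs us'" using nsrc ww by auto
          finally show ?thesis .
        qed
        moreover have "length v1 < length v"
          using w(2,3) Cons by (metis append_eq_conv_conj drop_eq_Nil length_append length_greater_0_conv less_add_same_cancel2)
        ultimately have "qs = qs' \<and> us = us'"
          using less.hyps[of v1 qs us qs' us'] w(5) w'(5) ww dd by simp
        then show ?thesis using ps ps' p p' w(1) w'(1) ww by simp
      qed
    qed
  qed
qed

section \<open>Comparison with the formula\<close>

definition gap_word :: "'a letter \<Rightarrow> 'a list list \<Rightarrow> 'a list list \<Rightarrow> nat \<Rightarrow> 'a letter list" where
  "gap_word x ps ws i = [if i = 0 then x else Letter (last (ws ! (i - 1)))] @ map Letter (ps ! i) @
      [if i = length ws then Bot else Letter (hd (ws ! i))]"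

context two_orders
begin

lemma factor_weight_prod:
  assumes "factors G B ps ws v"
  shows "factor_weight x ps ws = (\<Prod>i\<le>length ws. gap_weight ext_less t (gap_word x ps ws i)) *
    (\<Prod>w\<leftarrow>ws. - t * block_value w)"
  using assms
proof (induction G B ps ws v arbitrary: x rule: factors.induct)
  case (1 G B p v)
  then show ?case by (simp add: gap_word_def)
next
  case (2 G B p ps w ws v)
  have "gap_word x (p # ps) (w # ws) (Suc i) = gap_word (Letter (last w)) ps ws i" for i
    by (cases i) (simp_all add: gap_word_def)
  moreover obtain v' where "factors G B ps ws v'" "v = p @ w @ v'" using 2 by auto
  ultimately show ?case
    using "2.IH"[of v' "Letter (last w)"]
    by (simp add: prod.atMost_Suc_shift mult_ac del: prod.atMost_Suc) (simp add: gap_word_def)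
qed auto

lemma factor_weight_zpoly:
  assumes f: "factors G B ps ws v"
  shows "factor_weight Top ps ws = (-1) ^ (length ws + total_gap ps) * t ^ length ws *
    zpoly \<tau> ps ws t * (\<Prod>w\<leftarrow>ws. block_value w)"
proof -
  define mt where "mt = (\<lambda>i. runs_mt (gap_runs \<tau> ps ws i))"
  define io where "io = (\<lambda>i. runs_io (gap_runs \<tau> ps ws i))"
  define n where "n = (\<lambda>i. length (ps ! i))"
  have runs: "gap_runs \<tau> ps ws i = rising_runs ext_less (gap_word Top ps ws i)" for i
    by (simp add: gap_runs_def gap_word_def)
  have len: "length (gap_word Top ps ws i) = n i + 2" for i by (simp add: gap_word_def n_def)
  have le: "mt i + io i \<le> n i" and gw: "gap_weight ext_less t (gap_word Top ps ws i) =
      (-1) ^ n i * ((t - 1) ^ mt i * t ^ (n i - mt i - io i) * (t + 1) ^ io i)" for i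
    using gap_weight_runs[of "gap_word Top ps ws i" ext_less t] by (simp_all add: mt_def io_def len runs)
  have mt: "stat_mt \<tau> ps ws = (\<Sum>i\<le>length ws. mt i)" by (simp add: stat_mt_def mt_def runs_mt_def)
  have io: "stat_io \<tau> ps ws = (\<Sum>i\<le>length ws. io i)" by (simp add: stat_io_def io_def runs_io_def)
  have tg: "total_gap ps = (\<Sum>i\<le>length ws. n i)"
    using factors_length[OF f]
    by (simp add: total_gap_def sum_list_sum_nth n_def atLeast0LessThan lessThan_Suc_atMost)
  \<comment> \<open>Since \<open>mt i + io i\<close> is at most \<open>n i\<close> for each gap,
    truncated subtraction commutes with the sum.\<close>
  have "(\<Sum>i\<le>length ws. n i - mt i - io i) = (\<Sum>i\<le>length ws. n i - (mt i + io i))" by simp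
  also have "\<dots> = total_gap ps - (stat_mt \<tau> ps ws + stat_io \<tau> ps ws)"
    unfolding tg mt io sum.distrib[symmetric] by (rule sum_subtractf_nat) (use le in auto)
  finally have rst: "stat_rst \<tau> ps ws = (\<Sum>i\<le>length ws. n i - mt i - io i)"
    by (simp add: stat_rst_def)
  have "(\<Prod>w\<leftarrow>ws. - t * block_value w) = (-1) ^ length ws * t ^ length ws * (\<Prod>w\<leftarrow>ws. block_value w)"
    by (induction ws) (auto simp: algebra_simps)
  moreover have "(\<Prod>i\<le>length ws. gap_weight ext_less t (gap_word Top ps ws i)) =
    (-1) ^ total_gap ps * zpoly \<tau> ps ws t"
    unfolding gw prod.distrib zpoly_def rst unfolding tg mt io power_sum by simp
  ultimately show ?thesis
    unfolding factor_weight_prod[OF f] by (simp add: power_add mult_ac)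
qed

text \<open>Blocks are increasing, so a block containing the minimum starts with it and a block
  containing the maximum ends with it. The condition on the ends thus says that no gap contains an
  extreme letter, which is a condition on single letters and suits the recursion.\<close>

lemma is_factorization_iff:
  "is_factorization \<tau> \<rho> \<mu> ps ws \<longleftrightarrow> (ps, ws) \<in> facs \<rho> \<and> \<mu> = block_arcs ws"
proof -
  have eq: "(\<forall>w \<in> set ws. is_block w) \<longleftrightarrow>
     (\<forall>w \<in> set ws. w \<noteq> [] \<and> (hd w = last w \<longrightarrow> w = [hd w] \<and> hd w \<in> {lo, hi})) \<and>
     (\<forall>w \<in> set ws. increasing w)"
    by (auto simp: is_block_def)
  have ends: "(lo \<in> hd ` set ws \<and> hi \<in> last ` set ws) \<longleftrightarrow> (\<forall>p\<in>set ps. \<forall>x\<in>set p. x \<notin> {lo, hi})"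
    if blocks: "\<forall>w \<in> set ws. is_block w" and len: "length ps = length ws + 1"
      and \<rho>: "\<rho> = hd ps @ concat (map2 (@) ws (tl ps))"
  proof -
    have "factors (\<lambda>_. True) is_block ps ws \<rho>"
      unfolding factors_iff using that by simp
    note parts = factors_set[OF this, THEN conjunct1] factors_set[OF this, THEN conjunct2, rule_format, OF distinct_\<rho>]
    show ?thesis
    proof
      assume ends: "lo \<in> hd ` set ws \<and> hi \<in> last ` set ws"
      then obtain w w' where w: "w \<in> set ws" "lo = hd w" "w' \<in> set ws" "hi = last w'" by blast
      then have "lo \<in> set w" "hi \<in> set w'" using blocks by (simp_all add: is_block_def)
      then have "lo \<in> set (concat ws)" "hi \<in> set (concat ws)" using w(1,3) by auto
      then show "\<forall>p\<in>set ps. \<forall>x\<in>set p. x \<notin> {lo, hi}" using parts(2) by auto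
    next
      assume gaps: "\<forall>p\<in>set ps. \<forall>x\<in>set p. x \<notin> {lo, hi}"
      have "lo \<in> set \<rho>" "hi \<in> set \<rho>" using lo_hi_in set_\<rho> by auto
      then have "lo \<in> set (concat ws)" "hi \<in> set (concat ws)" using gaps unfolding parts(1) by auto
      then obtain w w' where w: "w \<in> set ws" "lo \<in> set w" "w' \<in> set ws" "hi \<in> set w'" by auto
      have inc: "increasing w" "increasing w'" "w \<noteq> []" "w' \<noteq> []"
        using blocks w by (auto simp: is_block_def)
      have "hd w = lo" using inc(1,3) w(2) not_precedes_lo by (cases w) auto
      moreover have "last w' = hi" using inc(2,4) w(4) not_hi_precedes
        by (cases w' rule: rev_cases) (auto simp: sorted_wrt_append)
      ultimately show "lo \<in> hd ` set ws \<and> hi \<in> last ` set ws" using w(1,3) by (metis imageI)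
    qed
  qed
  show ?thesis
  proof
    assume fac: "is_factorization \<tau> \<rho> \<mu> ps ws"
    then have blocks: "\<forall>w \<in> set ws. is_block w" and len: "length ps = length ws + 1"
      and \<rho>: "\<rho> = hd ps @ concat (map2 (@) ws (tl ps))" and \<mu>: "\<mu> = block_arcs ws"
      and lohi: "lo \<in> hd ` set ws \<and> hi \<in> last ` set ws"
      unfolding eq is_factorization_def block_arcs_def by blast+
    then have "factors (\<lambda>x. x \<notin> {lo, hi}) is_block ps ws \<rho>"
      unfolding factors_iff using ends[OF blocks len \<rho>] by (intro conjI) blast+
    then show "(ps, ws) \<in> facs \<rho> \<and> \<mu> = block_arcs ws" using \<mu> by (simp add: factorings_def)
  next
    assume fac: "(ps, ws) \<in> facs \<rho> \<and> \<mu> = block_arcs ws"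
    then have "factors (\<lambda>x. x \<notin> {lo, hi}) is_block ps ws \<rho>" by (simp add: factorings_def)
    then have blocks: "\<forall>w \<in> set ws. is_block w" and len: "length ps = length ws + 1"
      and \<rho>: "\<rho> = hd ps @ concat (map2 (@) ws (tl ps))" and gaps: "\<forall>p\<in>set ps. \<forall>x\<in>set p. x \<notin> {lo, hi}"
      unfolding factors_iff by blast+
    have lohi: "lo \<in> hd ` set ws \<and> hi \<in> last ` set ws" using ends[OF blocks len \<rho>] gaps by blast
    then have "1 \<le> length ws" by (cases ws) auto
    then show "is_factorization \<tau> \<rho> \<mu> ps ws"
      unfolding is_factorization_def
      using lohi len \<rho> blocks[unfolded eq] fac[THEN conjunct2, unfolded block_arcs_def] by (intro conjI) blast+
  qed
qed

lemma factorization_eq: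
  assumes "(ps, ws) \<in> facs \<rho>"
  shows "factorization \<tau> \<rho> (block_arcs ws) = (ps, ws)"
  unfolding factorization_def
proof (rule the_equality)
  show "case (ps, ws) of (ps', ws') \<Rightarrow> is_factorization \<tau> \<rho> (block_arcs ws) ps' ws'"
    using assms by (simp add: is_factorization_iff)
  fix x assume "case x of (ps', ws') \<Rightarrow> is_factorization \<tau> \<rho> (block_arcs ws) ps' ws'"
  then obtain ps' ws' where x: "x = (ps', ws')" "(ps', ws') \<in> facs \<rho>" "block_arcs ws = block_arcs ws'"
    by (auto simp: is_factorization_iff)
  have "ps = ps' \<and> ws = ws'"
    using assms x by (intro factors_unique[OF _ distinct_\<rho>]) (auto simp: factorings_def is_block_def)
  then show "x = (ps, ws)" using x by simp
qed

lemma is_block_cases: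
  assumes "is_block w"
  obtains a where "w = [a]" "hd w = last w" | a \<psi> b where "w = a # \<psi> @ [b]" "hd w \<noteq> last w"
proof (cases "hd w = last w")
  case True
  then show thesis using assms that(1) unfolding is_block_def by metis
next
  case False
  then obtain a w' where w: "w = a # w'" "w' \<noteq> []" using assms by (cases w) (auto simp: is_block_def split: if_splits)
  then have "w = a # butlast w' @ [last w']" by simp
  then show thesis using that(2) False by blast
qed

lemma block_arcs_set_partitions:
  assumes "(ps, ws) \<in> facs \<rho>"
  shows "block_arcs ws \<in> set_partitions \<rho> \<inter> set_partitions \<tau>"
proof -
  have f: "factors (\<lambda>x. x \<notin> {lo, hi}) is_block ps ws \<rho>" using assms by (simp add: factorings_def)
  have dc: "distinct (concat ws)" using factors_blocks(2)[OF f distinct_\<rho>] .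
  have prec: "precedes \<rho> i j \<and> precedes \<tau> i j" if ij: "(i, j) \<in> block_arcs ws" for i j
  proof -
    obtain w where w: "w \<in> set ws" "i = hd w" "j = last w" "hd w \<noteq> last w"
      using ij by (auto simp: block_arcs_def)
    have b: "is_block w" using factors_blocks(3)[OF f w(1)] .
    obtain \<psi> where \<psi>: "w = i # \<psi> @ [j]" using is_block_cases[OF b] w by (metis last.simps last_snoc list.sel(1) snoc_eq_iff_butlast)
    obtain \<alpha> \<gamma> where "\<rho> = \<alpha> @ w @ \<gamma>" using factors_blocks(4)[OF f w(1)] by blast
    then have "precedes \<rho> i j" using \<psi> by auto
    moreover have "precedes \<tau> i j" using b \<psi> by (auto simp: is_block_def)
    ultimately show ?thesis ..
  qed
  have same: "w = w'" if "w \<in> set ws" "w' \<in> set ws" "hd w = hd w' \<or> last w = last w'" for w w'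
  proof -
    have "w \<noteq> []" "w' \<noteq> []" using factors_blocks(3)[OF f] that(1,2) by (auto simp: is_block_def)
    then have "hd w \<in> set w" "last w \<in> set w" "hd w' \<in> set w'" "last w' \<in> set w'" by auto
    then show ?thesis using distinct_concat_eq[OF dc that(1,2)] that(3) by metis
  qed
  have fwd: "j = k" if "(i, j) \<in> block_arcs ws" "(i, k) \<in> block_arcs ws" for i j k
    using that same unfolding block_arcs_def by blast
  have bwd: "i = j" if "(i, k) \<in> block_arcs ws" "(j, k) \<in> block_arcs ws" for i j k
    using that same unfolding block_arcs_def by blast
  show ?thesis using prec fwd bwd by (intro IntI set_partitionsI) blast+
qed

text \<open>A supercharacter is a product over its arcs, and blocks with disjoint letters have
  different arcs. One-letter blocks have no arc and contribute 1, so the product runs over all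
  blocks.\<close>

lemma supervalue_block_arcs:
  assumes fac: "(ps, ws) \<in> facs \<rho>" and q: "q = of_nat N" "N > 0"
  shows "supervalue N \<rho> (block_arcs ws) \<nu> = (\<Prod>w\<leftarrow>ws. block_value w)"
proof -
  have f: "factors (\<lambda>x. x \<notin> {lo, hi}) is_block ps ws \<rho>" using fac by (simp add: factorings_def)
  have dc: "distinct (concat ws)" using factors_blocks(2)[OF f distinct_\<rho>] .
  have blocks: "is_block w" if "w \<in> set ws" for w using factors_blocks(3)[OF f that] .
  have "[] \<notin> set ws" using blocks by (auto simp: is_block_def)
  then have dws: "distinct ws" using dc distinct_concat_iff[of ws] by (metis removeAll_id)
  let ?W = "{w \<in> set ws. hd w \<noteq> last w}"
  have inj: "inj_on (\<lambda>w. (hd w, last w)) ?W"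
  proof (rule inj_onI)
    fix w w' assume "w \<in> ?W" "w' \<in> ?W" "(hd w, last w) = (hd w', last w')"
    moreover from this have "w \<noteq> []" "w' \<noteq> []" using blocks by (auto simp: is_block_def)
    moreover from calculation have "hd w \<in> set w" "hd w \<in> set w'"
      using hd_in_set[of w] hd_in_set[of w'] by auto
    ultimately show "w = w'" using distinct_concat_eq[OF dc, of w w' "hd w"] by auto
  qed
  have arcs: "block_arcs ws = (\<lambda>w. (hd w, last w)) ` ?W" by (auto simp: block_arcs_def)
  have single: "supervalue N \<rho> {(hd w, last w)} \<nu> = block_value w" if w: "w \<in> ?W" for w
  proof -
    obtain a \<psi> b where \<psi>: "w = a # \<psi> @ [b]"
      using is_block_cases[OF blocks, of w] w by blast
    obtain \<alpha> \<gamma> where \<rho>: "\<rho> = \<alpha> @ w @ \<gamma>" using factors_blocks(4)[OF f, of w] w by blast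
    have d: "distinct (\<alpha> @ (a # \<psi> @ [b]) @ \<gamma>)" using distinct_\<rho> \<rho> \<psi> by metis
    have a: "precedes (\<alpha> @ (a # \<psi> @ [b]) @ \<gamma>) a j \<longleftrightarrow> j \<in> set \<psi> \<union> {b} \<union> set \<gamma>" for j
      using d by (auto dest: precedes_in_set)
    have b: "precedes (\<alpha> @ (a # \<psi> @ [b]) @ \<gamma>) j b \<longleftrightarrow> j \<in> set \<alpha> \<union> {a} \<union> set \<psi>" for j
      using d by (auto dest: precedes_in_set)
    \<comment> \<open>A block is a contiguous piece of \<open>\<rho>\<close>, so the letters between
      its ends with respect to \<open>\<rho>\<close> are exactly its inner letters.\<close>
    have between: "set \<psi> = {j. precedes \<rho> a j \<and> precedes \<rho> j b}"
      unfolding \<rho> \<psi> a b using d by auto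
    have "precedes \<rho> a b" unfolding \<rho> \<psi> a by simp
    then have "supervalue N \<rho> {(a, b)} \<nu> = arc_value (of_nat N) a b (set \<psi>) \<nu>"
      using supervalue_single[OF distinct_\<rho> _ \<nu> q(2) between] by blast
    then show ?thesis by (simp add: \<psi> block_value_def q(1)[symmetric])
  qed
  have "supervalue N \<rho> (block_arcs ws) \<nu> = (\<Prod>x\<in>block_arcs ws. supervalue N \<rho> {x} \<nu>)"
    using finite_set_partition[OF \<nu>] q(2) arcs by (intro supervalue_prod) auto
  also have "\<dots> = (\<Prod>w\<in>?W. supervalue N \<rho> {(hd w, last w)} \<nu>)"
    unfolding arcs by (subst prod.reindex[OF inj]) simp
  also have "\<dots> = (\<Prod>w\<in>?W. block_value w)" using single by (intro prod.cong) auto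
  also have "\<dots> = (\<Prod>w\<in>set ws. block_value w)"
  proof (rule prod.mono_neutral_left)
    show "\<forall>w\<in>set ws - ?W. block_value w = 1"
    proof
      fix w assume w: "w \<in> set ws - ?W"
      then obtain a where "w = [a]" using is_block_cases[OF blocks, of w] by blast
      then show "block_value w = 1" by (simp add: block_value_def)
    qed
  qed auto
  also have "\<dots> = (\<Prod>w\<leftarrow>ws. block_value w)" using dws by (simp add: prod.distinct_set_conv_list)
  finally show ?thesis .
qed

lemma sum_factorizations:
  "(\<Sum>\<mu>\<in>{\<mu> \<in> set_partitions \<rho> \<inter> set_partitions \<tau>. \<exists>ps ws. is_factorization \<tau> \<rho> \<mu> ps ws}.
      f (factorization \<tau> \<rho> \<mu>) \<mu>) = (\<Sum>(ps, ws)\<in>facs \<rho>. f (ps, ws) (block_arcs ws))"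
  (is "(\<Sum>\<mu>\<in>?M. _) = _")
proof (rule sum.reindex_bij_witness[where i = "\<lambda>(ps, ws). block_arcs ws" and j = "factorization \<tau> \<rho>"])
  fix \<mu> assume "\<mu> \<in> ?M"
  then obtain ps ws where "(ps, ws) \<in> facs \<rho>" "\<mu> = block_arcs ws" by (auto simp: is_factorization_iff)
  then show "(case factorization \<tau> \<rho> \<mu> of (ps, ws) \<Rightarrow> block_arcs ws) = \<mu>" "factorization \<tau> \<rho> \<mu> \<in> facs \<rho>"
    "(case factorization \<tau> \<rho> \<mu> of (ps, ws) \<Rightarrow> f (ps, ws) (block_arcs ws)) = f (factorization \<tau> \<rho> \<mu>) \<mu>"
    by (simp_all add: factorization_eq)
next
  fix x assume "x \<in> facs \<rho>"
  then obtain ps ws where x: "x = (ps, ws)" "(ps, ws) \<in> facs \<rho>" by (cases x) auto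
  then have "is_factorization \<tau> \<rho> (block_arcs ws) ps ws" by (simp add: is_factorization_iff)
  then show "factorization \<tau> \<rho> (case x of (ps, ws) \<Rightarrow> block_arcs ws) = x"
    "(case x of (ps, ws) \<Rightarrow> block_arcs ws) \<in> ?M"
    using x factorization_eq block_arcs_set_partitions by auto
qed

text \<open>Both sides are compared after multiplication by \<open>t\<close>: the expansion gives
  one factor \<open>t\<close> per block, and cancelling one of them leaves the exponent
  \<open>length ws - 1\<close>.\<close>

lemma antipode_component:
  assumes q: "q = of_nat CARD('f::{finite,field})"
  shows "takeuchi (set \<tau>) (supercharacter \<tau> {(lo, hi)}) \<rho> (arc_mat (set \<tau>) \<nu> :: ('a, 'f) matr) =
    (\<Sum>\<mu>\<in>{\<mu> \<in> set_partitions \<rho> \<inter> set_partitions \<tau>. \<exists>ps ws. is_factorization \<tau> \<rho> \<mu> ps ws}.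
      (case factorization \<tau> \<rho> \<mu> of (ps, ws) \<Rightarrow>
         (-1) ^ (length ws + total_gap ps) * t ^ (length ws - 1) * zpoly \<tau> ps ws t) *
      supervalue CARD('f) \<rho> \<mu> \<nu>)" (is "?L = ?R")
proof -
  let ?f = "\<lambda>x \<mu>. (case x of (ps, ws) \<Rightarrow>
      (-1) ^ (length ws + total_gap ps) * t ^ (length ws - 1) * zpoly \<tau> ps ws t) *
    supervalue CARD('f) \<rho> \<mu> \<nu>"
  \<comment> \<open>A field contains 0 and 1, so \<open>q\<close> is at least 2 and \<open>t\<close>
    can be cancelled.\<close>
  have "CARD('f) \<ge> card {0, 1 :: 'f}" by (intro card_mono) auto
  then have t: "t \<noteq> 0" unfolding q by auto
  have "t * ?L = (\<Sum>(ps, ws)\<in>facs \<rho>. factor_weight Top ps ws)"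
    using takeuchi_supercharacter[OF q] cut_sum_eq_factor_sum by simp
  also have "\<dots> = (\<Sum>(ps, ws)\<in>facs \<rho>. t * (?f (ps, ws) (block_arcs ws)))"
  proof (rule sum.cong)
    fix x assume "x \<in> facs \<rho>"
    then obtain ps ws where x: "x = (ps, ws)" "(ps, ws) \<in> facs \<rho>" by (cases x) auto
    then have f: "factors (\<lambda>x. x \<notin> {lo, hi}) is_block ps ws \<rho>" by (simp add: factorings_def)
    have "is_factorization \<tau> \<rho> (block_arcs ws) ps ws" using x by (simp add: is_factorization_iff)
    \<comment> \<open>A factorization has at least one block, so the subtraction in the exponent is
      not truncated.\<close>
    then have "t ^ length ws = t * t ^ (length ws - 1)"
      by (cases ws) (auto simp: is_factorization_def)
    then show "(case x of (ps, ws) \<Rightarrow> factor_weight Top ps ws) =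
      (case x of (ps, ws) \<Rightarrow> t * (?f (ps, ws) (block_arcs ws)))"
      using factor_weight_zpoly[OF f] supervalue_block_arcs[OF x(2) q]
      by (simp add: x(1) mult_ac)
  qed simp
  also have "\<dots> = t * (\<Sum>(ps, ws)\<in>facs \<rho>. ?f (ps, ws) (block_arcs ws))"
    by (simp add: sum_distrib_left case_prod_unfold)
  also have "\<dots> = t * ?R"
    by (subst sum_factorizations[where f = ?f]) (rule refl)
  finally show ?thesis using t by simp
qed

end

theorem theorem6p8:
  fixes K :: "'a set" and \<tau> :: "'a list"
  assumes "finite K" and "card K \<ge> 2" and "\<tau> \<in> permutations_of_set K"
  shows "antipode K (supercharacter \<tau> {(hd \<tau>, last \<tau>)} :: ('a, 'f::{finite, field}) family) =
    (\<lambda>\<rho> u. \<Sum>\<phi> \<in> permutations_of_set K.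
       \<Sum>\<mu> \<in> {\<mu> \<in> set_partitions \<phi> \<inter> set_partitions \<tau>. \<exists>ps ws. is_factorization \<tau> \<phi> \<mu> ps ws}.
         (case factorization \<tau> \<phi> \<mu> of (ps, ws) \<Rightarrow>
            (-1) ^ (length ws + total_gap ps) * (of_nat CARD('f) - 1) ^ (length ws - 1)
              * zpoly \<tau> ps ws (of_nat CARD('f) - 1))
         * supercharacter \<phi> \<mu> \<rho> u)"
proof (intro ext)
  fix \<rho> and u :: "('a, 'f) matr"
  let ?\<chi> = "supercharacter \<tau> {(hd \<tau>, last \<tau>)} :: ('a, 'f) family"
  let ?M = "\<lambda>\<phi>. {\<mu> \<in> set_partitions \<phi> \<inter> set_partitions \<tau>. \<exists>ps ws. is_factorization \<tau> \<phi> \<mu> ps ws}"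
  let ?c = "\<lambda>\<phi> \<mu>. (case factorization \<tau> \<phi> \<mu> of (ps, ws) \<Rightarrow>
            (-1) ^ (length ws + total_gap ps) * (of_nat CARD('f) - 1) ^ (length ws - 1)
              * zpoly \<tau> ps ws (of_nat CARD('f) - 1))"
  have \<tau>: "distinct \<tau>" "set \<tau> = K" using assms(3) by (auto simp: permutations_of_set_def)
  have scfU: "?\<chi> \<in> scfU K" using supercharacter_scfU[OF assms(3)] .
  show "antipode K ?\<chi> \<rho> u = (\<Sum>\<phi>\<in>permutations_of_set K. \<Sum>\<mu>\<in>?M \<phi>. ?c \<phi> \<mu> * supercharacter \<phi> \<mu> \<rho> u)"
  proof (cases "\<rho> \<in> permutations_of_set K \<and> u \<in> unitri \<rho>")
    case False
    then have "supercharacter \<phi> \<mu> \<rho> u = 0" if "\<phi> \<in> permutations_of_set K" for \<phi> \<mu>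
      using that by (auto simp: supercharacter_def)
    then show ?thesis
      unfolding antipode_eq_takeuchi[OF assms(1) scfU] takeuchi_def if_not_P[OF False] by simp
  next
    case True
    then have \<rho>: "distinct \<rho>" "set \<rho> = K" "\<rho> \<in> permutations_of_set K" and u: "u \<in> unitri \<rho>"
      by (auto simp: permutations_of_set_def)
    define \<nu> where "\<nu> = superclass_index \<rho> u"
    have index: "\<nu> \<in> set_partitions \<rho>" "same_superclass \<rho> (arc_mat K \<nu>) u"
      using superclass_index[OF \<rho>(1) u] \<rho>(2) unfolding \<nu>_def by auto
    interpret two_orders \<tau> \<rho> \<nu> "of_nat CARD('f)"
      using \<tau> \<rho> assms(2) index(1) distinct_card[OF \<tau>(1)] by unfold_locales auto
    \<comment> \<open>Takeuchi's sum is constant on superclasses, so \<open>u\<close> may be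
      replaced by the arc matrix representing its class.\<close>
    have "antipode K ?\<chi> \<rho> u = takeuchi K ?\<chi> \<rho> (arc_mat K \<nu>)"
      using takeuchi_scfU[OF scfU] \<rho>(3) index(2)
      by (simp add: antipode_eq_takeuchi[OF assms(1) scfU] scfU_def scf_def)
    also have "\<dots> = (\<Sum>\<mu>\<in>?M \<rho>. ?c \<rho> \<mu> * supervalue CARD('f) \<rho> \<mu> \<nu>)"
      using antipode_component[where 'f = 'f] \<tau>(2) by simp
    also have "\<dots> = (\<Sum>\<phi>\<in>{\<rho>}. \<Sum>\<mu>\<in>?M \<phi>. ?c \<phi> \<mu> * supercharacter \<phi> \<mu> \<rho> u)"
      using u by (simp add: supercharacter_def \<nu>_def)
    also have "\<dots> = (\<Sum>\<phi>\<in>permutations_of_set K. \<Sum>\<mu>\<in>?M \<phi>. ?c \<phi> \<mu> * supercharacter \<phi> \<mu> \<rho> u)"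
      using \<rho>(3) by (intro sum.mono_neutral_left) (auto simp: supercharacter_def intro!: sum.neutral)
    finally show ?thesis .
  qed
qed

end
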